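(* Let $d\ge 1$, $k\ge 1$ be integers and let $c^2>0$, $b_1,\dots,b_k>0$ pairwise distinct, and $a_1,\dots,a_k\in\mathbb{R}\setminus\{0\}$ be constants. Let $A_j$ and $B$ be the constant matrices defined in the context. Then the operator $L=\partial_t+\sum_{j=1}^dA_j\partial_{x_j}$ is hyperbolic, and the Cauchy problem for the constant-coefficient operator $\mathcal{L}=\partial_t+\sum_{j=1}^dA_j\partial_{x_j}+B$ is strongly well-posed.
   Context: Set $n=kd+d+1$. Vectors are written in block form $U=(u,v,w_1,\dots,w_k)$ with $u$ scalar and $v,w_1,\dots,w_k$ having $d$ components. The $n\times n$ real matrices $A_1,\dots,A_d$ are defined by: for $\xi\in\mathbb{R}^d$, $A(\xi)=\sum_{j=1}^d\xi_jA_j$ satisfies $$A(\xi)(u,v,w_1,\dots,w_k)=(\xi\cdot v,\;c^2\xi u,\;-a_1\xi u,\dots,-a_k\xi u),$$ and $B$ is defined by $$B(u,v,w_1,\dots,w_k)=\Big(0,\;\sum_{i=1}^kw_i,\;b_1w_1,\dots,b_kw_k\Big).$$ The Cauchy problem is $\mathcal{L}U=\partial_tU+\sum_{j=1}^dA_j\partial_{x_j}U+BU=0$, $U(x,0)=U_0(x)$, $x\in\mathbb{R}^d$, $t\ge0$; on the (spatial) Fourier side it reads $\hat U_t+iA(\xi)\hat U+B\hat U=0$, $\hat U(\xi,0)=\hat U_0(\xi)$. Definition (hyperbolic): $L$ is called hyperbolic if $\sup_{\xi\in\mathbb{R}^d}\|e^{-iA(\xi)}\|<\infty$, where $\|M\|=\sup_{|x|=1}|Mx|$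 is the matrix norm induced by the Euclidean norm. Definition (strongly well-posed): the Cauchy problem for $\mathcal{L}$ is strongly well-posed if for any initial data $U_0\in L^2(\mathbb{R}^d)$ (with values in $n$-vectors) there is a unique solution $U\in\mathcal{C}(\mathbb{R}^+,L^2(\mathbb{R}^d))$ and it satisfies $$\|U(t)\|_{L^2(\mathbb{R}^d)}\le Ke^{\alpha t}\|U_0\|_{L^2(\mathbb{R}^d)},\qquad t\ge0,$$ with constants $K>0$ and $\alpha\in\mathbb{R}$ independent of $t$ and of $U_0$. *)

theory Defs
  imports "HOL-Analysis.Analysis"
begin

section \<open>Matrix exponential and hyperbolicity\<close>

text \<open>
  The product \<open>*\<close> on \<open>'a^'n^'n\<close> is entrywise, so the library's \<open>exp\<close> and \<open>^\<close> are not the ones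
  needed here.
\<close>

primrec matrix_power :: "complex^'n^'n \<Rightarrow> nat \<Rightarrow> complex^'n^'n" where
  "matrix_power M 0 = mat 1"
| "matrix_power M (Suc m) = M ** matrix_power M m"

definition matrix_exp :: "complex^'n^'n \<Rightarrow> complex^'n^'n" where
  "matrix_exp M = (\<Sum>m. (1 / fact m) *\<^sub>R matrix_power M m)"

definition symbol :: "('d::finite \<Rightarrow> real^'n^'n) \<Rightarrow> real^'d \<Rightarrow> real^'n^'n" where
  "symbol A \<xi> = (\<Sum>j\<in>UNIV. (\<xi> $ j) *\<^sub>R A j)"

definition hyperbolic :: "('d::finite \<Rightarrow> real^'n^'n) \<Rightarrow> bool" where
  "hyperbolic A \<longleftrightarrow>
     bdd_above (range (\<lambda>\<xi>::real^'d.
       onorm ((*v) (matrix_exp (map_matrix (\<lambda>x. - \<i> * complex_of_real x) (symbol A \<xi>))))))"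


section \<open>The Cauchy problem in \<open>L\<^sup>2\<close>\<close>

text \<open>
  Elements of \<open>L\<^sup>2(\<real>\<^sup>d)\<close> are given by Borel measurable representatives; equality in \<open>L\<^sup>2\<close> is
  equality almost everywhere.
\<close>

definition in_L2 :: "(real^'d \<Rightarrow> complex^'n) \<Rightarrow> bool" where
  "in_L2 f \<longleftrightarrow> f \<in> borel_measurable lborel \<and> integrable lborel (\<lambda>x. (norm (f x))\<^sup>2)"

definition L2_norm :: "(real^'d \<Rightarrow> complex^'n) \<Rightarrow> real" where
  "L2_norm f = sqrt (\<integral>x. (norm (f x))\<^sup>2 \<partial>lborel)"

primrec times_differentiable ::
    "nat \<Rightarrow> ('a::euclidean_space \<Rightarrow> 'b::real_normed_vector) \<Rightarrow> bool" where
  "times_differentiable 0 f \<longleftrightarrow> True"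
| "times_differentiable (Suc m) f \<longleftrightarrow>
     (\<forall>x. f differentiable (at x)) \<and>
     (\<forall>v. times_differentiable m (\<lambda>x. frechet_derivative f (at x) v))"

text \<open>
  The class \<open>C\<^sub>c\<^sup>\<infinity>((0,\<infinity>) \<times> \<real>\<^sup>d)\<close>, its members being extended by zero to all of space-time.
\<close>

definition test_function :: "(real \<times> (real^'d) \<Rightarrow> real) \<Rightarrow> bool" where
  "test_function \<phi> \<longleftrightarrow>
     (\<forall>m. times_differentiable m \<phi>) \<and>
     (\<exists>K. compact K \<and> K \<subseteq> {0<..} \<times> UNIV \<and> (\<forall>z. z \<notin> K \<longrightarrow> \<phi> z = 0))"

definition dt :: "(real \<times> (real^'d) \<Rightarrow> real) \<Rightarrow> real \<times> (real^'d) \<Rightarrow> real" where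
  "dt \<phi> z = frechet_derivative \<phi> (at z) (1, 0)"

definition dx :: "'d::finite \<Rightarrow> (real \<times> (real^'d) \<Rightarrow> real) \<Rightarrow> real \<times> (real^'d) \<Rightarrow> real" where
  "dx j \<phi> z = frechet_derivative \<phi> (at z) (0, axis j 1)"

abbreviation complex_matrix :: "real^'n^'m \<Rightarrow> complex^'n^'m" where
  "complex_matrix \<equiv> map_matrix complex_of_real"

text \<open>
  \<open>\<partial>\<^sub>t U + (\<Sum>j. A\<^sub>j \<partial>\<^sub>j U) + B U = 0\<close> in the sense of distributions on \<open>(0,\<infinity>) \<times> \<real>\<^sup>d\<close>; the
  tested equation is an identity between vectors. The integral is iterated because
  the representatives \<open>U t\<close> are chosen separately for each \<open>t\<close>, so that \<open>U\<close> need not be jointly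
  measurable; for \<open>U\<close> continuous in time with values in \<open>L\<^sup>2\<close> the inner integral exists and is a
  continuous, compactly supported function of \<open>t\<close>.
\<close>

definition distributional_solution ::
    "('d::finite \<Rightarrow> real^'n^'n) \<Rightarrow> real^'n^'n \<Rightarrow> (real \<Rightarrow> real^'d \<Rightarrow> complex^'n) \<Rightarrow> bool" where
  "distributional_solution A B U \<longleftrightarrow>
     (\<forall>\<phi>. test_function \<phi> \<longrightarrow>
        (LBINT t:{0<..}. \<integral>x.
             - dt \<phi> (t, x) *\<^sub>R U t x
             - (\<Sum>j\<in>UNIV. dx j \<phi> (t, x) *\<^sub>R (complex_matrix (A j) *v U t x))
             + \<phi> (t, x) *\<^sub>R (complex_matrix B *v U t x) \<partial>lborel) = 0)"

definition continuous_in_L2 :: "(real \<Rightarrow> real^'d \<Rightarrow> complex^'n) \<Rightarrow> bool" where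
  "continuous_in_L2 U \<longleftrightarrow>
     (\<forall>t\<ge>0. in_L2 (U t)) \<and>
     (\<forall>t\<ge>0. ((\<lambda>s. L2_norm (\<lambda>x. U s x - U t x)) \<longlongrightarrow> 0) (at t within {0..}))"

definition solves_cauchy_problem ::
    "('d::finite \<Rightarrow> real^'n^'n) \<Rightarrow> real^'n^'n \<Rightarrow> (real^'d \<Rightarrow> complex^'n)
      \<Rightarrow> (real \<Rightarrow> real^'d \<Rightarrow> complex^'n) \<Rightarrow> bool" where
  "solves_cauchy_problem A B U\<^sub>0 U \<longleftrightarrow>
     continuous_in_L2 U \<and> distributional_solution A B U \<and> (AE x in lborel. U 0 x = U\<^sub>0 x)"

definition strongly_well_posed ::
    "('d::finite \<Rightarrow> real^'n^'n) \<Rightarrow> real^'n^'n \<Rightarrow> bool" where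
  "strongly_well_posed A B \<longleftrightarrow>
     (\<exists>K>0. \<exists>\<alpha>::real. \<forall>U\<^sub>0 :: real^'d \<Rightarrow> complex^'n. in_L2 U\<^sub>0 \<longrightarrow>
        (\<exists>U. solves_cauchy_problem A B U\<^sub>0 U \<and>
             (\<forall>V. solves_cauchy_problem A B U\<^sub>0 V \<longrightarrow>
                    (\<forall>t\<ge>0. AE x in lborel. V t x = U t x)) \<and>
             (\<forall>t\<ge>0. L2_norm (U t) \<le> K * exp (\<alpha> * t) * L2_norm U\<^sub>0)))"


section \<open>The matrices \<open>A\<^sub>j\<close> and \<open>B\<close>\<close>

text \<open>
  Coordinates of \<open>\<real>\<^sup>n\<close>: one for \<open>u\<close>, \<open>d\<close> for \<open>v\<close>, and the pair \<open>(l, i)\<close> for the \<open>i\<close>-th component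
  of \<open>w\<^sub>l\<close>.
\<close>

type_synonym ('d, 'k) block_index = "unit + 'd + 'k \<times> 'd"

lemma card_block_index:
  "CARD(('d::finite, 'k::finite) block_index) = CARD('k) * CARD('d) + CARD('d) + 1"
  by simp

definition block :: "real \<Rightarrow> real^'d \<Rightarrow> ('k \<Rightarrow> real^'d) \<Rightarrow> real^('d::finite, 'k::finite) block_index"
  where "block u v w =
    (\<chi> r. case r of Inl _ \<Rightarrow> u | Inr (Inl i) \<Rightarrow> v $ i | Inr (Inr (l, i)) \<Rightarrow> w l $ i)"

definition u_part :: "real^('d::finite, 'k::finite) block_index \<Rightarrow> real" where
  "u_part U = U $ Inl ()"

definition v_part :: "real^('d::finite, 'k::finite) block_index \<Rightarrow> real^'d" where
  "v_part U = (\<chi> i. U $ Inr (Inl i))"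

definition w_part :: "real^('d::finite, 'k::finite) block_index \<Rightarrow> 'k \<Rightarrow> real^'d" where
  "w_part U l = (\<chi> i. U $ Inr (Inr (l, i)))"

definition A_map :: "real \<Rightarrow> ('k \<Rightarrow> real) \<Rightarrow> real^'d \<Rightarrow>
    real^('d::finite, 'k::finite) block_index \<Rightarrow> real^('d, 'k) block_index" where
  "A_map c a \<xi> U =
     block (\<xi> \<bullet> v_part U) ((c\<^sup>2 * u_part U) *\<^sub>R \<xi>) (\<lambda>l. (- a l * u_part U) *\<^sub>R \<xi>)"

definition B_map :: "('k \<Rightarrow> real) \<Rightarrow>
    real^('d::finite, 'k::finite) block_index \<Rightarrow> real^('d, 'k) block_index" where
  "B_map b U = block 0 (\<Sum>l\<in>UNIV. w_part U l) (\<lambda>l. b l *\<^sub>R w_part U l)"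

text \<open>As \<open>A(\<xi>)\<close> is linear in \<open>\<xi>\<close>, the matrix \<open>A\<^sub>j\<close> is that of \<open>A(e\<^sub>j)\<close>.\<close>

definition A_matrix :: "real \<Rightarrow> ('k \<Rightarrow> real) \<Rightarrow> 'd \<Rightarrow>
    real^('d::finite, 'k::finite) block_index^('d, 'k) block_index" where
  "A_matrix c a j = matrix (A_map c a (axis j 1))"

definition B_matrix :: "('k \<Rightarrow> real) \<Rightarrow>
    real^('d::finite, 'k::finite) block_index^('d, 'k) block_index" where
  "B_matrix b = matrix (B_map b)"

lemma block_parts [simp]:
  "u_part (block u v w) = u" "v_part (block u v w) = v" "w_part (block u v w) l = w l"
  by (simp_all add: u_part_def v_part_def w_part_def block_def vec_eq_iff)

lemma parts_add [simp]:
  "u_part (x + y) = u_part x + u_part y" "v_part (x + y) = v_part x + v_part y"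
  "w_part (x + y) l = w_part x l + w_part y l"
  by (simp_all add: u_part_def v_part_def w_part_def vec_eq_iff)

lemma parts_scaleR [simp]:
  "u_part (r *\<^sub>R x) = r * u_part x" "v_part (r *\<^sub>R x) = r *\<^sub>R v_part x"
  "w_part (r *\<^sub>R x) l = r *\<^sub>R w_part x l"
  by (simp_all add: u_part_def v_part_def w_part_def vec_eq_iff)

lemma block_add: "block u v w + block u' v' w' = block (u + u') (v + v') (\<lambda>l. w l + w' l)"
  by (auto simp: block_def vec_eq_iff split: sum.split)

lemma block_scaleR: "r *\<^sub>R block u v w = block (r * u) (r *\<^sub>R v) (\<lambda>l. r *\<^sub>R w l)"
  by (auto simp: block_def vec_eq_iff split: sum.split)

lemma linear_A_map: "linear (A_map c a \<xi>)"
  by (rule linearI)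
    (simp_all add: A_map_def block_add block_scaleR inner_add_right algebra_simps)

lemma linear_B_map: "linear (B_map b)"
  by (rule linearI)
    (simp_all add: B_map_def block_add block_scaleR sum.distrib scaleR_sum_right algebra_simps)

lemma linear_A_map_left: "linear (\<lambda>\<xi>. A_map c a \<xi> U)"
  by (rule linearI)
    (simp_all add: A_map_def block_add block_scaleR inner_add_left algebra_simps)

lemma symbol_A_matrix:
  "symbol (A_matrix c a) \<xi> *v block u v w =
     block (\<xi> \<bullet> v) ((c\<^sup>2 * u) *\<^sub>R \<xi>) (\<lambda>l. (- a l * u) *\<^sub>R \<xi>)"
proof -
  let ?U = "block u v w"
  have mult_sum: "sum M S *v ?U = (\<Sum>j\<in>S. M j *v ?U)" if "finite S"
    for M :: "'a \<Rightarrow> real^('a, 'b) block_index^('a, 'b) block_index" and S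
    using that by induction (simp_all add: matrix_vector_mult_add_rdistrib)
  have "symbol (A_matrix c a) \<xi> *v ?U = (\<Sum>j\<in>UNIV. (\<xi> $ j) *\<^sub>R A_map c a (axis j 1) ?U)"
    by (simp add: symbol_def A_matrix_def mult_sum scaleR_matrix_vector_assoc [symmetric]
        matrix_works linear_A_map)
  also have "\<dots> = A_map c a (\<Sum>j\<in>UNIV. (\<xi> $ j) *\<^sub>R axis j 1) ?U"
    by (simp add: linear_sum [OF linear_A_map_left] linear_cmul [OF linear_A_map_left])
  also have "(\<Sum>j\<in>UNIV. (\<xi> $ j) *\<^sub>R axis j 1) = \<xi>"
    using basis_expansion [of \<xi>] by (simp add: scalar_mult_eq_scaleR)
  finally show ?thesis
    by (simp add: A_map_def)
qed

lemma B_matrix_block: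
  "B_matrix b *v block u v w = block 0 (\<Sum>l\<in>UNIV. w l) (\<lambda>l. b l *\<^sub>R w l)"
  by (simp add: B_matrix_def matrix_works linear_B_map B_map_def)

end

theory Submission
  imports Defs
begin

text \<open>
  The system is symmetrizable. Put \<open>z\<^sub>l = w\<^sub>l + (a\<^sub>l / c\<^sup>2) v\<close>. In the equation for \<open>z\<^sub>l\<close> the two
  gradient terms cancel, so \<open>z\<^sub>l\<close> has no principal part, while the pair \<open>(c u, v)\<close> satisfies the
  symmetric wave system. Hence for the linear change of variables
  \<open>Q (u, v, w) = (c u, v, (w\<^sub>l + (a\<^sub>l / c\<^sup>2) v)\<^sub>l)\<close> all matrices \<open>Q\<^sup>T Q A\<^sub>j\<close> are symmetric. The rest
  of the argument is about any system with such a \<open>Q\<close>; the bounded term \<open>B\<close> enters through the growth rate.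

  Hyperbolicity. Since \<open>Q\<^sup>T Q A(\<xi>)\<close> is real and symmetric, \<open>\<bar>Q y\<bar>\<close> does not increase along
  solutions of \<open>y' = - i A(\<xi>) y\<close>, so \<open>e\<^bsup>-iA(\<xi>)\<^esup>\<close> is bounded by the condition number of \<open>Q\<close>.

  Existence. The proof avoids the Fourier transform. On \<open>L\<^sup>2\<close> the derivative \<open>\<partial>\<^sub>j\<close> is replaced by the
  centred difference quotient \<open>K\<^sub>j\<^sub>n\<close> of step \<open>1 / (n + 1)\<close>. These operators are bounded and skew, they
  commute with each other and with constant matrices, and they converge to \<open>\<partial>\<^sub>j\<close> on test functions.
  The bounded operator \<open>G\<^sub>n = - \<Sum>\<^sub>j A\<^sub>j K\<^sub>j\<^sub>n - B\<close> then satisfies the same energy estimate as the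
  differential operator, with a rate that does not depend on \<open>n\<close>. For a test function \<open>F\<close> the
  difference of \<open>e\<^bsup>tG\<^sub>m\<^esup> F\<close> and \<open>e\<^bsup>tG\<^sub>n\<^esup> F\<close> is controlled by \<open>(K\<^sub>j\<^sub>m - K\<^sub>j\<^sub>n) F\<close>, because the difference
  quotients commute with \<open>e\<^bsup>tG\<^sub>m\<^esup>\<close>; so the approximations form a Cauchy sequence. The uniform bounds and
  the density of the test functions in \<open>L\<^sup>2\<close> extend this to all initial data.

  Uniqueness. If \<open>V\<close> is a solution with \<open>V(0) = 0\<close> and \<open>F\<close> a test function, the derivative of
  \<open>\<langle>V(t), e\<^bsup>(T-t)G\<^sub>n*\<^esup> F\<rangle>\<close> involves only the error of replacing \<open>\<partial>\<^sub>j\<close> by \<open>K\<^sub>j\<^sub>n\<close> on \<open>F\<close>, which vanishes as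
  \<open>n \<rightarrow> \<infinity>\<close>. Hence \<open>V(T)\<close> is orthogonal to all test functions.

  Both arguments live in an abstract Hilbert space (\<open>ex_weak_solution\<close>, \<open>weak_solution_unique\<close>), where
  a solution is a continuous curve whose pairing with each test function satisfies an ordinary
  differential equation in time. For \<open>L\<^sup>2\<close> this notion agrees with that of a distributional solution:
  \<open>weak_solution_distributional\<close> is a product rule, and \<open>distributional_weak_solution\<close> follows from the
  lemma of du Bois-Reymond.
\<close>

section \<open>The exponential of a bounded operator\<close>

definition op_exp :: "('h::real_normed_vector \<Rightarrow> 'h) \<Rightarrow> real \<Rightarrow> 'h \<Rightarrow> 'h" where
  "op_exp G t x = (\<Sum>m. (t ^ m / fact m) *\<^sub>R (G ^^ m) x)"

lemma bounded_linear_funpow: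
  fixes G :: "'h::real_normed_vector \<Rightarrow> 'h"
  assumes "bounded_linear G"
  shows "bounded_linear (G ^^ m)"
proof (induction m)
  case 0
  show ?case by (simp add: id_def bounded_linear_ident)
next
  case (Suc m)
  show ?case using bounded_linear_compose [OF assms Suc] by (simp add: o_def)
qed

lemma norm_funpow_le:
  fixes G :: "'h::real_normed_vector \<Rightarrow> 'h"
  assumes "bounded_linear G"
  shows "norm ((G ^^ m) x) \<le> onorm G ^ m * norm x"
proof (induction m)
  case (Suc m)
  have "norm (G ((G ^^ m) x)) \<le> onorm G * norm ((G ^^ m) x)"
    by (rule onorm [OF assms])
  also have "\<dots> \<le> onorm G * (onorm G ^ m * norm x)"
    by (rule mult_left_mono [OF Suc onorm_pos_le [OF assms]])
  finally show ?case by (simp add: mult.assoc)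
qed simp

context
  fixes G :: "'h::banach \<Rightarrow> 'h"
  assumes G: "bounded_linear G"
begin

lemma op_exp_sums: "(\<lambda>m. (t ^ m / fact m) *\<^sub>R (G ^^ m) x) sums op_exp G t x"
proof -
  have "summable (\<lambda>m. (t ^ m / fact m) *\<^sub>R (G ^^ m) x)"
  proof (rule summable_comparison_test')
    show "summable (\<lambda>m. inverse (fact m) * (\<bar>t\<bar> * onorm G) ^ m * norm x)"
      by (intro summable_mult2 summable_exp)
    show "norm ((t ^ m / fact m) *\<^sub>R (G ^^ m) x) \<le> inverse (fact m) * (\<bar>t\<bar> * onorm G) ^ m * norm x" for m
      using mult_left_mono [OF norm_funpow_le [OF G, of m x], of "\<bar>t\<bar> ^ m / fact m"]
      by (simp add: power_mult_distrib power_abs field_simps)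
  qed
  thus ?thesis unfolding op_exp_def by (rule summable_sums)
qed

lemma op_exp_0 [simp]: "op_exp G 0 x = x"
proof -
  have "(\<lambda>m. (0 ^ m / fact m) *\<^sub>R (G ^^ m) x) = (\<lambda>m. if m = 0 then x else 0)"
    by (auto simp: fun_eq_iff)
  hence "(\<lambda>m. (0 ^ m / fact m) *\<^sub>R (G ^^ m) x) sums x"
    using sums_single [of 0 "\<lambda>_. x"] by simp
  thus ?thesis using op_exp_sums [of 0 x] sums_unique2 by blast
qed

text \<open>
  The source of all commutation properties of the approximate evolution: whatever commutes with the
  generator commutes with each term of the series.
\<close>

lemma op_exp_commute:
  assumes K: "bounded_linear K" and comm: "\<And>x. K (G x) = G (K x)"
  shows "K (op_exp G t x) = op_exp G t (K x)"
proof -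
  have *: "K ((G ^^ m) x) = (G ^^ m) (K x)" for m
    by (induction m) (simp_all add: comm)
  have "(\<lambda>m. K ((t ^ m / fact m) *\<^sub>R (G ^^ m) x)) sums K (op_exp G t x)"
    by (rule bounded_linear.sums [OF K op_exp_sums])
  thus ?thesis
    using op_exp_sums [of t "K x"]
    by (simp add: linear_cmul [OF bounded_linear.linear [OF K]] * sums_unique2)
qed

lemma op_exp_add: "op_exp G t (x + y) = op_exp G t x + op_exp G t y"
proof -
  have "(\<lambda>m. (t ^ m / fact m) *\<^sub>R (G ^^ m) (x + y)) sums (op_exp G t x + op_exp G t y)"
    using sums_add [OF op_exp_sums [of t x] op_exp_sums [of t y]]
    by (simp add: linear_add [OF bounded_linear.linear [OF bounded_linear_funpow [OF G]]] scaleR_add_right)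
  thus ?thesis using op_exp_sums sums_unique2 by blast
qed

lemma op_exp_scaleR: "op_exp G t (r *\<^sub>R x) = r *\<^sub>R op_exp G t x"
  using op_exp_commute [OF bounded_linear_scaleR_right [of r], of t x]
  by (simp add: linear_cmul [OF bounded_linear.linear [OF G]])

lemma op_exp_diff: "op_exp G t (x - y) = op_exp G t x - op_exp G t y"
  using op_exp_add [of t x "- 1 *\<^sub>R y"] op_exp_scaleR [of t "-1" y] by simp

text \<open>
  The series is differentiated term by term; the differentiated series is, up to a shift of the index,
  the series of \<open>op_exp G t (G x)\<close>, which converges uniformly for bounded \<open>t\<close>.
\<close>

lemma op_exp_has_vector_derivative:
  "((\<lambda>t. op_exp G t x) has_vector_derivative G (op_exp G t x)) (at t)"
proof -
  define R where "R = \<bar>t\<bar> + 1"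
  define f where "f m s = (s ^ m / fact m) *\<^sub>R (G ^^ m) x" for m and s :: real
  define f' where "f' m s = (real m * s ^ (m - 1) / fact m) *\<^sub>R (G ^^ m) x" for m and s :: real
  have deriv: "(f m has_derivative (\<lambda>h. h *\<^sub>R f' m s)) (at s within {-R..R})" for m s
    unfolding f_def f'_def
    by (auto intro!: derivative_eq_intros simp: fun_eq_iff)
  have shift: "(\<Sum>i<Suc n. f' i s) = (\<Sum>i<n. (s ^ i / fact i) *\<^sub>R (G ^^ i) (G x))" for n s
  proof -
    have "f' (Suc i) s = (s ^ i / fact i) *\<^sub>R (G ^^ i) (G x)" for i
      unfolding f'_def funpow_Suc_right o_def by (simp del: of_nat_Suc)
    moreover have "f' 0 s = 0" by (simp add: f'_def)
    ultimately show ?thesis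
      unfolding sum.lessThan_Suc_shift by simp
  qed
  have unif: "uniform_limit {-R..R} (\<lambda>n s. \<Sum>i<n. (s ^ i / fact i) *\<^sub>R (G ^^ i) (G x))
      (\<lambda>s. \<Sum>i. (s ^ i / fact i) *\<^sub>R (G ^^ i) (G x)) sequentially"
  proof (rule Weierstrass_m_test)
    show "summable (\<lambda>m. inverse (fact m) * (R * onorm G) ^ m * norm (G x))"
      by (intro summable_mult2 summable_exp)
    fix m s assume "s \<in> {-R..R}"
    hence "\<bar>s\<bar> \<le> R" by auto
    have "norm ((s ^ m / fact m) *\<^sub>R (G ^^ m) (G x)) = \<bar>s\<bar> ^ m / fact m * norm ((G ^^ m) (G x))"
      by (simp add: power_abs)
    also have "\<dots> \<le> R ^ m / fact m * (onorm G ^ m * norm (G x))"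
      using \<open>\<bar>s\<bar> \<le> R\<close>
      by (intro mult_mono norm_funpow_le [OF G] divide_right_mono power_mono) auto
    finally show "norm ((s ^ m / fact m) *\<^sub>R (G ^^ m) (G x)) \<le> inverse (fact m) * (R * onorm G) ^ m * norm (G x)"
      by (simp add: power_mult_distrib field_simps)
  qed
  have unif': "uniform_limit {-R..R} (\<lambda>n s. \<Sum>i<n. f' i s) (\<lambda>s. op_exp G s (G x)) sequentially"
  proof -
    have "uniform_limit {-R..R} (\<lambda>n s. \<Sum>i<Suc n. f' i s) (\<lambda>s. op_exp G s (G x)) sequentially"
      using unif unfolding shift op_exp_def .
    thus ?thesis
      unfolding uniform_limit_iff by (subst (asm) eventually_sequentially_Suc)
  qed
  have "\<exists>g. \<forall>s\<in>{-R..R}. (\<lambda>n. f n s) sums g s \<and>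
      (g has_derivative (\<lambda>h. h *\<^sub>R op_exp G s (G x))) (at s within {-R..R})"
  proof (rule has_derivative_series [OF _ deriv])
    show "t \<in> {-R..R}" "(\<lambda>n. f n t) sums op_exp G t x"
      using op_exp_sums by (auto simp: R_def f_def)
    fix e :: real assume "0 < e"
    from uniform_limitD [OF unif' this]
    show "\<forall>\<^sub>F n in sequentially. \<forall>s\<in>{-R..R}. \<forall>h.
        norm ((\<Sum>i<n. h *\<^sub>R f' i s) - h *\<^sub>R op_exp G s (G x)) \<le> e * norm h"
    proof (rule eventually_mono, intro ballI allI)
      fix n s and h :: real
      assume *: "\<forall>s\<in>{-R..R}. dist (\<Sum>i<n. f' i s) (op_exp G s (G x)) < e" "s \<in> {-R..R}"
      hence "norm ((\<Sum>i<n. f' i s) - op_exp G s (G x)) \<le> e"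
        by (auto simp: dist_norm less_imp_le)
      hence "\<bar>h\<bar> * norm ((\<Sum>i<n. f' i s) - op_exp G s (G x)) \<le> \<bar>h\<bar> * e"
        by (intro mult_left_mono) auto
      thus "norm ((\<Sum>i<n. h *\<^sub>R f' i s) - h *\<^sub>R op_exp G s (G x)) \<le> e * norm h"
        by (simp add: scaleR_sum_right [symmetric] scaleR_diff_right [symmetric] mult.commute)
    qed
  qed auto
  then obtain g where g: "\<And>s. s \<in> {-R..R} \<Longrightarrow> (\<lambda>n. f n s) sums g s"
    "\<And>s. s \<in> {-R..R} \<Longrightarrow> (g has_derivative (\<lambda>h. h *\<^sub>R op_exp G s (G x))) (at s within {-R..R})"
    by blast
  have t: "t \<in> {-R<..<R}" by (auto simp: R_def)
  have "(g has_derivative (\<lambda>h. h *\<^sub>R op_exp G t (G x))) (at t within {-R<..<R})"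
    using t by (intro has_derivative_subset [OF g(2)]) auto
  hence "(g has_derivative (\<lambda>h. h *\<^sub>R op_exp G t (G x))) (at t)"
    using at_within_open [OF t] by simp
  hence "((\<lambda>s. op_exp G s x) has_derivative (\<lambda>h. h *\<^sub>R op_exp G t (G x))) (at t)"
  proof (rule has_derivative_transform_within_open [OF _ _ t])
    show "g s = op_exp G s x" if "s \<in> {-R<..<R}" for s
      using g(1) [of s] op_exp_sums [of s x] that unfolding f_def by (auto intro: sums_unique2)
  qed auto
  moreover have "op_exp G t (G x) = G (op_exp G t x)"
    by (rule op_exp_commute [symmetric]) (use G in auto)
  ultimately show ?thesis by (simp add: has_vector_derivative_def)
qed

end

lemma inner_op_exp:
  fixes G G' :: "'h::{real_inner,banach} \<Rightarrow> 'h"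
  assumes G: "bounded_linear G" and G': "bounded_linear G'"
    and adj: "\<And>x y. inner (G x) y = inner x (G' y)"
  shows "inner (op_exp G t x) y = inner x (op_exp G' t y)"
proof -
  have *: "inner ((G ^^ m) x) y = inner x ((G' ^^ m) y)" for m
  proof (induction m arbitrary: x y)
    case (Suc m)
    show ?case by (simp add: adj Suc funpow_swap1)
  qed simp
  have "(\<lambda>m. inner ((t ^ m / fact m) *\<^sub>R (G ^^ m) x) y) sums inner (op_exp G t x) y"
    by (rule bounded_linear.sums [OF bounded_linear_inner_left op_exp_sums [OF G]])
  moreover have "(\<lambda>m. inner x ((t ^ m / fact m) *\<^sub>R (G' ^^ m) y)) sums inner x (op_exp G' t y)"
    by (rule bounded_linear.sums [OF bounded_linear_inner_right op_exp_sums [OF G']])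
  ultimately show ?thesis by (simp add: * sums_unique2)
qed

text \<open>
  \<open>e\<^bsup>-2\<alpha>s\<^esup> \<parallel>Q (op_exp G s x)\<parallel>\<^sup>2\<close> has a nonpositive derivative in \<open>s\<close>. With \<open>\<alpha> = 0\<close> this gives
  hyperbolicity, on \<open>L\<^sup>2\<close> it gives the stability of the approximations.
\<close>

lemma op_exp_energy_estimate:
  fixes G Q :: "'h::{real_inner,banach} \<Rightarrow> 'h"
  assumes G: "bounded_linear G" and Q: "bounded_linear Q"
    and dissip: "\<And>x. inner (Q (G x)) (Q x) \<le> \<alpha> * (norm (Q x))\<^sup>2"
    and "0 \<le> t"
  shows "norm (Q (op_exp G t x)) \<le> exp (\<alpha> * t) * norm (Q x)"
proof -
  define y where "y s = Q (op_exp G s x)" for s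
  define E where "E s = exp (- 2 * \<alpha> * s) * inner (y s) (y s)" for s
  have y: "(y has_derivative (\<lambda>h. h *\<^sub>R Q (G (op_exp G s x)))) (at s)" for s
    using bounded_linear.has_derivative [OF Q op_exp_has_vector_derivative [OF G, unfolded has_vector_derivative_def]]
    unfolding y_def by (simp add: linear_cmul [OF bounded_linear.linear [OF Q]])
  have "E t \<le> E 0"
  proof (rule DERIV_nonpos_imp_nonincreasing [OF \<open>0 \<le> t\<close>])
    fix s
    let ?z = "Q (G (op_exp G s x))"
    have "(E has_real_derivative
        exp (- 2 * \<alpha> * s) * (2 * (inner ?z (y s) - \<alpha> * inner (y s) (y s)))) (at s)"
      unfolding E_def has_field_derivative_def
      by (auto intro!: derivative_eq_intros y simp: fun_eq_iff inner_commute algebra_simps)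
    moreover have "exp (- 2 * \<alpha> * s) * (2 * (inner ?z (y s) - \<alpha> * inner (y s) (y s))) \<le> 0"
      using dissip [of "op_exp G s x"]
      by (intro mult_nonneg_nonpos) (auto simp: y_def power2_norm_eq_inner)
    ultimately show "\<exists>d. (E has_real_derivative d) (at s) \<and> d \<le> 0" by blast
  qed
  hence "exp (- 2 * \<alpha> * t) * (norm (y t))\<^sup>2 \<le> (norm (Q x))\<^sup>2"
    by (simp add: E_def y_def op_exp_0 [OF G] power2_norm_eq_inner)
  moreover have "exp (- 2 * \<alpha> * t) = 1 / (exp (\<alpha> * t))\<^sup>2"
    by (simp add: exp_minus inverse_eq_divide flip: exp_double)
  ultimately have "(norm (y t))\<^sup>2 \<le> (exp (\<alpha> * t) * norm (Q x))\<^sup>2"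
    by (simp add: power_mult_distrib divide_le_eq mult.commute)
  thus ?thesis unfolding y_def by (rule power2_le_imp_le) auto
qed

section \<open>Evolution equations with approximable generators\<close>

lemma has_vector_derivative_iff_quotient:
  "(f has_vector_derivative f') (at t within S) \<longleftrightarrow>
     ((\<lambda>s. (f s - f t) /\<^sub>R (s - t)) \<longlongrightarrow> f') (at t within S)"
proof -
  have eq: "norm ((f s - f t - (s - t) *\<^sub>R f') /\<^sub>R norm (s - t)) = norm ((f s - f t) /\<^sub>R (s - t) - f')"
    if "s \<noteq> t" for s
  proof -
    have "(f s - f t) /\<^sub>R (s - t) - f' = (f s - f t - (s - t) *\<^sub>R f') /\<^sub>R (s - t)"
      using that by (simp add: scaleR_diff_right)
    thus ?thesis by simp
  qed
  have "(f has_vector_derivative f') (at t within S) \<longleftrightarrow>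
      ((\<lambda>s. norm ((f s - f t - (s - t) *\<^sub>R f') /\<^sub>R norm (s - t))) \<longlongrightarrow> 0) (at t within S)"
    unfolding has_vector_derivative_def has_derivative_at_within tendsto_norm_zero_iff
    by (simp add: bounded_linear_scaleR_left)
  also have "\<dots> \<longleftrightarrow> ((\<lambda>s. norm ((f s - f t) /\<^sub>R (s - t) - f')) \<longlongrightarrow> 0) (at t within S)"
    by (rule Lim_cong_within) (use eq in auto)
  also have "\<dots> \<longleftrightarrow> ((\<lambda>s. (f s - f t) /\<^sub>R (s - t)) \<longlongrightarrow> f') (at t within S)"
    unfolding tendsto_norm_zero_iff by (rule Lim_null [symmetric])
  finally show ?thesis .
qed

lemma has_derivative_uniform_limit_atLeast:
  fixes f g :: "nat \<Rightarrow> real \<Rightarrow> real"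
  assumes deriv: "\<And>n t. 0 \<le> t \<Longrightarrow> (f n has_real_derivative g n t) (at t within {0..})"
    and lim: "\<And>t. 0 \<le> t \<Longrightarrow> (\<lambda>n. f n t) \<longlonglongrightarrow> F t"
    and unif: "\<And>T. 0 \<le> T \<Longrightarrow> uniform_limit {0..T} g G sequentially"
    and t: "0 \<le> t"
  shows "(F has_real_derivative G t) (at t within {0..})"
proof -
  define T where "T = t + 1"
  have T: "0 \<le> T" using t by (simp add: T_def)
  have "\<exists>h. \<forall>s\<in>{0..T}. (\<lambda>n. f n s) \<longlonglongrightarrow> h s \<and>
      (h has_derivative (\<lambda>x. G s * x)) (at s within {0..T})"
  proof (rule has_derivative_sequence)
    show "(f n has_derivative (\<lambda>x. g n s * x)) (at s within {0..T})" if "s \<in> {0..T}" for n s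
      using that deriv [of s n] by (auto simp: has_field_derivative_def intro: has_derivative_subset)
    show "\<forall>\<^sub>F n in sequentially. \<forall>s\<in>{0..T}. \<forall>x. norm (g n s * x - G s * x) \<le> e * norm x"
      if "e > 0" for e
      using uniform_limitD [OF unif [OF T] that]
    proof (rule eventually_mono, intro ballI allI)
      fix n s x assume "\<forall>s\<in>{0..T}. dist (g n s) (G s) < e" "s \<in> {0..T}"
      hence "\<bar>g n s - G s\<bar> \<le> e" by (auto simp: dist_real_def less_imp_le)
      from mult_right_mono [OF this, of "\<bar>x\<bar>"]
      show "norm (g n s * x - G s * x) \<le> e * norm x"
        by (simp add: abs_mult left_diff_distrib [symmetric])
    qed
    show "0 \<in> {0..T}" "(\<lambda>n. f n 0) \<longlonglongrightarrow> F 0" using T lim by auto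
  qed auto
  then obtain h where h: "\<And>s. s \<in> {0..T} \<Longrightarrow> (\<lambda>n. f n s) \<longlonglongrightarrow> h s"
    "\<And>s. s \<in> {0..T} \<Longrightarrow> (h has_derivative (\<lambda>x. G s * x)) (at s within {0..T})"
    by blast
  have hF: "h s = F s" if "s \<in> {0..T}" for s
    using h(1) [OF that] lim [of s] that by (auto intro: LIMSEQ_unique)
  have "(h has_derivative (\<lambda>x. G t * x)) (at t within {0..T})"
    using h(2) t by (auto simp: T_def)
  hence "(F has_derivative (\<lambda>x. G t * x)) (at t within {0..T})"
    by (rule has_derivative_transform [rotated 2]) (use hF t in \<open>auto simp: T_def\<close>)
  moreover have "at t within {0..T} = at t within {0..}"
    by (rule at_within_nhd [of _ "{..<T}"]) (auto simp: T_def)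
  ultimately show ?thesis by (simp add: has_field_derivative_def)
qed

text \<open>
  The evolution equation is \<open>U' = - \<Sum>\<^sub>j A\<^sub>j \<partial>\<^sub>j U - B U\<close>. The unbounded operators \<open>\<partial>\<^sub>j\<close> enter only
  through their bounded skew approximations \<open>K j n\<close>, which converge on the dense space \<open>D\<close> of test
  vectors. \<open>Q\<close> is the change of variables that
  makes the principal part symmetric; as \<open>K j n\<close> is skew and commutes with everything else, the principal
  part then drops out of the energy balance.
\<close>

locale approximable_evolution =
  fixes A A' :: "'j::finite \<Rightarrow> 'h::{real_inner,banach} \<Rightarrow> 'h"
    and B B' Q :: "'h \<Rightarrow> 'h"
    and K :: "'j \<Rightarrow> nat \<Rightarrow> 'h \<Rightarrow> 'h"
    and D :: "'h set" and q :: real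
  assumes A: "bounded_linear (A j)" and A': "bounded_linear (A' j)"
    and B: "bounded_linear B" and B': "bounded_linear B'"
    and Q: "bounded_linear Q" and K: "bounded_linear (K j n)"
    and A_adjoint: "inner (A j x) y = inner x (A' j y)"
    and B_adjoint: "inner (B x) y = inner x (B' y)"
    and K_skew: "inner (K j n x) y = - inner x (K j n y)"
    and K_K: "K j n (K i m x) = K i m (K j n x)"
    and K_A: "K j n (A i x) = A i (K j n x)" and K_A': "K j n (A' i x) = A' i (K j n x)"
    and K_B: "K j n (B x) = B (K j n x)" and K_B': "K j n (B' x) = B' (K j n x)"
    and K_Q: "K j n (Q x) = Q (K j n x)"
    and symmetrizer: "inner (Q (A j x)) (Q y) = inner (Q x) (Q (A j y))"
    and q: "0 < q" and Q_coercive: "norm x \<le> q * norm (Q x)"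
    and subspace_D: "subspace D" and dense_D: "closure D = UNIV"
    and A'_D: "F \<in> D \<Longrightarrow> A' j F \<in> D" and B'_D: "F \<in> D \<Longrightarrow> B' F \<in> D"
    and K_D: "F \<in> D \<Longrightarrow> K j n F \<in> D"
    and K_convergent: "F \<in> D \<Longrightarrow> convergent (\<lambda>n. K j n F)"
begin

definition deriv_D :: "'j \<Rightarrow> 'h \<Rightarrow> 'h" where
  "deriv_D j F = lim (\<lambda>n. K j n F)"

text \<open>
  The formal adjoint of \<open>- \<Sum>\<^sub>j A\<^sub>j \<partial>\<^sub>j - B\<close> on test vectors. The sign of the first sum is reversed because
  \<open>\<partial>\<^sub>j\<close> is skew.
\<close>

definition adj_gen :: "'h \<Rightarrow> 'h" where
  "adj_gen F = (\<Sum>j\<in>UNIV. A' j (deriv_D j F)) - B' F"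

definition G :: "nat \<Rightarrow> 'h \<Rightarrow> 'h" where
  "G n x = - (\<Sum>j\<in>UNIV. A j (K j n x)) - B x"

definition G' :: "nat \<Rightarrow> 'h \<Rightarrow> 'h" where
  "G' n x = (\<Sum>j\<in>UNIV. A' j (K j n x)) - B' x"

text \<open>
  As the derivative is one-sided at \<open>0\<close>, the equation holds up to the initial time.
\<close>

definition weak_solution :: "(real \<Rightarrow> 'h) \<Rightarrow> bool" where
  "weak_solution U \<longleftrightarrow> continuous_on {0..} U \<and>
     (\<forall>F\<in>D. \<forall>t\<ge>0. ((\<lambda>s. inner (U s) F) has_real_derivative inner (U t) (adj_gen F)) (at t within {0..}))"

lemmas lin = A [THEN bounded_linear.linear] A' [THEN bounded_linear.linear]
  B [THEN bounded_linear.linear] B' [THEN bounded_linear.linear]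
  Q [THEN bounded_linear.linear] K [THEN bounded_linear.linear]

lemma G: "bounded_linear (G n)"
  unfolding G_def [abs_def]
  by (intro bounded_linear_sub bounded_linear_minus bounded_linear_sum bounded_linear_compose [OF A K] B)

lemma G': "bounded_linear (G' n)"
  unfolding G'_def [abs_def]
  by (intro bounded_linear_sub bounded_linear_sum bounded_linear_compose [OF A' K] B')

lemma G_adjoint: "inner (G n x) y = inner x (G' n y)"
  by (simp add: G_def G'_def inner_diff_left inner_diff_right inner_sum_left inner_sum_right
      A_adjoint B_adjoint K_skew K_A' sum_negf)

lemma K_G: "K j m (G n x) = G n (K j m x)"
  by (simp add: G_def linear_diff [OF lin(6)] linear_neg [OF lin(6)] linear_sum [OF lin(6)] K_A K_K K_B)

lemma K_G': "K j m (G' n x) = G' n (K j m x)"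
  by (simp add: G'_def linear_diff [OF lin(6)] linear_sum [OF lin(6)] K_A' K_K K_B')

lemma deriv_D: "F \<in> D \<Longrightarrow> (\<lambda>n. K j n F) \<longlonglongrightarrow> deriv_D j F"
  unfolding deriv_D_def using K_convergent convergent_LIMSEQ_iff by blast

lemma G'_tendsto: "F \<in> D \<Longrightarrow> (\<lambda>n. G' n F) \<longlonglongrightarrow> adj_gen F"
  unfolding G'_def adj_gen_def
  by (intro tendsto_intros bounded_linear.tendsto [OF A'] deriv_D)

text \<open>
  The constants of the energy estimate. The \<open>+ 1\<close> makes \<open>M\<close> positive even if the space is trivial.
\<close>

definition \<alpha> :: real where "\<alpha> = onorm Q * onorm B * q"
definition M :: real where "M = q * onorm Q + 1"

lemma \<alpha>_nonneg: "0 \<le> \<alpha>"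
  using q by (simp add: \<alpha>_def onorm_pos_le [OF Q] onorm_pos_le [OF B])

lemma M_pos: "0 < M"
  using q onorm_pos_le [OF Q] by (simp add: M_def add_nonneg_pos)

text \<open>
  Moving \<open>K j n\<close> and \<open>Q A\<^sub>j\<close> to the other side of the inner product changes the sign once, so
  \<open>\<langle>Q A\<^sub>j K\<^sub>j\<^sub>n x, Q x\<rangle>\<close> equals its own negative. Only \<open>B\<close> contributes, and the bound does not depend
  on \<open>n\<close>.
\<close>

lemma G_dissipative: "inner (Q (G n x)) (Q x) \<le> \<alpha> * (norm (Q x))\<^sup>2"
proof -
  have "inner (Q (A j (K j n x))) (Q x) = 0" for j
  proof -
    have "inner (Q (A j (K j n x))) (Q x) = inner (K j n (Q x)) (Q (A j x))"
      by (simp add: symmetrizer K_Q)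
    also have "\<dots> = - inner (Q x) (K j n (Q (A j x)))"
      by (rule K_skew)
    also have "\<dots> = - inner (Q x) (Q (A j (K j n x)))"
      by (simp only: K_Q K_A)
    also have "\<dots> = - inner (Q (A j (K j n x))) (Q x)"
      by (simp only: inner_commute)
    finally show ?thesis by simp
  qed
  hence "inner (Q (G n x)) (Q x) = - inner (Q (B x)) (Q x)"
    by (simp add: G_def linear_diff [OF lin(5)] linear_neg [OF lin(5)] linear_sum [OF lin(5)]
        inner_diff_left inner_sum_left)
  also have "\<dots> \<le> norm (Q (B x)) * norm (Q x)"
    using Cauchy_Schwarz_ineq2 [of "Q (B x)" "Q x"] by simp
  also have "norm (Q (B x)) \<le> onorm Q * norm (B x)"
    by (rule onorm [OF Q])
  also have "onorm Q * norm (B x) \<le> onorm Q * (onorm B * (q * norm (Q x)))"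
    by (intro mult_left_mono order_trans [OF onorm [OF B]] Q_coercive onorm_pos_le Q B)
  finally show ?thesis
    by (simp add: \<alpha>_def power2_eq_square mult.assoc mult_right_mono)
qed

lemma op_exp_G_bound:
  assumes "0 \<le> t"
  shows "norm (op_exp (G n) t x) \<le> M * exp (\<alpha> * t) * norm x"
proof -
  have "norm (Q (op_exp (G n) t x)) \<le> exp (\<alpha> * t) * norm (Q x)"
    using G Q G_dissipative assms by (rule op_exp_energy_estimate)
  hence "norm (op_exp (G n) t x) \<le> q * (exp (\<alpha> * t) * norm (Q x))"
    using Q_coercive [of "op_exp (G n) t x"] mult_left_mono less_imp_le [OF q] order_trans by blast
  also have "\<dots> \<le> q * (exp (\<alpha> * t) * (onorm Q * norm x))"
    using q by (intro mult_left_mono onorm [OF Q]) auto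
  also have "\<dots> \<le> M * exp (\<alpha> * t) * norm x"
    by (simp add: M_def algebra_simps)
  finally show ?thesis .
qed

text \<open>
  The adjoint of the approximate evolution has the same norm.
\<close>

lemma op_exp_G'_bound:
  assumes "0 \<le> t"
  shows "norm (op_exp (G' n) t y) \<le> M * exp (\<alpha> * t) * norm y"
proof -
  let ?z = "op_exp (G' n) t y"
  have "norm ?z * norm ?z = inner (op_exp (G n) t ?z) y"
    using inner_op_exp [OF G G' G_adjoint] by (simp add: power2_norm_eq_inner flip: power2_eq_square)
  also have "\<dots> \<le> norm (op_exp (G n) t ?z) * norm y"
    by (rule norm_cauchy_schwarz)
  also have "\<dots> \<le> M * exp (\<alpha> * t) * norm ?z * norm y"
    by (rule mult_right_mono [OF op_exp_G_bound [OF assms]]) simp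
  finally have "norm ?z * norm ?z \<le> norm ?z * (M * exp (\<alpha> * t) * norm y)"
    by (simp add: mult_ac)
  thus ?thesis using M_pos by (cases "norm ?z = 0") auto
qed

lemma op_exp_G'_has_derivative:
  "((\<lambda>s. op_exp (G' n) (T - s) x) has_derivative (\<lambda>h. h *\<^sub>R - G' n (op_exp (G' n) (T - t) x))) (at t within S)"
proof -
  have "((\<lambda>s. op_exp (G' n) s x) has_derivative (\<lambda>h. h *\<^sub>R G' n (op_exp (G' n) (T - t) x))) (at (T - t))"
    using op_exp_has_vector_derivative [OF G'] by (simp add: has_vector_derivative_def)
  moreover have "((\<lambda>s. T - s) has_derivative uminus) (at t within S)"
    by (auto intro!: derivative_eq_intros)
  ultimately show ?thesis
    using has_derivative_compose [of "\<lambda>s. T - s" uminus t S "\<lambda>s. op_exp (G' n) s x"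
        "\<lambda>h. h *\<^sub>R G' n (op_exp (G' n) (T - t) x)"]
    by simp
qed

text \<open>
  The curve \<open>U\<close> is only weakly differentiable, so the bilinear product rule does not apply. Splitting the
  difference quotient as below, the difference quotient of \<open>W\<close> converges in norm and is paired with a
  continuous curve, and the weak derivative of \<open>U\<close> is needed only against the fixed vector \<open>W t\<close>.
\<close>

lemma weak_product_rule:
  assumes U: "continuous_on {0..} U" and t: "0 \<le> t"
    and weak: "((\<lambda>s. inner (U s) (W t)) has_real_derivative d) (at t within {0..})"
    and W: "(W has_derivative (\<lambda>h. h *\<^sub>R W')) (at t within {0..})"
  shows "((\<lambda>s. inner (U s) (W s)) has_real_derivative d + inner (U t) W') (at t within {0..})"
proof -
  have "((\<lambda>s. (W s - W t) /\<^sub>R (s - t)) \<longlongrightarrow> W') (at t within {0..})"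
    using W unfolding has_vector_derivative_def [symmetric] has_vector_derivative_iff_quotient .
  hence "((\<lambda>s. inner (U s) ((W s - W t) /\<^sub>R (s - t))) \<longlongrightarrow> inner (U t) W') (at t within {0..})"
    using U t by (intro tendsto_inner) (auto simp: continuous_on_def)
  moreover have "((\<lambda>s. (inner (U s) (W t) - inner (U t) (W t)) / (s - t)) \<longlongrightarrow> d) (at t within {0..})"
    using weak by (simp add: has_field_derivative_iff)
  ultimately have "((\<lambda>s. (inner (U s) (W t) - inner (U t) (W t)) / (s - t) +
      inner (U s) ((W s - W t) /\<^sub>R (s - t))) \<longlongrightarrow> d + inner (U t) W') (at t within {0..})"
    by (intro tendsto_add)
  moreover have "(inner (U s) (W t) - inner (U t) (W t)) / (s - t) + inner (U s) ((W s - W t) /\<^sub>R (s - t)) =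
      (inner (U s) (W s) - inner (U t) (W t)) / (s - t)" for s
    by (simp add: inner_diff_right divide_inverse distrib_right [symmetric] mult.commute [of "inverse _"])
  ultimately show ?thesis
    unfolding has_field_derivative_iff by simp
qed

text \<open>
  A curve is compared with the approximate evolution by pairing it with the backward approximate
  adjoint evolution of \<open>y\<close>: if \<open>U\<close> satisfies \<open>U' = G n U\<close> weakly up to the remainder \<open>r\<close>, the pairing has
  derivative \<open>r\<close>. This serves both the convergence of the approximations and uniqueness.
\<close>

lemma op_exp_G'_duality_estimate:
  assumes U: "continuous_on {0..} U" and T: "0 \<le> T"
    and deriv: "\<And>t. 0 \<le> t \<Longrightarrow> t \<le> T \<Longrightarrow>
      ((\<lambda>s. inner (U s) (op_exp (G' n) (T - t) y)) has_real_derivative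
        inner (U t) (G' n (op_exp (G' n) (T - t) y)) + r t) (at t within {0..})"
    and bound: "\<And>t. 0 \<le> t \<Longrightarrow> t \<le> T \<Longrightarrow> \<bar>r t\<bar> \<le> C"
  shows "\<bar>inner (U T) y - inner (U 0) (op_exp (G' n) T y)\<bar> \<le> C * T"
proof -
  define p where "p s = inner (U s) (op_exp (G' n) (T - s) y)" for s
  have p: "(p has_real_derivative r t) (at t within {0..T})" if "t \<in> {0..T}" for t
  proof -
    have "(p has_real_derivative (inner (U t) (G' n (op_exp (G' n) (T - t) y)) + r t)
        + inner (U t) (- G' n (op_exp (G' n) (T - t) y))) (at t within {0..})"
      unfolding p_def
      by (rule weak_product_rule [OF U _ deriv op_exp_G'_has_derivative]) (use that in auto)
    thus ?thesis by (auto intro: DERIV_subset)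
  qed
  have "norm (p T - p 0) \<le> C * norm (T - 0)"
    by (rule field_differentiable_bound [OF _ p]) (use T bound in auto)
  thus ?thesis using T by (simp add: p_def op_exp_0 [OF G'])
qed

lemma op_exp_inner_derivative:
  "((\<lambda>s. inner (op_exp (G m) s x) y) has_real_derivative inner (op_exp (G m) t x) (G' m y)) (at t within S)"
proof -
  have "((\<lambda>s. op_exp (G m) s x) has_vector_derivative G m (op_exp (G m) t x)) (at t within S)"
    using op_exp_has_vector_derivative [OF G] by (rule has_vector_derivative_at_within)
  from bounded_linear.has_vector_derivative [OF bounded_linear_inner_left [of y] this]
  show ?thesis by (simp add: has_real_derivative_iff_has_vector_derivative G_adjoint)
qed

lemma continuous_op_exp_G: "continuous_on S (\<lambda>t. op_exp (G m) t x)"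
  by (intro continuous_at_imp_continuous_on ballI
      has_vector_derivative_continuous [OF op_exp_has_vector_derivative [OF G]])

definition defect :: "nat \<Rightarrow> nat \<Rightarrow> 'h \<Rightarrow> real" where
  "defect m n F = (\<Sum>j\<in>UNIV. onorm (A j) * norm (K j m F - K j n F))"

text \<open>
  The remainder of \<open>e\<^bsup>tG\<^sub>m\<^esup> F\<close> as a solution for \<open>G n\<close> is \<open>(G m - G n) e\<^bsup>tG\<^sub>m\<^esup> F\<close>. Although \<open>G m\<close> and \<open>G n\<close> do
  not commute, the operators \<open>K j m - K j n\<close> commute with \<open>e\<^bsup>tG\<^sub>m\<^esup>\<close> and can be moved onto \<open>F\<close>. The estimate
  is tested with the difference \<open>w\<close> itself.
\<close>

lemma op_exp_G_diff_bound:
  assumes T: "0 \<le> T"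
  shows "norm (op_exp (G m) T F - op_exp (G n) T F) \<le> M\<^sup>2 * exp (\<alpha> * T) * T * defect m n F"
proof -
  define w where "w = op_exp (G m) T F - op_exp (G n) T F"
  define U where "U t = op_exp (G m) t F" for t
  define r where "r t = inner (G m (U t) - G n (U t)) (op_exp (G' n) (T - t) w)" for t
  have bound: "\<bar>r t\<bar> \<le> M\<^sup>2 * exp (\<alpha> * T) * defect m n F * norm w" if t: "0 \<le> t" "t \<le> T" for t
  proof -
    have "G m (U t) - G n (U t) = - (\<Sum>j\<in>UNIV. A j (op_exp (G m) t (K j m F - K j n F)))"
    proof -
      have "K j i (U t) = op_exp (G m) t (K j i F)" for j i
        using op_exp_commute [of "G m" "K j i" t F] G K K_G by (simp add: U_def)
      thus ?thesis
        by (simp add: G_def op_exp_diff [OF G] linear_diff [OF lin(1)] sum_subtractf)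
    qed
    also have "norm \<dots> \<le> (\<Sum>j\<in>UNIV. onorm (A j) * (M * exp (\<alpha> * t) * norm (K j m F - K j n F)))"
      unfolding norm_minus_cancel
      by (intro sum_norm_le order_trans [OF onorm [OF A]] mult_left_mono op_exp_G_bound onorm_pos_le A t)
    also have "\<dots> = M * exp (\<alpha> * t) * defect m n F"
      by (simp add: defect_def sum_distrib_left mult_ac)
    finally have *: "norm (G m (U t) - G n (U t)) \<le> M * exp (\<alpha> * t) * defect m n F" .
    have "\<bar>r t\<bar> \<le> norm (G m (U t) - G n (U t)) * norm (op_exp (G' n) (T - t) w)"
      unfolding r_def by (rule Cauchy_Schwarz_ineq2)
    also have "\<dots> \<le> (M * exp (\<alpha> * t) * defect m n F) * (M * exp (\<alpha> * (T - t)) * norm w)"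
      using t by (intro mult_mono * op_exp_G'_bound order_trans [OF norm_ge_zero *]) auto
    also have "\<dots> = M\<^sup>2 * (exp (\<alpha> * t) * exp (\<alpha> * (T - t))) * defect m n F * norm w"
      by (simp add: power2_eq_square mult_ac)
    also have "exp (\<alpha> * t) * exp (\<alpha> * (T - t)) = exp (\<alpha> * T)"
      by (simp add: exp_add [symmetric] algebra_simps)
    finally show ?thesis .
  qed
  have "\<bar>inner (U T) w - inner (U 0) (op_exp (G' n) T w)\<bar> \<le> (M\<^sup>2 * exp (\<alpha> * T) * defect m n F * norm w) * T"
  proof (rule op_exp_G'_duality_estimate [OF _ T _ bound])
    show "continuous_on {0..} U" unfolding U_def by (rule continuous_op_exp_G)
    show "((\<lambda>s. inner (U s) (op_exp (G' n) (T - t) w)) has_real_derivative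
        inner (U t) (G' n (op_exp (G' n) (T - t) w)) + r t) (at t within {0..})" for t
      using op_exp_inner_derivative [of m F "op_exp (G' n) (T - t) w" t "{0..}"]
      by (simp add: U_def r_def G_adjoint inner_diff_left)
  qed
  moreover have "inner (U T) w - inner (U 0) (op_exp (G' n) T w) = inner w w"
  proof -
    have "inner (U 0) (op_exp (G' n) T w) = inner (op_exp (G n) T F) w"
      by (simp add: U_def op_exp_0 [OF G] inner_op_exp [OF G G' G_adjoint])
    thus ?thesis
      by (simp add: U_def inner_diff_left [symmetric] w_def)
  qed
  ultimately have "norm w * norm w \<le> (M\<^sup>2 * exp (\<alpha> * T) * defect m n F * norm w) * T"
    by (simp flip: power2_norm_eq_inner power2_eq_square)
  hence "norm w * norm w \<le> norm w * (M\<^sup>2 * exp (\<alpha> * T) * T * defect m n F)"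
    by (simp add: mult_ac)
  hence "norm w \<le> M\<^sup>2 * exp (\<alpha> * T) * T * defect m n F"
  proof (cases "w = 0")
    case True
    thus ?thesis using T by (auto simp: defect_def intro!: mult_nonneg_nonneg sum_nonneg onorm_pos_le A)
  qed auto
  thus ?thesis by (simp add: w_def)
qed

lemma defect_small:
  assumes "F \<in> D" "0 < e"
  shows "\<exists>N. \<forall>m\<ge>N. \<forall>n\<ge>N. defect m n F < e"
proof -
  define f where "f n = (\<Sum>j\<in>UNIV. onorm (A j) * norm (K j n F - deriv_D j F))" for n
  have "f \<longlonglongrightarrow> (\<Sum>j\<in>UNIV. onorm (A j) * norm (deriv_D j F - deriv_D j F))"
    unfolding f_def by (intro tendsto_intros deriv_D assms)
  hence "f \<longlonglongrightarrow> 0" by simp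
  hence "\<forall>\<^sub>F n in sequentially. f n < e / 2"
    using assms(2) by (intro order_tendstoD) auto
  then obtain N where N: "\<And>n. n \<ge> N \<Longrightarrow> f n < e / 2"
    by (auto simp: eventually_sequentially)
  have "defect m n F \<le> f m + f n" for m n
    unfolding defect_def f_def sum.distrib [symmetric] distrib_left [symmetric]
    by (intro sum_mono mult_left_mono onorm_pos_le A) (metis norm_triangle_sub norm_minus_commute dist_norm dist_triangle2)
  hence "defect m n F < e" if "m \<ge> N" "n \<ge> N" for m n
    using N [OF that(1)] N [OF that(2)] by (smt (verit) field_sum_of_halves)
  thus ?thesis by blast
qed

text \<open>
  On test vectors this follows from the previous estimates; the uniform bounds on the approximate
  evolutions and the density of \<open>D\<close> transfer it to every \<open>x\<close>.
\<close>

lemma op_exp_G_uniformly_Cauchy: "uniformly_Cauchy_on {0..T} (\<lambda>n t. op_exp (G n) t x)"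
proof (cases "0 \<le> T")
  case T: True
  define C where "C = M * exp (\<alpha> * T)"
  have C: "0 < C" using M_pos by (simp add: C_def)
  have "\<exists>N. \<forall>t\<in>{0..T}. \<forall>m\<ge>N. \<forall>n\<ge>N. dist (op_exp (G m) t x) (op_exp (G n) t x) < e" if e: "0 < e" for e
  proof -
    have "x \<in> closure D" using dense_D by simp
    then obtain F where F: "F \<in> D" "dist F x < e / (4 * C)"
      unfolding closure_approachable using e C by (meson divide_pos_pos mult_pos_pos zero_less_numeral)
    define C' where "C' = M\<^sup>2 * exp (\<alpha> * T) * (T + 1)"
    have C': "0 < C'" using M_pos T by (simp add: C'_def)
    obtain N where N: "\<And>m n. m \<ge> N \<Longrightarrow> n \<ge> N \<Longrightarrow> defect m n F < e / (2 * C')"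
      using defect_small [OF F(1), of "e / (2 * C')"] e C' by auto
    show ?thesis
    proof (intro exI ballI allI impI)
      fix t m n assume t: "t \<in> {0..T}" and mn: "N \<le> m" "N \<le> n"
      have d: "0 \<le> defect m n F"
        unfolding defect_def by (intro sum_nonneg mult_nonneg_nonneg onorm_pos_le A) auto
      have 1: "norm (op_exp (G i) t (x - F)) \<le> e / 4" for i
      proof -
        have "norm (op_exp (G i) t (x - F)) \<le> M * exp (\<alpha> * t) * norm (x - F)"
          using t by (intro op_exp_G_bound) auto
        also have "\<dots> \<le> C * (e / (4 * C))"
          unfolding C_def using t F(2) M_pos \<alpha>_nonneg
          by (intro mult_mono) (auto simp: dist_norm norm_minus_commute C_def intro: mult_left_mono)
        finally show ?thesis using C by simp
      qed
      have "norm (op_exp (G m) t F - op_exp (G n) t F) \<le> M\<^sup>2 * exp (\<alpha> * t) * t * defect m n F"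
        using t by (intro op_exp_G_diff_bound) auto
      also have "\<dots> \<le> C' * defect m n F"
        unfolding C'_def using t \<alpha>_nonneg M_pos d
        by (intro mult_mono) (auto intro: mult_left_mono)
      also have "\<dots> < C' * (e / (2 * C'))"
        using N [OF mn] C' by (intro mult_strict_left_mono)
      finally have 2: "norm (op_exp (G m) t F - op_exp (G n) t F) < e / 2"
        using C' by simp
      have eq: "op_exp (G m) t x - op_exp (G n) t x =
          op_exp (G m) t (x - F) - op_exp (G n) t (x - F) + (op_exp (G m) t F - op_exp (G n) t F)"
        by (simp add: op_exp_diff [OF G])
      show "dist (op_exp (G m) t x) (op_exp (G n) t x) < e"
        unfolding dist_norm eq using 1 [of m] 1 [of n] 2
          norm_triangle_ineq4 [of "op_exp (G m) t (x - F)" "op_exp (G n) t (x - F)"]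
          norm_triangle_ineq [of "op_exp (G m) t (x - F) - op_exp (G n) t (x - F)" "op_exp (G m) t F - op_exp (G n) t F"]
        by linarith
    qed
  qed
  thus ?thesis unfolding uniformly_Cauchy_on_def by blast
qed (simp add: uniformly_Cauchy_on_def)

lemma ex_weak_solution:
  "\<exists>U. weak_solution U \<and> U 0 = x \<and> (\<forall>t\<ge>0. norm (U t) \<le> M * exp (\<alpha> * t) * norm x)"
proof -
  define U where "U t = lim (\<lambda>n. op_exp (G n) t x)" for t
  have unif: "uniform_limit {0..T} (\<lambda>n t. op_exp (G n) t x) U sequentially" for T
    using Cauchy_uniformly_convergent [OF op_exp_G_uniformly_Cauchy]
    unfolding U_def uniformly_convergent_uniform_limit_iff .
  have lim: "(\<lambda>n. op_exp (G n) t x) \<longlonglongrightarrow> U t" if "0 \<le> t" for t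
    using tendsto_uniform_limitI [OF unif [of t], of t] that by simp
  have bound: "norm (U t) \<le> M * exp (\<alpha> * t) * norm x" if "0 \<le> t" for t
    by (rule LIMSEQ_le_const2 [OF tendsto_norm [OF lim [OF that]]]) (auto intro: op_exp_G_bound [OF that])
  have cont_T: "continuous_on {0..T} U" for T
    by (rule uniform_limit_theorem [OF _ unif]) (auto intro: always_eventually continuous_op_exp_G)
  have cont: "continuous_on {0..} U"
  proof -
    have "continuous (at t within {0..}) U" if "0 \<le> t" for t
    proof -
      have "at t within {0..} = at t within {0..t + 1}"
        by (rule at_within_nhd [of _ "{..<t + 1}"]) auto
      moreover have "continuous (at t within {0..t + 1}) U"
        using cont_T [of "t + 1"] that by (simp add: continuous_on_eq_continuous_within)
      ultimately show ?thesis by (simp add: continuous_within)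
    qed
    thus ?thesis by (simp add: continuous_on_eq_continuous_within)
  qed
  have "((\<lambda>s. inner (U s) F) has_real_derivative inner (U t) (adj_gen F)) (at t within {0..})"
    if F: "F \<in> D" and t: "0 \<le> t" for F t
  proof (rule has_derivative_uniform_limit_atLeast [OF op_exp_inner_derivative _ _ t])
    show "(\<lambda>n. inner (op_exp (G n) t x) F) \<longlonglongrightarrow> inner (U t) F" if "0 \<le> t" for t
      by (intro tendsto_intros lim that)
    show "uniform_limit {0..T} (\<lambda>n t. inner (op_exp (G n) t x) (G' n F)) (\<lambda>t. inner (U t) (adj_gen F)) sequentially"
      if T: "0 \<le> T" for T
    proof (rule bounded_bilinear.bounded_uniform_limit [OF bounded_bilinear_inner unif])
      show "uniform_limit {0..T} (\<lambda>n _. G' n F) (\<lambda>_. adj_gen F) sequentially"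
        unfolding uniform_limit_iff using tendstoD [OF G'_tendsto [OF F]]
        by (auto elim: eventually_mono)
      show "bounded (U ` {0..T})"
        by (intro compact_imp_bounded compact_continuous_image cont_T) auto
    qed (auto simp: image_constant_conv)
  qed
  moreover have "U 0 = x"
    using lim [of 0] by (simp add: op_exp_0 [OF G] LIMSEQ_const_iff)
  ultimately show ?thesis
    unfolding weak_solution_def using cont bound by blast
qed

text \<open>
  The weak equation persists under limits in the graph of the adjoint generator. This is what allows
  testing with \<open>e\<^bsup>\<tau>G\<^sub>n*\<^esup> F\<close>, which need not belong to \<open>D\<close>.
\<close>

lemma weak_solution_adj_gen_limit:
  assumes U: "weak_solution U"
    and D: "\<And>n. F n \<in> D" and F: "F \<longlonglongrightarrow> f" and Y: "(\<lambda>n. adj_gen (F n)) \<longlonglongrightarrow> y"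
    and t: "0 \<le> t"
  shows "((\<lambda>s. inner (U s) f) has_real_derivative inner (U t) y) (at t within {0..})"
proof (rule has_derivative_uniform_limit_atLeast [OF _ _ _ t])
  show "((\<lambda>s. inner (U s) (F n)) has_real_derivative inner (U t) (adj_gen (F n))) (at t within {0..})"
    if "0 \<le> t" for n t
    using U D that by (auto simp: weak_solution_def)
  show "(\<lambda>n. inner (U t) (F n)) \<longlonglongrightarrow> inner (U t) f" for t
    by (intro tendsto_intros F)
  show "uniform_limit {0..T} (\<lambda>n t. inner (U t) (adj_gen (F n))) (\<lambda>t. inner (U t) y) sequentially"
    if "0 \<le> T" for T
  proof (rule bounded_bilinear.bounded_uniform_limit [OF bounded_bilinear_inner])
    show "uniform_limit {0..T} (\<lambda>_. U) U sequentially"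
      unfolding uniform_limit_iff by auto
    show "uniform_limit {0..T} (\<lambda>n _. adj_gen (F n)) (\<lambda>_. y) sequentially"
      unfolding uniform_limit_iff using tendstoD [OF Y] by (auto elim: eventually_mono)
    have "continuous_on {0..T} U"
      using U unfolding weak_solution_def by (auto intro: continuous_on_subset)
    thus "bounded (U ` {0..T})"
      by (intro compact_imp_bounded compact_continuous_image) auto
  qed (auto simp: image_constant_conv)
qed

lemma G'_D: "F \<in> D \<Longrightarrow> G' n F \<in> D"
  unfolding G'_def by (intro subspace_diff subspace_sum subspace_D A'_D K_D B'_D)

lemma funpow_G'_D: "F \<in> D \<Longrightarrow> (G' n ^^ m) F \<in> D"
  by (induction m) (auto intro: G'_D)

lemma deriv_D_eqI: "(\<lambda>n. K j n F) \<longlonglongrightarrow> y \<Longrightarrow> deriv_D j F = y"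
  unfolding deriv_D_def by (rule limI)

lemma deriv_D_funpow_G': "F \<in> D \<Longrightarrow> deriv_D j ((G' n ^^ m) F) = (G' n ^^ m) (deriv_D j F)"
proof (induction m)
  case (Suc m)
  have "(\<lambda>i. K j i ((G' n ^^ Suc m) F)) \<longlonglongrightarrow> G' n (deriv_D j ((G' n ^^ m) F))"
    using bounded_linear.tendsto [OF G' deriv_D [OF funpow_G'_D [OF Suc.prems]]]
    by (simp add: K_G')
  from deriv_D_eqI [OF this] Suc show ?case by simp
qed simp

text \<open>
  The partial sums of the exponential series stay in \<open>D\<close>, and \<open>\<partial>\<^sub>j\<close> commutes with them, so along the
  partial sums both the vectors and their images under \<open>adj_gen\<close> converge.
\<close>

lemma weak_solution_op_exp_G':
  assumes U: "weak_solution U" and F: "F \<in> D" and t: "0 \<le> t"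
  shows "((\<lambda>s. inner (U s) (op_exp (G' n) \<tau> F)) has_real_derivative
    inner (U t) ((\<Sum>j\<in>UNIV. A' j (op_exp (G' n) \<tau> (deriv_D j F))) - B' (op_exp (G' n) \<tau> F)))
    (at t within {0..})"
proof -
  define W where "W N x = (\<Sum>m<N. (\<tau> ^ m / fact m) *\<^sub>R (G' n ^^ m) x)" for N x
  have W_lim: "(\<lambda>N. W N x) \<longlonglongrightarrow> op_exp (G' n) \<tau> x" for x
    using op_exp_sums [OF G', of \<tau> n x] unfolding W_def sums_def .
  have W_D: "W N F \<in> D" for N
    unfolding W_def by (intro subspace_sum subspace_scale subspace_D funpow_G'_D F)
  have "deriv_D j (W N F) = W N (deriv_D j F)" for j N
  proof (rule deriv_D_eqI)
    have "(\<lambda>i. \<Sum>m<N. (\<tau> ^ m / fact m) *\<^sub>R K j i ((G' n ^^ m) F)) \<longlonglongrightarrow>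
        (\<Sum>m<N. (\<tau> ^ m / fact m) *\<^sub>R deriv_D j ((G' n ^^ m) F))"
      by (intro tendsto_intros deriv_D funpow_G'_D F)
    thus "(\<lambda>i. K j i (W N F)) \<longlonglongrightarrow> W N (deriv_D j F)"
      by (simp add: W_def deriv_D_funpow_G' F linear_sum [OF lin(6)] linear_cmul [OF lin(6)])
  qed
  hence "(\<lambda>N. adj_gen (W N F)) \<longlonglongrightarrow>
      (\<Sum>j\<in>UNIV. A' j (op_exp (G' n) \<tau> (deriv_D j F))) - B' (op_exp (G' n) \<tau> F)"
    unfolding adj_gen_def
    by (simp only:) (intro tendsto_intros bounded_linear.tendsto [OF A'] bounded_linear.tendsto [OF B'] W_lim)
  from weak_solution_adj_gen_limit [OF U W_D W_lim this t] show ?thesis .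
qed

text \<open>
  Testing with the backward evolution \<open>e\<^bsup>(T-t)G\<^sub>n*\<^esup> F\<close> leaves the remainder \<open>\<langle>U(t), R(t)\<rangle>\<close>, where \<open>R\<close> contains
  \<open>\<partial>\<^sub>j F - K\<^sub>j\<^sub>n F\<close> only. It tends to \<open>0\<close> as \<open>n \<rightarrow> \<infinity>\<close>, so \<open>U(T)\<close> is orthogonal to the dense set \<open>D\<close>.
\<close>

lemma weak_solution_zero:
  assumes U: "weak_solution U" and U0: "U 0 = 0" and T: "0 \<le> T"
  shows "U T = 0"
proof -
  have cont: "continuous_on {0..} U"
    using U by (simp add: weak_solution_def)
  have "bounded (U ` {0..T})"
    by (intro compact_imp_bounded compact_continuous_image continuous_on_subset [OF cont]) auto
  then obtain C where "\<forall>t\<in>{0..T}. norm (U t) \<le> C"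
    by (auto simp: bounded_iff)
  hence C: "\<And>t. 0 \<le> t \<Longrightarrow> t \<le> T \<Longrightarrow> norm (U t) \<le> C" by auto
  have orth: "inner (U T) F = 0" if F: "F \<in> D" for F
  proof -
    define \<delta> where "\<delta> n = (\<Sum>j\<in>UNIV. onorm (A' j) * norm (deriv_D j F - K j n F))" for n
    have est: "\<bar>inner (U T) F\<bar> \<le> C * (M * exp (\<alpha> * T) * \<delta> n) * T" for n
    proof -
      define R where "R t = (\<Sum>j\<in>UNIV. A' j (op_exp (G' n) (T - t) (deriv_D j F - K j n F)))" for t
      define r where "r t = inner (U t) (R t)" for t
      have "\<bar>inner (U T) F - inner (U 0) (op_exp (G' n) T F)\<bar> \<le> (C * (M * exp (\<alpha> * T) * \<delta> n)) * T"
      proof (rule op_exp_G'_duality_estimate [OF cont T])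
        fix t assume t: "0 \<le> t" "t \<le> T"
        have "norm (R t) \<le> (\<Sum>j\<in>UNIV. onorm (A' j) * (M * exp (\<alpha> * (T - t)) * norm (deriv_D j F - K j n F)))"
          unfolding R_def using t
          by (intro sum_norm_le order_trans [OF onorm [OF A']] mult_left_mono op_exp_G'_bound onorm_pos_le A') auto
        also have "\<dots> = M * exp (\<alpha> * (T - t)) * \<delta> n"
          by (simp add: \<delta>_def sum_distrib_left mult_ac)
        also have "\<dots> \<le> M * exp (\<alpha> * T) * \<delta> n"
          using t \<alpha>_nonneg M_pos unfolding \<delta>_def
          by (intro mult_right_mono mult_left_mono sum_nonneg mult_nonneg_nonneg onorm_pos_le A')
            (auto intro: mult_left_mono)
        finally have R: "norm (R t) \<le> M * exp (\<alpha> * T) * \<delta> n" .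
        have "\<bar>r t\<bar> \<le> norm (U t) * norm (R t)"
          unfolding r_def by (rule Cauchy_Schwarz_ineq2)
        also have "\<dots> \<le> C * (M * exp (\<alpha> * T) * \<delta> n)"
          using C [OF t] by (intro mult_mono R) (auto intro: order_trans [OF norm_ge_zero])
        finally show "\<bar>r t\<bar> \<le> C * (M * exp (\<alpha> * T) * \<delta> n)" .
        have KW: "K j n (op_exp (G' n) (T - t) F) = op_exp (G' n) (T - t) (K j n F)" for j
          using op_exp_commute [of "G' n" "K j n" "T - t" F] G' K K_G' by simp
        have "(\<Sum>j\<in>UNIV. A' j (op_exp (G' n) (T - t) (deriv_D j F))) - B' (op_exp (G' n) (T - t) F) =
            G' n (op_exp (G' n) (T - t) F) + R t"
          by (simp add: G'_def KW R_def op_exp_diff [OF G'] linear_diff [OF lin(2)] sum_subtractf)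
        with weak_solution_op_exp_G' [OF U F t(1), of n "T - t"]
        show "((\<lambda>s. inner (U s) (op_exp (G' n) (T - t) F)) has_real_derivative
            inner (U t) (G' n (op_exp (G' n) (T - t) F)) + r t) (at t within {0..})"
          by (simp add: r_def inner_add_right)
      qed
      thus ?thesis by (simp add: U0)
    qed
    have "\<delta> \<longlonglongrightarrow> (\<Sum>j\<in>UNIV. onorm (A' j) * norm (deriv_D j F - deriv_D j F))"
      unfolding \<delta>_def by (intro tendsto_intros deriv_D F)
    hence "(\<lambda>n. C * (M * exp (\<alpha> * T) * \<delta> n) * T) \<longlonglongrightarrow> C * (M * exp (\<alpha> * T) * 0) * T"
      by (intro tendsto_intros) simp
    hence "\<bar>inner (U T) F\<bar> \<le> C * (M * exp (\<alpha> * T) * 0) * T"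
      by (rule LIMSEQ_le_const) (use est in auto)
    thus ?thesis by simp
  qed
  have "inner (U T) x = 0" for x
  proof -
    have "x \<in> closure D" using dense_D by simp
    then obtain F where "\<And>n. F n \<in> D" "F \<longlonglongrightarrow> x"
      by (auto simp: closure_sequential)
    with orth have "(\<lambda>n. 0) \<longlonglongrightarrow> inner (U T) x"
      using tendsto_inner [OF tendsto_const [of "U T"], of F x] by simp
    thus ?thesis by (simp add: LIMSEQ_const_iff)
  qed
  from this [of "U T"] show ?thesis by simp
qed

theorem weak_solution_unique:
  assumes U: "weak_solution U" and V: "weak_solution V" and "U 0 = V 0" and "0 \<le> t"
  shows "U t = V t"
proof -
  have "weak_solution (\<lambda>t. U t - V t)"
    using U V unfolding weak_solution_def
    by (auto intro!: continuous_intros DERIV_diff simp: inner_diff_left)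
  from weak_solution_zero [OF this] assms(3,4) show ?thesis by simp
qed

lemma deriv_D_add: "F \<in> D \<Longrightarrow> F' \<in> D \<Longrightarrow> deriv_D j (F + F') = deriv_D j F + deriv_D j F'"
  by (rule deriv_D_eqI) (simp add: linear_add [OF lin(6)] tendsto_add deriv_D)

lemma deriv_D_scaleR: "F \<in> D \<Longrightarrow> deriv_D j (r *\<^sub>R F) = r *\<^sub>R deriv_D j F"
  by (rule deriv_D_eqI) (simp add: linear_cmul [OF lin(6)] tendsto_scaleR deriv_D)

lemma adj_gen_add: "F \<in> D \<Longrightarrow> F' \<in> D \<Longrightarrow> adj_gen (F + F') = adj_gen F + adj_gen F'"
  by (simp add: adj_gen_def deriv_D_add linear_add [OF lin(2)] linear_add [OF lin(4)] sum.distrib)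

lemma adj_gen_scaleR: "F \<in> D \<Longrightarrow> adj_gen (r *\<^sub>R F) = r *\<^sub>R adj_gen F"
  by (simp add: adj_gen_def deriv_D_scaleR linear_cmul [OF lin(2)] linear_cmul [OF lin(4)]
      scaleR_diff_right scaleR_sum_right)

lemma weak_solution_spanI:
  assumes cont: "continuous_on {0..} U" and S: "D = span S"
    and weak: "\<And>F t. F \<in> S \<Longrightarrow> 0 \<le> t \<Longrightarrow>
      ((\<lambda>s. inner (U s) F) has_real_derivative inner (U t) (adj_gen F)) (at t within {0..})"
  shows "weak_solution U"
proof -
  define W where "W = {F \<in> D. \<forall>t\<ge>0. ((\<lambda>s. inner (U s) F) has_real_derivative inner (U t) (adj_gen F)) (at t within {0..})}"
  have "subspace W"
  proof (rule subspaceI)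
    have "adj_gen 0 = 0" using adj_gen_scaleR [of 0 0] subspace_0 [OF subspace_D] by simp
    thus "0 \<in> W" using subspace_0 [OF subspace_D] by (simp add: W_def)
  next
    fix F F' assume "F \<in> W" "F' \<in> W"
    thus "F + F' \<in> W"
      by (auto simp: W_def adj_gen_add inner_add_right intro!: DERIV_add subspace_add [OF subspace_D])
  next
    fix F r assume "F \<in> W"
    thus "r *\<^sub>R F \<in> W"
      by (auto simp: W_def adj_gen_scaleR intro!: DERIV_cmult subspace_scale [OF subspace_D])
  qed
  moreover have "S \<subseteq> W" using weak S span_superset by (auto simp: W_def)
  ultimately have "D \<subseteq> W" unfolding S by (rule span_minimal [rotated])
  thus ?thesis unfolding weak_solution_def W_def using cont by blast
qed

end

section \<open>The Hilbert space of square integrable functions\<close>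

lemma in_L2_measurable [measurable_dest]: "in_L2 f \<Longrightarrow> f \<in> borel_measurable borel"
  by (simp add: in_L2_def)

lemma in_L2_integrable: "in_L2 f \<Longrightarrow> integrable lborel (\<lambda>x. (norm (f x))\<^sup>2)"
  by (simp add: in_L2_def)

lemma in_L2_bound:
  assumes [measurable]: "f \<in> borel_measurable lborel" and "integrable lborel w"
    and "\<And>x. (norm (f x))\<^sup>2 \<le> w x"
  shows "in_L2 f"
  unfolding in_L2_def
proof
  show "integrable lborel (\<lambda>x. (norm (f x))\<^sup>2)"
    by (rule Bochner_Integration.integrable_bound [OF assms(2)])
      (use assms in \<open>auto intro!: AE_I2 order_trans [OF _ abs_ge_self]\<close>)
qed fact

lemma in_L2_0 [simp]: "in_L2 (\<lambda>x. 0)"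
  by (simp add: in_L2_def)

lemma in_L2_scaleR: "in_L2 f \<Longrightarrow> in_L2 (\<lambda>x. r *\<^sub>R f x)"
  by (rule in_L2_bound [of _ "\<lambda>x. r\<^sup>2 * (norm (f x))\<^sup>2"])
    (auto simp: power_mult_distrib intro!: in_L2_integrable in_L2_measurable borel_measurable_scaleR)

lemma norm_add_squared_le: "(norm (x + y))\<^sup>2 \<le> 2 * (norm x)\<^sup>2 + 2 * (norm y)\<^sup>2"
  for x y :: "'a::real_normed_vector"
proof -
  have "(norm (x + y))\<^sup>2 \<le> (norm x + norm y)\<^sup>2"
    by (intro power_mono norm_triangle_ineq) auto
  also have "\<dots> \<le> 2 * (norm x)\<^sup>2 + 2 * (norm y)\<^sup>2"
    using sum_squares_bound [of "norm x" "norm y"] by (simp add: power2_sum)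
  finally show ?thesis .
qed

lemma in_L2_add: "in_L2 f \<Longrightarrow> in_L2 g \<Longrightarrow> in_L2 (\<lambda>x. f x + g x)"
  by (rule in_L2_bound [of _ "\<lambda>x. 2 * (norm (f x))\<^sup>2 + 2 * (norm (g x))\<^sup>2"])
    (auto intro!: in_L2_integrable in_L2_measurable norm_add_squared_le borel_measurable_add
      Bochner_Integration.integrable_add integrable_mult_right)

lemma in_L2_minus: "in_L2 f \<Longrightarrow> in_L2 (\<lambda>x. - f x)"
  using in_L2_scaleR [of f "- 1"] by simp

lemma in_L2_diff: "in_L2 f \<Longrightarrow> in_L2 g \<Longrightarrow> in_L2 (\<lambda>x. f x - g x)"
  using in_L2_add [OF _ in_L2_minus, of f g] by simp

lemma in_L2_inner: "in_L2 f \<Longrightarrow> in_L2 g \<Longrightarrow> integrable lborel (\<lambda>x. inner (f x) (g x))"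
proof -
  assume fg: "in_L2 f" "in_L2 g"
  note [measurable] = fg [THEN in_L2_measurable]
  show ?thesis
  proof (rule Bochner_Integration.integrable_bound)
    show "integrable lborel (\<lambda>x. (norm (f x))\<^sup>2 + (norm (g x))\<^sup>2)"
      using fg by (auto intro: in_L2_integrable)
    have "\<bar>inner (f x) (g x)\<bar> \<le> (norm (f x))\<^sup>2 + (norm (g x))\<^sup>2" for x
      using Cauchy_Schwarz_ineq2 [of "f x" "g x"] sum_squares_bound [of "norm (f x)" "norm (g x)"]
      mult_nonneg_nonneg [of "norm (f x)" "norm (g x)"] by auto
    thus "AE x in lborel. norm (inner (f x) (g x)) \<le> norm ((norm (f x))\<^sup>2 + (norm (g x))\<^sup>2)"
      by simp
  qed measurable
qed

lemma in_L2_translate: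
  assumes "in_L2 f" shows "in_L2 (\<lambda>x. f (x + y))"
proof -
  have "integrable (distr lborel borel ((+) y)) (\<lambda>x. (norm (f x))\<^sup>2)"
    using in_L2_integrable [OF assms] by (simp add: lborel_distr_plus)
  hence "integrable lborel (\<lambda>x. (norm (f (y + x)))\<^sup>2)"
    by (subst (asm) integrable_distr_eq)
      (use assms in \<open>auto intro!: in_L2_measurable borel_measurable_power borel_measurable_norm\<close>)
  moreover have "(\<lambda>x. f (x + y)) \<in> borel_measurable lborel"
    using in_L2_measurable [OF assms] by measurable
  ultimately show ?thesis by (simp add: in_L2_def add.commute)
qed

lemma lborel_integral_translate:
  fixes f :: "'a::euclidean_space \<Rightarrow> real"
  assumes [measurable]: "f \<in> borel_measurable borel"
  shows "(\<integral>x. f (x + y) \<partial>lborel) = (\<integral>x. f x \<partial>lborel)"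
proof -
  have "(\<integral>x. f x \<partial>lborel) = (\<integral>x. f x \<partial>distr lborel borel ((+) y))"
    by (simp add: lborel_distr_plus)
  also have "\<dots> = (\<integral>x. f (y + x) \<partial>lborel)"
    by (rule integral_distr) auto
  finally show ?thesis by (simp add: add.commute)
qed

lemma AE_lborel_translate:
  fixes y :: "'a::euclidean_space"
  assumes "AE x in lborel. P x" shows "AE x in lborel. P (x + y)"
proof -
  have "AE x in distr lborel borel ((+) y). P x"
    unfolding lborel_distr_plus by fact
  hence "AE x in lborel. P (y + x)"
    by (rule AE_distrD [rotated]) simp
  thus ?thesis by (simp add: add.commute)
qed

lemma in_L2_matrix:
  assumes "in_L2 f" shows "in_L2 (\<lambda>x. complex_matrix M *v f x)"
proof (rule in_L2_bound)
  let ?K = "onorm ((*v) (complex_matrix M))"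
  have bl: "bounded_linear ((*v) (complex_matrix M))"
    by (rule matrix_vector_mul_bounded_linear)
  have [measurable]: "(*v) (complex_matrix M) \<in> borel_measurable borel"
    using bl by (intro borel_measurable_continuous_onI linear_continuous_on)
  show "(\<lambda>x. complex_matrix M *v f x) \<in> borel_measurable lborel"
    using in_L2_measurable [OF assms] by measurable
  show "integrable lborel (\<lambda>x. ?K\<^sup>2 * (norm (f x))\<^sup>2)"
    using in_L2_integrable [OF assms] by simp
  show "(norm (complex_matrix M *v f x))\<^sup>2 \<le> ?K\<^sup>2 * (norm (f x))\<^sup>2" for x
    unfolding power_mult_distrib [symmetric] by (intro power_mono onorm bl) auto
qed

text \<open>
  The partial equivalence relation whose classes are the elements of \<open>L\<^sup>2\<close>; only square integrable
  functions are related to themselves.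
\<close>

definition L2_eq :: "(real^'d \<Rightarrow> complex^'n) \<Rightarrow> (real^'d \<Rightarrow> complex^'n) \<Rightarrow> bool" where
  "L2_eq f g \<longleftrightarrow> in_L2 f \<and> in_L2 g \<and> (AE x in lborel. f x = g x)"

quotient_type ('d, 'n) L2 = "real^'d::finite \<Rightarrow> complex^'n::finite" / partial: L2_eq
proof (rule part_equivpI)
  show "\<exists>f. L2_eq f f" by (rule exI [of _ "\<lambda>x. 0"]) (simp add: L2_eq_def)
  show "symp L2_eq" by (auto simp: symp_def L2_eq_def)
  show "transp L2_eq" unfolding transp_def L2_eq_def by (metis (mono_tags, lifting) AE_mp AE_I2)
qed

instantiation L2 :: (finite, finite) real_vector
begin

lift_definition zero_L2 :: "('a, 'b) L2" is "\<lambda>x. 0"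
  by (simp add: L2_eq_def)

lift_definition plus_L2 :: "('a, 'b) L2 \<Rightarrow> ('a, 'b) L2 \<Rightarrow> ('a, 'b) L2" is "\<lambda>f g x. f x + g x"
  by (auto simp: L2_eq_def in_L2_add)

lift_definition minus_L2 :: "('a, 'b) L2 \<Rightarrow> ('a, 'b) L2 \<Rightarrow> ('a, 'b) L2" is "\<lambda>f g x. f x - g x"
  by (auto simp: L2_eq_def in_L2_diff)

lift_definition uminus_L2 :: "('a, 'b) L2 \<Rightarrow> ('a, 'b) L2" is "\<lambda>f x. - f x"
  by (auto simp: L2_eq_def in_L2_minus)

lift_definition scaleR_L2 :: "real \<Rightarrow> ('a, 'b) L2 \<Rightarrow> ('a, 'b) L2" is "\<lambda>r f x. r *\<^sub>R f x"
  by (auto simp: L2_eq_def in_L2_scaleR)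

instance
proof
  fix f g h :: "('a, 'b) L2" and r s :: real
  show "f + g + h = f + (g + h)" by transfer (simp add: L2_eq_def in_L2_add add.assoc)
  show "f + g = g + f" by transfer (simp add: L2_eq_def in_L2_add add.commute)
  show "0 + f = f" by transfer (simp add: L2_eq_def)
  show "- f + f = 0" by transfer (simp add: L2_eq_def)
  show "f - g = f + - g" by transfer (simp add: L2_eq_def in_L2_diff in_L2_add in_L2_minus)
  show "r *\<^sub>R (f + g) = r *\<^sub>R f + r *\<^sub>R g"
    by transfer (simp add: L2_eq_def in_L2_scaleR in_L2_add scaleR_add_right)
  show "(r + s) *\<^sub>R f = r *\<^sub>R f + s *\<^sub>R f"
    by transfer (simp add: L2_eq_def in_L2_scaleR in_L2_add scaleR_add_left)
  show "r *\<^sub>R s *\<^sub>R f = (r * s) *\<^sub>R f" by transfer (simp add: L2_eq_def in_L2_scaleR)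
  show "1 *\<^sub>R f = f" by transfer (simp add: L2_eq_def)
qed

end

instantiation L2 :: (finite, finite) real_inner
begin

lift_definition inner_L2 :: "('a, 'b) L2 \<Rightarrow> ('a, 'b) L2 \<Rightarrow> real" is "\<lambda>f g. \<integral>x. inner (f x) (g x) \<partial>lborel"
  unfolding L2_eq_def
  by (intro integral_cong_AE) (auto intro!: borel_measurable_inner in_L2_measurable)

definition norm_L2 :: "('a, 'b) L2 \<Rightarrow> real" where "norm_L2 f = sqrt (inner f f)"
definition dist_L2 :: "('a, 'b) L2 \<Rightarrow> ('a, 'b) L2 \<Rightarrow> real" where "dist_L2 f g = norm (f - g)"
definition sgn_L2 :: "('a, 'b) L2 \<Rightarrow> ('a, 'b) L2" where "sgn_L2 f = f /\<^sub>R norm f"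
definition uniformity_L2 :: "(('a, 'b) L2 \<times> ('a, 'b) L2) filter" where
  "uniformity_L2 = (INF e\<in>{0<..}. principal {(x, y). dist x y < e})"
definition open_L2 :: "('a, 'b) L2 set \<Rightarrow> bool" where
  "open_L2 S \<longleftrightarrow> (\<forall>x\<in>S. \<forall>\<^sub>F (x', y) in uniformity. x' = x \<longrightarrow> y \<in> S)"

instance
proof
  fix f g h :: "('a, 'b) L2" and r :: real and S :: "('a, 'b) L2 set"
  show "inner f g = inner g f" by transfer (simp add: inner_commute)
  show "inner (f + g) h = inner f h + inner g h"
    by transfer (simp add: L2_eq_def inner_add_left in_L2_inner)
  show "inner (r *\<^sub>R f) g = r * inner f g"
    by transfer (simp add: L2_eq_def)
  show "0 \<le> inner f f" by transfer (simp add: integral_nonneg_AE)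
  show "(inner f f = 0) = (f = 0)"
  proof transfer
    fix f :: "real^'a \<Rightarrow> complex^'b" assume "L2_eq f f"
    hence f: "in_L2 f" by (simp add: L2_eq_def)
    show "((\<integral>x. inner (f x) (f x) \<partial>lborel) = 0) = L2_eq f (\<lambda>x. 0)"
      using f integral_nonneg_eq_0_iff_AE [OF in_L2_inner [OF f f]] by (simp add: L2_eq_def)
  qed
  show "norm f = sqrt (inner f f)" by (fact norm_L2_def)
  show "dist f g = norm (f - g)" by (fact dist_L2_def)
  show "sgn f = f /\<^sub>R norm f" by (fact sgn_L2_def)
  show "uniformity = (INF e\<in>{0<..}. principal {(x::('a, 'b) L2, y). dist x y < e})"
    by (fact uniformity_L2_def)
  show "open S \<longleftrightarrow> (\<forall>x\<in>S. \<forall>\<^sub>F (x', y) in uniformity. x' = x \<longrightarrow> y \<in> S)"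
    by (fact open_L2_def)
qed

end

lift_definition translate :: "real^'d \<Rightarrow> ('d::finite, 'n::finite) L2 \<Rightarrow> ('d, 'n) L2" is
  "\<lambda>y f x. f (x + y)"
proof -
  fix y :: "real^'d" and f g :: "real^'d \<Rightarrow> complex^'n"
  assume "L2_eq f g"
  thus "L2_eq (\<lambda>x. f (x + y)) (\<lambda>x. g (x + y))"
    using AE_lborel_translate [of "\<lambda>x. f x = g x" y] by (auto simp: L2_eq_def in_L2_translate)
qed

lift_definition mat_app :: "real^'n^'n \<Rightarrow> ('d::finite, 'n::finite) L2 \<Rightarrow> ('d, 'n) L2" is
  "\<lambda>M f x. complex_matrix M *v f x"
  by (auto simp: L2_eq_def in_L2_matrix)

lemma in_L2_rep: "in_L2 (rep_L2 f)"
  using Quotient3_rep_reflp [OF Quotient3_L2, of f] by (simp add: L2_eq_def)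

lemma abs_rep_L2 [simp]: "abs_L2 (rep_L2 f) = f"
  by (rule Quotient3_abs_rep [OF Quotient3_L2])

lemma rep_abs_L2: "in_L2 f \<Longrightarrow> AE x in lborel. rep_L2 (abs_L2 f) x = f x"
  using Quotient3_rep_abs [OF Quotient3_L2, of f] by (simp add: L2_eq_def)

lemma abs_L2_eq_iff: "in_L2 f \<Longrightarrow> in_L2 g \<Longrightarrow> abs_L2 f = abs_L2 g \<longleftrightarrow> (AE x in lborel. f x = g x)"
  using Quotient3_rel [OF Quotient3_L2, of f g] by (simp add: L2_eq_def)

lemma L2_eq_refl: "in_L2 f \<Longrightarrow> L2_eq f f"
  by (simp add: L2_eq_def)

lemma abs_L2_add: "in_L2 f \<Longrightarrow> in_L2 g \<Longrightarrow> abs_L2 f + abs_L2 g = abs_L2 (\<lambda>x. f x + g x)"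
  by (simp add: plus_L2.abs_eq L2_eq_refl)

lemma abs_L2_diff: "in_L2 f \<Longrightarrow> in_L2 g \<Longrightarrow> abs_L2 f - abs_L2 g = abs_L2 (\<lambda>x. f x - g x)"
  by (simp add: minus_L2.abs_eq L2_eq_refl)

lemma abs_L2_scaleR: "in_L2 f \<Longrightarrow> r *\<^sub>R abs_L2 f = abs_L2 (\<lambda>x. r *\<^sub>R f x)"
  by (simp add: scaleR_L2.abs_eq L2_eq_refl)

lemma inner_abs_L2: "in_L2 f \<Longrightarrow> in_L2 g \<Longrightarrow> inner (abs_L2 f) (abs_L2 g) = (\<integral>x. inner (f x) (g x) \<partial>lborel)"
  by (simp add: inner_L2.abs_eq L2_eq_refl)

lemma norm_abs_L2: "in_L2 f \<Longrightarrow> norm (abs_L2 f) = L2_norm f"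
  by (simp add: norm_eq_sqrt_inner inner_abs_L2 L2_norm_def power2_norm_eq_inner)

lemma abs_L2_translate: "in_L2 f \<Longrightarrow> translate y (abs_L2 f) = abs_L2 (\<lambda>x. f (x + y))"
  by (simp add: translate.abs_eq L2_eq_refl)

lemma abs_L2_mat_app: "in_L2 f \<Longrightarrow> mat_app M (abs_L2 f) = abs_L2 (\<lambda>x. complex_matrix M *v f x)"
  by (simp add: mat_app.abs_eq L2_eq_refl)

lemma norm_abs_L2_squared: "in_L2 f \<Longrightarrow> (norm (abs_L2 f))\<^sup>2 = (\<integral>x. (norm (f x))\<^sup>2 \<partial>lborel)"
  by (simp add: power2_norm_eq_inner inner_abs_L2)

lemma L2_dominated_convergence:
  fixes f :: "nat \<Rightarrow> real^'d::finite \<Rightarrow> complex^'n::finite"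
  assumes meas: "\<And>n. f n \<in> borel_measurable borel" "g \<in> borel_measurable borel"
    and w: "integrable lborel w"
    and bound: "\<And>n x. (norm (f n x))\<^sup>2 \<le> w x"
    and lim: "\<And>x. (\<lambda>n. f n x) \<longlonglongrightarrow> g x"
  shows "in_L2 g" "(\<lambda>n. abs_L2 (f n)) \<longlonglongrightarrow> abs_L2 g"
proof -
  note [measurable] = meas
  have bound': "(norm (g x))\<^sup>2 \<le> w x" for x
    by (rule LIMSEQ_le_const2 [OF tendsto_power [OF tendsto_norm [OF lim]]]) (use bound in auto)
  have f: "in_L2 (f n)" for n
    by (rule in_L2_bound [OF _ w bound]) (simp add: meas)
  show g: "in_L2 g"
    by (rule in_L2_bound [OF _ w bound']) (simp add: meas)
  have "(\<lambda>n. \<integral>x. (norm (f n x - g x))\<^sup>2 \<partial>lborel) \<longlonglongrightarrow> (\<integral>x. (norm (g x - g x))\<^sup>2 \<partial>lborel)"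
  proof (rule integral_dominated_convergence [where w = "\<lambda>x. 4 * w x"])
    show "AE x in lborel. (\<lambda>n. (norm (f n x - g x))\<^sup>2) \<longlonglongrightarrow> (norm (g x - g x))\<^sup>2"
      by (intro AE_I2 tendsto_intros lim)
    show "AE x in lborel. norm ((norm (f n x - g x))\<^sup>2) \<le> 4 * w x" for n
    proof (rule AE_I2)
      fix x
      have "(norm (f n x - g x))\<^sup>2 \<le> 2 * (norm (f n x))\<^sup>2 + 2 * (norm (g x))\<^sup>2"
        using norm_add_squared_le [of "f n x" "- g x"] by simp
      thus "norm ((norm (f n x - g x))\<^sup>2) \<le> 4 * w x"
        using bound [of n x] bound' [of x] by simp
    qed
  qed (use w in auto)
  hence "(\<lambda>n. (norm (abs_L2 (f n) - abs_L2 g))\<^sup>2) \<longlonglongrightarrow> 0"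
    by (simp add: abs_L2_diff f g norm_abs_L2_squared in_L2_diff)
  hence "(\<lambda>n. sqrt ((norm (abs_L2 (f n) - abs_L2 g))\<^sup>2)) \<longlonglongrightarrow> sqrt 0"
    by (rule tendsto_real_sqrt)
  hence "(\<lambda>n. norm (abs_L2 (f n) - abs_L2 g)) \<longlonglongrightarrow> 0" by simp
  thus "(\<lambda>n. abs_L2 (f n)) \<longlonglongrightarrow> abs_L2 g"
    by (simp add: tendsto_norm_zero_iff Lim_null [symmetric])
qed

lemma nn_integral_norm_squared:
  "in_L2 f \<Longrightarrow> (\<integral>\<^sup>+x. ennreal ((norm (f x))\<^sup>2) \<partial>lborel) = ennreal ((norm (abs_L2 f))\<^sup>2)"
  by (simp add: norm_abs_L2_squared nn_integral_eq_integral in_L2_integrable)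

text \<open>
  The function \<open>\<Sum>\<^sub>k 4\<^sup>k \<bar>f\<^sub>k\<^sub>+\<^sub>1 - f\<^sub>k\<bar>\<^sup>2\<close> has a finite integral and is therefore finite almost everywhere; at
  such a point the increments are bounded by a multiple of \<open>2\<^sup>-\<^sup>k\<close>. The weight \<open>4\<^sup>k\<close> is small enough for
  the integral, the increments having squared norm at most \<open>16\<^sup>-\<^sup>k\<close>, and large enough for the summation.
\<close>

lemma L2_fast_Cauchy_AE:
  fixes f :: "nat \<Rightarrow> real^'d::finite \<Rightarrow> complex^'n::finite"
  assumes f: "\<And>k. in_L2 (f k)"
    and fast: "\<And>k. norm (abs_L2 (f (Suc k)) - abs_L2 (f k)) \<le> (1 / 4) ^ k"
  shows "AE x in lborel. convergent (\<lambda>k. f k x)"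
proof -
  note [measurable] = f [THEN in_L2_measurable]
  define g where "g k x = f (Suc k) x - f k x" for k x
  have g: "in_L2 (g k)" for k
    unfolding g_def by (intro in_L2_diff f)
  note [measurable] = g [THEN in_L2_measurable]
  have "(\<integral>\<^sup>+x. (\<Sum>k. ennreal (4 ^ k * (norm (g k x))\<^sup>2)) \<partial>lborel)
      = (\<Sum>k. \<integral>\<^sup>+x. ennreal (4 ^ k * (norm (g k x))\<^sup>2) \<partial>lborel)"
    by (rule nn_integral_suminf) measurable
  also have "\<dots> \<le> (\<Sum>k. ennreal ((1 / 4) ^ k))"
  proof (rule suminf_le)
    fix k
    have "(norm (abs_L2 (g k)))\<^sup>2 \<le> ((1 / 4) ^ k)\<^sup>2"
      using fast [of k] by (intro power_mono) (auto simp: g_def [abs_def] abs_L2_diff f)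
    hence "4 ^ k * (norm (abs_L2 (g k)))\<^sup>2 \<le> 4 ^ k * ((1 / 4) ^ k)\<^sup>2"
      by (rule mult_left_mono) auto
    also have "\<dots> = (1 / 4) ^ k"
      by (simp add: power2_eq_square power_one_over)
    finally have "ennreal (4 ^ k) * ennreal ((norm (abs_L2 (g k)))\<^sup>2) \<le> ennreal ((1 / 4) ^ k)"
      by (simp add: ennreal_mult [symmetric] ennreal_leI)
    thus "(\<integral>\<^sup>+x. ennreal (4 ^ k * (norm (g k x))\<^sup>2) \<partial>lborel) \<le> ennreal ((1 / 4) ^ k)"
      by (simp add: ennreal_mult nn_integral_cmult nn_integral_norm_squared g)
  qed auto
  also have "\<dots> = ennreal (\<Sum>k. (1 / 4) ^ k)"
    by (rule suminf_ennreal2) auto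
  also have "\<dots> < \<infinity>" by simp
  finally have "AE x in lborel. (\<Sum>k. ennreal (4 ^ k * (norm (g k x))\<^sup>2)) \<noteq> \<infinity>"
    by (intro nn_integral_PInf_AE) auto
  thus ?thesis
  proof (rule AE_mp, intro AE_I2 impI)
    fix x assume fin: "(\<Sum>k. ennreal (4 ^ k * (norm (g k x))\<^sup>2)) \<noteq> \<infinity>"
    define S where "S = enn2real (\<Sum>k. ennreal (4 ^ k * (norm (g k x))\<^sup>2))"
    have le: "norm (g k x) \<le> sqrt S * (1 / 2) ^ k" for k
    proof -
      have "sum (\<lambda>k. ennreal (4 ^ k * (norm (g k x))\<^sup>2)) {k} \<le> (\<Sum>k. ennreal (4 ^ k * (norm (g k x))\<^sup>2))"
        by (rule sum_le_suminf) (auto intro: summableI)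
      also have "\<dots> = ennreal S"
        using fin by (simp add: S_def top.not_eq_extremum)
      finally have "ennreal (4 ^ k * (norm (g k x))\<^sup>2) \<le> ennreal S" by simp
      hence "4 ^ k * (norm (g k x))\<^sup>2 \<le> S"
        by (subst (asm) ennreal_le_iff) (simp_all add: S_def)
      moreover have "(2 ^ k)\<^sup>2 = (4::real) ^ k"
        by (simp add: power2_eq_square flip: power_mult_distrib)
      ultimately have "(2 ^ k * norm (g k x))\<^sup>2 \<le> S"
        by (simp add: power_mult_distrib)
      hence "2 ^ k * norm (g k x) \<le> sqrt S"
        by (rule real_le_rsqrt)
      thus ?thesis by (simp add: field_simps)
    qed
    have "summable (\<lambda>k. sqrt S * (1 / 2) ^ k)"
      by (intro summable_mult summable_geometric) auto
    from summable_comparison_test' [OF this le] have "summable (\<lambda>k. g k x)" .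
    from tendsto_add [OF tendsto_const [of "f 0 x"] summable_LIMSEQ [OF this]]
    have "(\<lambda>n. f 0 x + (\<Sum>k<n. g k x)) \<longlonglongrightarrow> f 0 x + (\<Sum>k. g k x)" .
    moreover have "f 0 x + (\<Sum>k<n. g k x) = f n x" for n
      unfolding g_def by (subst sum_lessThan_telescope) simp
    ultimately show "convergent (\<lambda>k. f k x)"
      by (auto intro: convergentI)
  qed
qed

text \<open>
  Completeness (Riesz--Fischer): a rapidly converging subsequence converges almost everywhere, and by
  Fatou's lemma its pointwise limit is also its limit in \<open>L\<^sup>2\<close>.
\<close>

instance L2 :: (finite, finite) banach
proof
  fix X :: "nat \<Rightarrow> ('a, 'b) L2"
  assume X: "Cauchy X"
  \<comment> \<open>Each index exceeds the Cauchy threshold for its own tolerance as well as the index before it.\<close>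
  obtain r :: "nat \<Rightarrow> nat" where r: "strict_mono r"
    "\<And>k. norm (X (r (Suc k)) - X (r k)) \<le> (1 / 4) ^ k"
  proof -
    have "\<exists>N. \<forall>m\<ge>N. \<forall>n\<ge>N. norm (X m - X n) < (1 / 4) ^ k" for k
      using X by (intro CauchyD) auto
    then obtain N where N: "\<And>k m n. m \<ge> N k \<Longrightarrow> n \<ge> N k \<Longrightarrow> norm (X m - X n) < (1 / 4) ^ k"
      by metis
    define r where "r = rec_nat (N 0) (\<lambda>k m. max (Suc m) (N (Suc k)))"
    have r_Suc: "r (Suc k) = max (Suc (r k)) (N (Suc k))" for k by (simp add: r_def)
    have "r k \<ge> N k" for k by (cases k) (simp_all add: r_def)
    moreover have "r (Suc k) > r k" for k by (simp add: r_Suc)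
    ultimately have "norm (X (r (Suc k)) - X (r k)) \<le> (1 / 4) ^ k" for k
      using N [of k "r (Suc k)" "r k"] by (meson less_imp_le order_trans)
    moreover have "strict_mono r" using \<open>\<And>k. r (Suc k) > r k\<close> by (simp add: strict_mono_Suc_iff)
    ultimately show ?thesis using that by blast
  qed
  define f where "f k = rep_L2 (X (r k))" for k
  have f: "in_L2 (f k)" and abs_f: "abs_L2 (f k) = X (r k)" for k
    by (auto simp: f_def in_L2_rep)
  note [measurable] = f [THEN in_L2_measurable]
  define F where "F x = lim (\<lambda>k. f k x)" for x
  have F_meas [measurable]: "F \<in> borel_measurable borel"
    unfolding F_def by measurable
  have AE_lim: "AE x in lborel. (\<lambda>k. f k x) \<longlonglongrightarrow> F x"
    using L2_fast_Cauchy_AE [of f, OF f] r(2) by (simp add: abs_f F_def convergent_LIMSEQ_iff)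
  have fatou: "(\<integral>\<^sup>+x. ennreal ((norm (F x - f k x))\<^sup>2) \<partial>lborel) \<le> ennreal e"
    if "\<And>m. m \<ge> k \<Longrightarrow> (norm (X (r m) - X (r k)))\<^sup>2 \<le> e" for k e
  proof -
    have "(\<integral>\<^sup>+x. ennreal ((norm (F x - f k x))\<^sup>2) \<partial>lborel)
        = (\<integral>\<^sup>+x. liminf (\<lambda>m. ennreal ((norm (f m x - f k x))\<^sup>2)) \<partial>lborel)"
    proof (rule nn_integral_cong_AE, rule AE_mp [OF AE_lim], intro AE_I2 impI)
      fix x assume "(\<lambda>m. f m x) \<longlonglongrightarrow> F x"
      hence "(\<lambda>m. ennreal ((norm (f m x - f k x))\<^sup>2)) \<longlonglongrightarrow> ennreal ((norm (F x - f k x))\<^sup>2)"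
        by (intro tendsto_intros tendsto_ennrealI)
      from lim_imp_Liminf [OF _ this]
      show "ennreal ((norm (F x - f k x))\<^sup>2) = liminf (\<lambda>m. ennreal ((norm (f m x - f k x))\<^sup>2))"
        by simp
    qed
    also have "\<dots> \<le> liminf (\<lambda>m. \<integral>\<^sup>+x. ennreal ((norm (f m x - f k x))\<^sup>2) \<partial>lborel)"
      by (rule nn_integral_liminf) measurable
    also have "\<dots> \<le> ennreal e"
    proof (rule Liminf_le)
      show "\<forall>\<^sub>F m in sequentially. (\<integral>\<^sup>+x. ennreal ((norm (f m x - f k x))\<^sup>2) \<partial>lborel) \<le> ennreal e"
        using eventually_ge_at_top [of k]
      proof eventually_elim
        case (elim m)
        have "(\<integral>\<^sup>+x. ennreal ((norm (f m x - f k x))\<^sup>2) \<partial>lborel) = ennreal ((norm (X (r m) - X (r k)))\<^sup>2)"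
          using nn_integral_norm_squared [OF in_L2_diff [OF f f], of m k]
          by (simp add: abs_L2_diff [symmetric] f abs_f)
        thus ?case using that [OF elim] by (simp add: ennreal_leI)
      qed
    qed simp
    finally show ?thesis .
  qed
  have Xr: "Cauchy (X \<circ> r)"
    using X r(1) by (rule Cauchy_subseq_Cauchy)
  have in_L2_diff_F: "in_L2 (\<lambda>x. F x - f k x)" if "\<And>m. m \<ge> k \<Longrightarrow> (norm (X (r m) - X (r k)))\<^sup>2 \<le> e" for k e
    unfolding in_L2_def integrable_iff_bounded
    using fatou [OF that] by (auto simp: less_top [symmetric] top_unique)
  have tail: "\<exists>k0. \<forall>k\<ge>k0. \<forall>m\<ge>k. (norm (X (r m) - X (r k)))\<^sup>2 \<le> e\<^sup>2" if e: "e > 0" for e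
  proof -
    obtain k0 where k0: "\<And>m k. m \<ge> k0 \<Longrightarrow> k \<ge> k0 \<Longrightarrow> norm (X (r m) - X (r k)) < e"
      using CauchyD [OF Xr e] by auto
    have "(norm (X (r m) - X (r k)))\<^sup>2 \<le> e\<^sup>2" if "k \<ge> k0" "m \<ge> k" for m k
      using k0 [of m k] that by (intro power_mono) auto
    thus ?thesis by blast
  qed
  obtain k0 where "\<And>m. m \<ge> k0 \<Longrightarrow> (norm (X (r m) - X (r k0)))\<^sup>2 \<le> 1"
    using tail [of 1] by auto
  from in_L2_add [OF in_L2_diff_F [OF this] f [of k0]] have F: "in_L2 F" by simp
  have "(X \<circ> r) \<longlonglongrightarrow> abs_L2 F"
  proof (rule LIMSEQ_I)
    fix e :: real assume "e > 0"
    hence "e / 2 > 0" by simp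
    from tail [OF this] obtain k0 where
      k0: "\<And>k m. k \<ge> k0 \<Longrightarrow> m \<ge> k \<Longrightarrow> (norm (X (r m) - X (r k)))\<^sup>2 \<le> (e / 2)\<^sup>2" by blast
    have "norm ((X \<circ> r) k - abs_L2 F) < e" if "k \<ge> k0" for k
    proof -
      have "ennreal ((norm (abs_L2 F - X (r k)))\<^sup>2) \<le> ennreal ((e / 2)\<^sup>2)"
        using fatou [OF k0 [OF that]] nn_integral_norm_squared [OF in_L2_diff [OF F f [of k]]]
        by (simp add: abs_L2_diff [symmetric] F f abs_f)
      hence "(norm (abs_L2 F - X (r k)))\<^sup>2 \<le> (e / 2)\<^sup>2"
        by (subst (asm) ennreal_le_iff) auto
      hence "norm (abs_L2 F - X (r k)) \<le> e / 2"
        by (rule power2_le_imp_le) (use \<open>e > 0\<close> in simp)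
      thus ?thesis
        using \<open>e > 0\<close> norm_minus_commute [of "abs_L2 F" "X (r k)"] by simp
    qed
    thus "\<exists>no. \<forall>n\<ge>no. norm ((X \<circ> r) n - abs_L2 F) < e" by blast
  qed
  from Cauchy_converges_subseq [OF X r(1) this] show "convergent X"
    by (rule convergentI)
qed

section \<open>Translations and matrices acting on square integrable functions\<close>

lemma complex_matrix_mult_component:
  "(complex_matrix M *v x) $ i = (\<Sum>j\<in>UNIV. M $ i $ j *\<^sub>R (x $ j))"
  by (simp add: matrix_vector_mult_def map_matrix_def scaleR_conv_of_real)

lemma inner_complex_matrix:
  "inner (complex_matrix M *v x) y = inner x (complex_matrix (transpose M) *v y)"
proof -
  have "inner (complex_matrix M *v x) y = (\<Sum>i\<in>UNIV. \<Sum>j\<in>UNIV. M $ i $ j * inner (x $ j) (y $ i))"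
    by (simp add: inner_vec_def complex_matrix_mult_component inner_sum_left)
  also have "\<dots> = (\<Sum>j\<in>UNIV. \<Sum>i\<in>UNIV. M $ i $ j * inner (x $ j) (y $ i))"
    by (rule sum.swap)
  also have "\<dots> = inner x (complex_matrix (transpose M) *v y)"
    by (simp add: inner_vec_def complex_matrix_mult_component inner_sum_right transpose_def)
  finally show ?thesis .
qed

lemma L2_induct_rep: "(\<And>f. in_L2 f \<Longrightarrow> P (abs_L2 f)) \<Longrightarrow> P u"
  using in_L2_rep [of u] abs_rep_L2 [of u] by metis

lemma translate_add: "translate y (f + g) = translate y f + translate y g"
  by transfer (simp add: L2_eq_def in_L2_add in_L2_translate)

lemma translate_scaleR: "translate y (r *\<^sub>R f) = r *\<^sub>R translate y f"
  by transfer (simp add: L2_eq_def in_L2_scaleR in_L2_translate)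

lemma inner_translate_translate: "inner (translate y f) (translate y g) = inner f g"
proof transfer
  fix y :: "real^'a" and f g :: "real^'a \<Rightarrow> complex^'b"
  assume "L2_eq f f" "L2_eq g g"
  hence [measurable]: "f \<in> borel_measurable borel" "g \<in> borel_measurable borel"
    by (auto simp: L2_eq_def in_L2_measurable)
  show "(\<integral>x. inner (f (x + y)) (g (x + y)) \<partial>lborel) = (\<integral>x. inner (f x) (g x) \<partial>lborel)"
    by (rule lborel_integral_translate) measurable
qed

lemma norm_translate [simp]: "norm (translate y f) = norm f"
  by (simp add: norm_eq_sqrt_inner inner_translate_translate)

lemma bounded_linear_translate: "bounded_linear (translate y)"
  by (rule bounded_linear_intro [where K = 1]) (simp_all add: translate_add translate_scaleR)

lemma translate_translate: "translate y (translate z f) = translate (z + y) f"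
proof transfer
  fix y z :: "real^'a" and f :: "real^'a \<Rightarrow> complex^'b"
  assume "L2_eq f f"
  moreover have "(\<lambda>x. f (x + y + z)) = (\<lambda>x. f (x + (z + y)))"
    by (simp add: ac_simps)
  ultimately show "L2_eq (\<lambda>x. f (x + y + z)) (\<lambda>x. f (x + (z + y)))"
    by (simp add: L2_eq_def in_L2_translate)
qed

lemma translate_0 [simp]: "translate 0 f = f"
  by transfer (simp add: L2_eq_def)

lemma inner_translate: "inner (translate y f) g = inner f (translate (- y) g)"
  using inner_translate_translate [of "- y" "translate y f" g] by (simp add: translate_translate)

lemma mat_app_add: "mat_app M (f + g) = mat_app M f + mat_app M g"
  by transfer (simp add: L2_eq_def in_L2_add in_L2_matrix matrix_vector_right_distrib)

lemma mat_app_scaleR: "mat_app M (r *\<^sub>R f) = r *\<^sub>R mat_app M f"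
  by transfer (simp add: L2_eq_def in_L2_scaleR in_L2_matrix
      linear_cmul [OF bounded_linear.linear [OF matrix_vector_mul_bounded_linear]])

lemma mat_app_translate: "translate y (mat_app M f) = mat_app M (translate y f)"
  by transfer (simp add: L2_eq_def in_L2_translate in_L2_matrix)

lemma inner_mat_app: "inner (mat_app M f) g = inner f (mat_app (transpose M) g)"
  by transfer (simp add: inner_complex_matrix)

lemma bounded_linear_mat_app: "bounded_linear (mat_app M)"
proof (rule bounded_linear_intro [OF mat_app_add mat_app_scaleR])
  fix u :: "('a, 'b) L2"
  let ?K = "onorm ((*v) (complex_matrix M))"
  have bl: "bounded_linear ((*v) (complex_matrix M))"
    by (rule matrix_vector_mul_bounded_linear)
  show "norm (mat_app M u) \<le> norm u * ?K"
  proof (rule L2_induct_rep [of _ u])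
    fix f :: "real^'a \<Rightarrow> complex^'b" assume f: "in_L2 f"
    have "(norm (mat_app M (abs_L2 f)))\<^sup>2 = (\<integral>x. (norm (complex_matrix M *v f x))\<^sup>2 \<partial>lborel)"
      by (simp add: abs_L2_mat_app f norm_abs_L2_squared in_L2_matrix)
    also have "\<dots> \<le> (\<integral>x. ?K\<^sup>2 * (norm (f x))\<^sup>2 \<partial>lborel)"
    proof (rule integral_mono)
      show "(norm (complex_matrix M *v f x))\<^sup>2 \<le> ?K\<^sup>2 * (norm (f x))\<^sup>2" for x
        unfolding power_mult_distrib [symmetric] by (intro power_mono onorm bl) auto
    qed (auto intro!: in_L2_integrable in_L2_matrix f)
    also have "\<dots> = (norm (abs_L2 f) * ?K)\<^sup>2"
      by (simp add: norm_abs_L2_squared f power_mult_distrib)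
    finally show "norm (mat_app M (abs_L2 f)) \<le> norm (abs_L2 f) * ?K"
      by (rule power2_le_imp_le) (simp add: onorm_pos_le [OF bl])
  qed
qed

definition diff_quot :: "'d \<Rightarrow> nat \<Rightarrow> ('d::finite, 'n::finite) L2 \<Rightarrow> ('d, 'n) L2" where
  "diff_quot j n f = (real (Suc n) / 2) *\<^sub>R
     (translate (axis j (1 / real (Suc n))) f - translate (- axis j (1 / real (Suc n))) f)"

lemma bounded_linear_diff_quot: "bounded_linear (diff_quot j n)"
  unfolding diff_quot_def [abs_def]
  by (intro bounded_linear_const_scaleR bounded_linear_sub bounded_linear_translate)

lemma diff_quot_skew: "inner (diff_quot j n f) g = - inner f (diff_quot j n g)"
  by (simp add: diff_quot_def inner_diff_left inner_diff_right inner_translate algebra_simps)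

lemma diff_quot_commute:
  assumes "bounded_linear T" and "\<And>y f. T (translate y f) = translate y (T f)"
  shows "T (diff_quot j n f) = diff_quot j n (T f)"
  using assms(2)
  by (simp add: diff_quot_def linear_cmul [OF bounded_linear.linear [OF assms(1)]]
      linear_diff [OF bounded_linear.linear [OF assms(1)]])

lemma diff_quot_translate: "translate y (diff_quot j n f) = diff_quot j n (translate y f)"
  by (rule diff_quot_commute [OF bounded_linear_translate]) (simp add: translate_translate add.commute)

lemma diff_quot_diff_quot: "diff_quot j n (diff_quot i m f) = diff_quot i m (diff_quot j n f)"
  by (rule diff_quot_commute [OF bounded_linear_diff_quot]) (simp add: diff_quot_translate)

lemma diff_quot_mat_app: "diff_quot j n (mat_app M f) = mat_app M (diff_quot j n f)"
  by (rule diff_quot_commute [OF bounded_linear_mat_app, symmetric]) (simp add: mat_app_translate)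

section \<open>Smooth functions with compact support\<close>

lemma times_differentiable_SucD: "times_differentiable (Suc m) f \<Longrightarrow> times_differentiable m f"
proof (induction m arbitrary: f)
  case (Suc m)
  from Suc.prems Suc.IH show ?case by (metis times_differentiable.simps(2))
qed simp

lemma times_differentiableI:
  assumes "\<And>x. (f has_derivative f' x) (at x)" and "\<And>v. times_differentiable m (\<lambda>x. f' x v)"
  shows "times_differentiable (Suc m) f"
proof -
  have "frechet_derivative f (at x) = f' x" for x
    using frechet_derivative_at [OF assms(1)] by simp
  thus ?thesis using assms by (auto simp: differentiable_def)
qed

lemma times_differentiable_SucE:
  assumes "times_differentiable (Suc m) f"
  obtains f' where "\<And>x. (f has_derivative f' x) (at x)" "\<And>v. times_differentiable m (\<lambda>x. f' x v)"
  using assms frechet_derivative_works by (metis times_differentiable.simps(2))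

lemma times_differentiable_const: "times_differentiable m (\<lambda>x. c)"
proof (induction m arbitrary: c)
  case (Suc m)
  show ?case by (rule times_differentiableI [where f' = "\<lambda>_ _. 0"]) (auto simp: Suc)
qed simp

lemma times_differentiable_add:
  "times_differentiable m f \<Longrightarrow> times_differentiable m g \<Longrightarrow> times_differentiable m (\<lambda>x. f x + g x)"
proof (induction m arbitrary: f g)
  case (Suc m)
  from Suc.prems obtain f' g' where
    f': "\<And>x. (f has_derivative f' x) (at x)" "\<And>v. times_differentiable m (\<lambda>x. f' x v)" and
    g': "\<And>x. (g has_derivative g' x) (at x)" "\<And>v. times_differentiable m (\<lambda>x. g' x v)"
    by (metis times_differentiable_SucE)
  show ?case
    by (rule times_differentiableI [where f' = "\<lambda>x v. f' x v + g' x v"])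
      (auto intro!: derivative_intros f' g' Suc.IH)
qed simp

lemma times_differentiable_mult:
  fixes f g :: "'a::euclidean_space \<Rightarrow> real"
  shows "times_differentiable m f \<Longrightarrow> times_differentiable m g \<Longrightarrow> times_differentiable m (\<lambda>x. f x * g x)"
proof (induction m arbitrary: f g)
  case (Suc m)
  from Suc.prems obtain f' g' where
    f': "\<And>x. (f has_derivative f' x) (at x)" "\<And>v. times_differentiable m (\<lambda>x. f' x v)" and
    g': "\<And>x. (g has_derivative g' x) (at x)" "\<And>v. times_differentiable m (\<lambda>x. g' x v)"
    by (metis times_differentiable_SucE)
  note fg = Suc.prems [THEN times_differentiable_SucD]
  show ?case
    by (rule times_differentiableI [where f' = "\<lambda>x v. f x * g' x v + f' x v * g x"])
      (auto intro!: derivative_intros times_differentiable_add f' g' Suc.IH fg)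
qed simp

lemma times_differentiable_prod:
  fixes f :: "'i \<Rightarrow> 'a::euclidean_space \<Rightarrow> real"
  shows "(\<And>i. i \<in> I \<Longrightarrow> times_differentiable m (f i)) \<Longrightarrow> times_differentiable m (\<lambda>x. \<Prod>i\<in>I. f i x)"
  by (induction I rule: infinite_finite_induct)
    (auto intro: times_differentiable_mult times_differentiable_const)

lemma times_differentiable_compose_affine:
  assumes "bounded_linear L"
  shows "times_differentiable m f \<Longrightarrow> times_differentiable m (\<lambda>x. f (L x + b))"
proof (induction m arbitrary: f)
  case (Suc m)
  from Suc.prems obtain f' where
    f': "\<And>x. (f has_derivative f' x) (at x)" "\<And>v. times_differentiable m (\<lambda>x. f' x v)"
    by (metis times_differentiable_SucE)
  have L: "((\<lambda>x. L x + b) has_derivative L) (at x)" for x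
    using bounded_linear_imp_has_derivative [OF assms] by (auto intro!: derivative_eq_intros)
  show ?case
    by (rule times_differentiableI [where f' = "\<lambda>x v. f' (L x + b) (L v)"])
      (auto intro!: Suc.IH f' has_derivative_compose [OF L f'(1)])
qed simp

text \<open>
  The classical flat function \<open>e\<^bsup>-1/s\<^esup>\<close>, here the case \<open>k = 0\<close>. The powers \<open>s\<^sup>-\<^sup>k\<close> are included because the
  derivative of the \<open>k\<close>-th function is a combination of the next two, so that smoothness of all of them
  follows by one induction.
\<close>

definition flat :: "nat \<Rightarrow> real \<Rightarrow> real" where
  "flat k s = (if 0 < s then (1 / s) ^ k * exp (- 1 / s) else 0)"

text \<open>
  With \<open>y = 1 / s\<close> this is \<open>y\<^bsup>k+2\<^esup> / (k + 2)! \<le> e\<^sup>y\<close>, a single term of the exponential series. It makes the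
  derivative at the origin vanish.
\<close>

lemma flat_bound: "\<bar>flat k s\<bar> \<le> fact (k + 2) * s\<^sup>2"
proof (cases "0 < s")
  case True
  define y where "y = 1 / s"
  have y: "0 < y" "s = 1 / y" using True by (auto simp: y_def)
  have "sum (\<lambda>n. inverse (fact n) * y ^ n) {k + 2} \<le> (\<Sum>n. inverse (fact n) * y ^ n)"
    by (rule sum_le_suminf [OF summable_exp]) (use y in auto)
  hence "y ^ (k + 2) \<le> fact (k + 2) * exp y"
    by (simp add: exp_def field_simps del: fact_Suc power_Suc)
  hence "y ^ (k + 2) * exp (- y) \<le> fact (k + 2)"
    by (simp add: exp_minus field_simps del: fact_Suc power_Suc)
  hence "y ^ (k + 2) * exp (- y) * s\<^sup>2 \<le> fact (k + 2) * s\<^sup>2"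
    by (rule mult_right_mono) simp
  moreover have "y ^ (k + 2) * s\<^sup>2 = y ^ k"
    using y by (simp add: power_add power_divide power2_eq_square)
  ultimately have "y ^ k * exp (- y) \<le> fact (k + 2) * s\<^sup>2"
    by (metis mult.assoc mult.commute)
  thus ?thesis using True by (simp add: flat_def y_def abs_mult)
qed (simp add: flat_def)

lemma flat_has_derivative:
  "(flat k has_real_derivative (flat (k + 2) s - real k * flat (k + 1) s)) (at s)"
proof -
  consider "0 < s" | "s < 0" | "s = 0" by linarith
  thus ?thesis
  proof cases
    case 1
    have "((\<lambda>s. (1 / s) ^ k * exp (- 1 / s)) has_real_derivative
        (flat (k + 2) s - real k * flat (k + 1) s)) (at s)"
    proof -
      have d: "((\<lambda>s. (inverse s) ^ k * exp (- inverse s)) has_real_derivative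
          (real k * inverse s ^ (k - 1) * (- (inverse s)\<^sup>2)) * exp (- inverse s)
          + inverse s ^ k * (exp (- inverse s) * (inverse s)\<^sup>2)) (at s)"
        using 1 by (auto intro!: derivative_eq_intros simp: power2_eq_square)
      have e: "real k * inverse s ^ (k - 1) * (- (inverse s)\<^sup>2) = - (real k * inverse s ^ (k + 1))"
        by (cases k) (simp_all add: power2_eq_square)
      show ?thesis
        using d [unfolded e] 1
        by (simp add: flat_def power_add divide_inverse power2_eq_square algebra_simps)
    qed
    thus ?thesis
      by (rule has_field_derivative_transform_within_open [where S = "{0<..}"]) (use 1 in \<open>auto simp: flat_def\<close>)
  next
    case 2
    have "((\<lambda>s. 0) has_real_derivative 0) (at s)" by simp
    hence "(flat k has_real_derivative 0) (at s)"
      by (rule has_field_derivative_transform_within_open [where S = "{..<0}"]) (use 2 in \<open>auto simp: flat_def\<close>)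
    thus ?thesis using 2 by (simp add: flat_def)
  next
    case 3
    have "((\<lambda>h. (flat k h - flat k 0) / (h - 0)) \<longlongrightarrow> 0) (at 0)"
    proof (rule Lim_null_comparison)
      show "\<forall>\<^sub>F h in at 0. norm ((flat k h - flat k 0) / (h - 0)) \<le> fact (k + 2) * \<bar>h\<bar>"
      proof (rule eventually_at_filter [THEN iffD2], rule always_eventually, intro allI impI)
        fix h :: real assume "h \<noteq> 0"
        thus "norm ((flat k h - flat k 0) / (h - 0)) \<le> fact (k + 2) * \<bar>h\<bar>"
          using flat_bound [of k h] by (simp add: flat_def divide_le_eq power2_eq_square abs_mult [symmetric] mult.assoc)
      qed
      show "((\<lambda>h. fact (k + 2) * \<bar>h\<bar>) \<longlongrightarrow> (0::real)) (at 0)"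
        by (auto intro!: tendsto_eq_intros)
    qed
    thus ?thesis using 3 by (simp add: has_field_derivative_iff flat_def)
  qed
qed

lemma times_differentiable_flat: "times_differentiable m (flat k)"
proof (induction m arbitrary: k)
  case (Suc m)
  show ?case
  proof (rule times_differentiableI)
    show "(flat k has_derivative (\<lambda>v. (flat (k + 2) s - real k * flat (k + 1) s) * v)) (at s)" for s
      using flat_has_derivative by (simp add: has_field_derivative_def)
    have "times_differentiable m (\<lambda>x. (flat (k + 2) x + - real k * flat (k + 1) x) * v)" for v
      by (intro times_differentiable_mult times_differentiable_add times_differentiable_const Suc)
    thus "times_differentiable m (\<lambda>x. (flat (k + 2) x - real k * flat (k + 1) x) * v)" for v
      by simp
  qed
qed simp

definition smooth_compact :: "('a::euclidean_space \<Rightarrow> real) \<Rightarrow> bool" where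
  "smooth_compact \<psi> \<longleftrightarrow> (\<forall>m. times_differentiable m \<psi>) \<and> (\<exists>K. compact K \<and> (\<forall>x. x \<notin> K \<longrightarrow> \<psi> x = 0))"

text \<open>
  The class of \<open>\<psi> \<otimes> e\<close>. Test functions are scalar, so vector-valued ones are obtained as linear
  combinations of these products.
\<close>

definition tensor :: "(real^'d::finite \<Rightarrow> real) \<Rightarrow> complex^'n::finite \<Rightarrow> ('d, 'n) L2" where
  "tensor \<psi> e = abs_L2 (\<lambda>x. \<psi> x *\<^sub>R e)"

definition test_span :: "('d::finite, 'n::finite) L2 set" where
  "test_span = span {tensor \<psi> e | \<psi> e. smooth_compact \<psi>}"

text \<open>
  Uniform bounds on a fixed compact set give \<open>L\<^sup>2\<close> bounds; this reduces the differentiation of curves of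
  test functions in \<open>L\<^sup>2\<close> to uniform convergence.
\<close>

lemma tensor_bound:
  fixes e :: "complex^'n::finite"
  assumes meas [measurable]: "\<psi> \<in> borel_measurable borel" and K: "compact K"
    and supp: "\<And>x. x \<notin> K \<Longrightarrow> \<psi> x = 0" and C: "\<And>x. x \<in> K \<Longrightarrow> \<bar>\<psi> x\<bar> \<le> C" and "0 \<le> C"
  shows in_L2_tensor_bound: "in_L2 (\<lambda>x. \<psi> x *\<^sub>R e)"
    and "norm (tensor \<psi> e) \<le> C * sqrt (measure lborel K) * norm e"
proof -
  define w where "w x = (C * norm e)\<^sup>2 * indicator K x" for x
  have w: "integrable lborel w"
    unfolding w_def using emeasure_compact_finite [OF K] compact_imp_closed [OF K] by auto
  have le: "(norm (\<psi> x *\<^sub>R e))\<^sup>2 \<le> w x" for x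
  proof (cases "x \<in> K")
    case True
    have "(norm (\<psi> x *\<^sub>R e))\<^sup>2 \<le> (C * norm e)\<^sup>2"
      using C [OF True] by (intro power_mono) (auto intro: mult_right_mono)
    thus ?thesis using True by (simp add: w_def)
  qed (simp add: w_def supp)
  show in_L2: "in_L2 (\<lambda>x. \<psi> x *\<^sub>R e)"
    by (rule in_L2_bound [OF _ w le]) measurable
  have "(norm (tensor \<psi> e))\<^sup>2 \<le> (\<integral>x. w x \<partial>lborel)"
    unfolding tensor_def norm_abs_L2_squared [OF in_L2]
    by (rule integral_mono [OF in_L2_integrable [OF in_L2] w le])
  also have "\<dots> = (C * norm e)\<^sup>2 * measure lborel K"
    unfolding w_def by simp
  also have "\<dots> = (C * sqrt (measure lborel K) * norm e)\<^sup>2"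
    by (simp add: power_mult_distrib)
  finally show "norm (tensor \<psi> e) \<le> C * sqrt (measure lborel K) * norm e"
    by (rule power2_le_imp_le) (use \<open>0 \<le> C\<close> in auto)
qed

lemma in_L2_tensor:
  fixes e :: "complex^'n::finite"
  assumes \<psi>: "continuous_on UNIV \<psi>" and K: "compact K" "\<And>x. x \<notin> K \<Longrightarrow> \<psi> x = 0"
  shows "in_L2 (\<lambda>x. \<psi> x *\<^sub>R e)"
proof -
  have "bounded (\<psi> ` K)"
    by (intro compact_imp_bounded compact_continuous_image K continuous_on_subset [OF \<psi>]) auto
  then obtain C where C: "\<forall>x\<in>K. \<bar>\<psi> x\<bar> \<le> C"
    by (auto simp: bounded_iff)
  show ?thesis
    by (rule in_L2_tensor_bound [of \<psi> K "max C 0"])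
      (use \<psi> K C in \<open>auto intro: borel_measurable_continuous_onI simp: le_max_iff_disj\<close>)
qed

lemma times_differentiable_continuous_on:
  "times_differentiable (Suc 0) f \<Longrightarrow> continuous_on S f"
  by (auto intro!: continuous_at_imp_continuous_on differentiable_imp_continuous_within)

lemma smooth_compact_continuous: "smooth_compact \<psi> \<Longrightarrow> continuous_on S \<psi>"
  unfolding smooth_compact_def using times_differentiable_continuous_on by blast

lemma in_L2_smooth_compact:
  assumes "smooth_compact \<psi>" shows "in_L2 (\<lambda>x. \<psi> x *\<^sub>R e)"
proof -
  obtain K where "compact K" "\<And>x. x \<notin> K \<Longrightarrow> \<psi> x = 0"
    using assms unfolding smooth_compact_def by auto
  thus ?thesis by (rule in_L2_tensor [OF smooth_compact_continuous [OF assms]])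
qed

subsection \<open>Density of the test functions\<close>

lemma flat_0_bounds: "0 \<le> flat 0 s" "flat 0 s \<le> 1" "s \<le> 0 \<Longrightarrow> flat 0 s = 0"
  by (auto simp: flat_def)

lemma flat_0_tendsto: "(\<lambda>n. flat 0 (real (Suc n) * s)) \<longlonglongrightarrow> (if 0 < s then 1 else 0)"
proof (cases "0 < s")
  case True
  have "(\<lambda>n. exp (- ((1 / s) * inverse (real (Suc n))))) \<longlonglongrightarrow> exp (- ((1 / s) * 0))"
    by (intro tendsto_intros LIMSEQ_inverse_real_of_nat)
  moreover have "exp (- ((1 / s) * inverse (real (Suc n)))) = flat 0 (real (Suc n) * s)" for n
    using True by (simp add: flat_def divide_inverse mult.commute del: of_nat_Suc)
  ultimately show ?thesis using True by simp
qed (simp add: flat_def mult_le_0_iff zero_less_mult_iff del: of_nat_Suc)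

text \<open>
  As \<open>flat 0\<close> vanishes on the negative axis and \<open>flat 0 (n s)\<close> tends to \<open>1\<close> for positive \<open>s\<close>, these smooth functions
  are supported in the box and converge pointwise to its indicator function.
\<close>

definition box_bump :: "nat \<Rightarrow> real^'d::finite \<Rightarrow> real^'d \<Rightarrow> real^'d \<Rightarrow> real" where
  "box_bump n a b x =
     (\<Prod>j\<in>UNIV. flat 0 (real (Suc n) * (x $ j - a $ j)) * flat 0 (real (Suc n) * (b $ j - x $ j)))"

lemma box_bump_bounds: "0 \<le> box_bump n a b x" "box_bump n a b x \<le> 1"
  unfolding box_bump_def
  by (intro prod_nonneg prod_le_1 ballI conjI mult_le_one mult_nonneg_nonneg flat_0_bounds(1,2))+

lemma box_bump_support: "x \<notin> cbox a b \<Longrightarrow> box_bump n a b x = 0"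
proof -
  assume "x \<notin> cbox a b"
  then obtain j where "\<not> (a $ j \<le> x $ j \<and> x $ j \<le> b $ j)"
    unfolding mem_box_cart by blast
  hence "x $ j - a $ j \<le> 0 \<or> b $ j - x $ j \<le> 0" by auto
  hence "flat 0 (real (Suc n) * (x $ j - a $ j)) * flat 0 (real (Suc n) * (b $ j - x $ j)) = 0"
    by (auto intro!: flat_0_bounds mult_nonneg_nonpos)
  thus ?thesis unfolding box_bump_def by (intro prod_zero) auto
qed

lemma smooth_compact_box_bump: "smooth_compact (box_bump n a b)"
proof -
  have *: "times_differentiable m (\<lambda>x. flat 0 (real (Suc n) * (x $ j - a $ j)) * flat 0 (real (Suc n) * (b $ j - x $ j)))"
    for m and j :: 'a
  proof -
    have "bounded_linear (\<lambda>x::real^'a. r * x $ j)" for r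
      by (intro bounded_linear_mult_right [THEN bounded_linear_compose] bounded_linear_vec_nth)
    from times_differentiable_compose_affine [OF this times_differentiable_flat]
    have "times_differentiable m (\<lambda>x::real^'a. flat 0 (r * x $ j + s))" for r s .
    from this [of "real (Suc n)" "- real (Suc n) * a $ j"] this [of "- real (Suc n)" "real (Suc n) * b $ j"]
    show ?thesis
      by (intro times_differentiable_mult) (simp_all add: algebra_simps del: of_nat_Suc)
  qed
  show ?thesis
    unfolding smooth_compact_def
  proof (intro conjI allI exI)
    show "times_differentiable m (box_bump n a b)" for m
      unfolding box_bump_def [abs_def] by (rule times_differentiable_prod) (rule *)
    show "compact (cbox a b)" by simp
    show "x \<notin> cbox a b \<longrightarrow> box_bump n a b x = 0" for x
      using box_bump_support by blast
  qed
qed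

lemma box_bump_tendsto: "(\<lambda>n. box_bump n a b x) \<longlonglongrightarrow> indicator (box a b) x"
proof -
  have "(\<lambda>n. box_bump n a b x) \<longlonglongrightarrow>
      (\<Prod>j\<in>UNIV. (if 0 < x $ j - a $ j then 1 else 0) * (if 0 < b $ j - x $ j then 1 else 0))"
    unfolding box_bump_def by (intro tendsto_intros flat_0_tendsto)
  also have "(\<Prod>j\<in>UNIV. (if 0 < x $ j - a $ j then 1 else 0) * (if 0 < b $ j - x $ j then 1 else 0)) =
      (indicator (box a b) x :: real)"
  proof (cases "x \<in> box a b")
    case False
    then obtain j where "\<not> (0 < x $ j - a $ j \<and> 0 < b $ j - x $ j)" by (auto simp: mem_box_cart)
    thus ?thesis using False by (subst prod_zero [of _ _]) auto
  qed (simp add: mem_box_cart)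
  finally show ?thesis .
qed

lemma subspace_closure:
  fixes S :: "'a::real_normed_vector set"
  assumes "subspace S" shows "subspace (closure S)"
proof (rule subspaceI)
  show "0 \<in> closure S"
    using subspace_0 [OF assms] closure_subset by blast
  fix u v r assume u: "u \<in> closure S"
  then obtain x where x: "\<And>n. x n \<in> S" "x \<longlonglongrightarrow> u"
    unfolding closure_sequential by metis
  show "r *\<^sub>R u \<in> closure S"
    unfolding closure_sequential
    by (intro exI [of _ "\<lambda>n. r *\<^sub>R x n"]) (auto intro: tendsto_scaleR x subspace_scale [OF assms])
  assume "v \<in> closure S"
  then obtain y where y: "\<And>n. y n \<in> S" "y \<longlonglongrightarrow> v"
    unfolding closure_sequential by metis
  show "u + v \<in> closure S"
    unfolding closure_sequential
    by (intro exI [of _ "\<lambda>n. x n + y n"]) (auto intro: tendsto_add x y subspace_add [OF assms])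
qed

context
begin

private lemma subspace_closure_test_span: "subspace (closure test_span)"
  unfolding test_span_def by (intro subspace_closure subspace_span)

private lemmas closure_test_span_sum = subspace_sum [OF subspace_closure_test_span]
private lemmas closure_test_span_diff = subspace_diff [OF subspace_closure_test_span]

private lemma closure_test_span_limit:
  "(\<And>n. x n \<in> closure test_span) \<Longrightarrow> x \<longlonglongrightarrow> u \<Longrightarrow> u \<in> closure test_span"
  by (rule closed_sequentially [OF closed_closure])

private lemma box_in_closure: "abs_L2 (\<lambda>x. indicator (box a b) x *\<^sub>R e) \<in> closure test_span"
proof (rule closure_test_span_limit)
  show "abs_L2 (\<lambda>x. box_bump n a b x *\<^sub>R e) \<in> closure test_span" for n
    using smooth_compact_box_bump [of n a b]
    by (intro subsetD [OF closure_subset]) (auto simp: test_span_def tensor_def intro!: span_base)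
  show "(\<lambda>n. abs_L2 (\<lambda>x. box_bump n a b x *\<^sub>R e)) \<longlonglongrightarrow> abs_L2 (\<lambda>x. indicator (box a b) x *\<^sub>R e)"
  proof (rule L2_dominated_convergence(2) [where w = "\<lambda>x. (norm e)\<^sup>2 * indicator (cbox a b) x"])
    show "(\<lambda>x. box_bump n a b x *\<^sub>R e) \<in> borel_measurable borel" for n
      using smooth_compact_continuous [OF smooth_compact_box_bump, of UNIV n a b]
      by (intro borel_measurable_continuous_onI continuous_on_scaleR continuous_on_const)
    show "(norm (box_bump n a b x *\<^sub>R e))\<^sup>2 \<le> (norm e)\<^sup>2 * indicator (cbox a b) x" for n x
    proof (cases "x \<in> cbox a b")
      case True
      have "(norm (box_bump n a b x *\<^sub>R e))\<^sup>2 \<le> (1 * norm e)\<^sup>2"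
        unfolding norm_scaleR using box_bump_bounds [of n a b x]
        by (intro power_mono mult_right_mono) auto
      thus ?thesis using True by simp
    qed (simp add: box_bump_support)
    show "(\<lambda>n. box_bump n a b x *\<^sub>R e) \<longlonglongrightarrow> indicator (box a b) x *\<^sub>R e" for x
      by (intro tendsto_intros box_bump_tendsto)
  qed (use emeasure_lborel_cbox_finite [of a b] in auto)
qed

private lemma integrable_indicator_box: "integrable lborel (\<lambda>x. (c::real) * indicator (box a b) x)"
  using emeasure_lborel_box_finite [of a b] by auto

private lemma norm_indicator_box_le:
  "(norm (indicator (A \<inter> box a b) x *\<^sub>R e))\<^sup>2 \<le> (norm e)\<^sup>2 * indicator (box a b) x"
  by (auto simp: indicator_def)

private lemma in_L2_indicator_box:
  assumes [measurable]: "A \<in> sets borel"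
  shows "in_L2 (\<lambda>x. indicator (A \<inter> box a b) x *\<^sub>R e)"
  by (rule in_L2_bound [OF _ integrable_indicator_box norm_indicator_box_le]) measurable

text \<open>
  The boxes are an intersection-stable generator of the Borel sets; intersecting with a fixed box keeps
  all functions square integrable, so complements and countable disjoint unions stay in the closed
  subspace.
\<close>

private lemma borel_in_closure:
  assumes "A \<in> sets borel"
  shows "abs_L2 (\<lambda>x. indicator (A \<inter> box a b) x *\<^sub>R e) \<in> closure test_span"
proof -
  have "Int_stable (range (\<lambda>(a, b). box a b :: (real^'c) set))"
    by (auto simp: Int_stable_def box_Int_box)
  moreover have "range (\<lambda>(a, b). box a b :: (real^'c) set) \<subseteq> Pow UNIV" by auto
  moreover have "A \<in> sigma_sets UNIV (range (\<lambda>(a, b). box a b))"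
    using assms unfolding borel_eq_box by simp
  ultimately show ?thesis
  proof (induction rule: sigma_sets_induct_disjoint)
    case (basic A)
    thus ?case by (auto simp: box_Int_box box_in_closure)
  next
    case empty
    have "abs_L2 (\<lambda>x. indicator (box 0 0) x *\<^sub>R e) \<in> closure test_span" by (rule box_in_closure)
    thus ?case by simp
  next
    case (compl A)
    hence A: "A \<in> sets borel" by (simp add: borel_eq_box)
    have "(\<lambda>x. indicator (UNIV \<inter> box a b) x *\<^sub>R e - indicator (A \<inter> box a b) x *\<^sub>R e)
        = (\<lambda>x. indicator ((UNIV - A) \<inter> box a b) x *\<^sub>R e)"
      by (auto simp: indicator_def)
    with abs_L2_diff [OF in_L2_indicator_box [of UNIV a b e] in_L2_indicator_box [OF A, of a b e]]
    have "abs_L2 (\<lambda>x. indicator (box a b) x *\<^sub>R e) - abs_L2 (\<lambda>x. indicator (A \<inter> box a b) x *\<^sub>R e)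
        = abs_L2 (\<lambda>x. indicator ((UNIV - A) \<inter> box a b) x *\<^sub>R e)"
      by simp
    thus ?case using closure_test_span_diff [OF box_in_closure [of a b e] compl(2)] by simp
  next
    case (union F)
    hence F: "F i \<in> sets borel" for i by (auto simp: borel_eq_box)
    have eq: "(\<Sum>i<n. abs_L2 (\<lambda>x. indicator (F i \<inter> box a b) x *\<^sub>R e))
        = abs_L2 (\<lambda>x. indicator ((\<Union>i<n. F i) \<inter> box a b) x *\<^sub>R e)" for n
    proof (induction n)
      case 0
      show ?case by (simp add: zero_L2.abs_eq)
    next
      case (Suc n)
      have Un: "(\<Union>i<n. F i) \<in> sets borel" using F by auto
      have "F i \<inter> F n = {}" if "i < n" for i
        using disjoint_family_onD [OF union(1), of i n] that by simp
      hence disj: "x \<notin> F n" if "x \<in> (\<Union>i<n. F i)" for x using that by blast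
      have "(\<lambda>x. indicator ((\<Union>i<n. F i) \<inter> box a b) x *\<^sub>R e + indicator (F n \<inter> box a b) x *\<^sub>R e)
          = (\<lambda>x. indicator ((\<Union>i<Suc n. F i) \<inter> box a b) x *\<^sub>R e)"
      proof
        fix x
        show "indicator ((\<Union>i<n. F i) \<inter> box a b) x *\<^sub>R e + indicator (F n \<inter> box a b) x *\<^sub>R e
            = indicator ((\<Union>i<Suc n. F i) \<inter> box a b) x *\<^sub>R e"
          unfolding lessThan_Suc UN_insert using disj [of x]
          by (cases "x \<in> F n"; cases "x \<in> (\<Union>i<n. F i)"; cases "x \<in> box a b")
            (simp_all only: indicator_def Int_iff Un_iff simp_thms if_True if_False scaleR_one
              scaleR_zero_left add_0_left add_0_right of_bool_eq)
      qed
      thus ?case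
        unfolding sum.lessThan_Suc Suc
        using abs_L2_add [OF in_L2_indicator_box [OF Un, of a b e] in_L2_indicator_box [OF F [of n], of a b e]]
        by (simp only:)
    qed
    show ?case
    proof (rule closure_test_span_limit)
      show "(\<Sum>i<n. abs_L2 (\<lambda>x. indicator (F i \<inter> box a b) x *\<^sub>R e)) \<in> closure test_span" for n
        by (rule closure_test_span_sum) (rule union(3))
      show "(\<lambda>n. \<Sum>i<n. abs_L2 (\<lambda>x. indicator (F i \<inter> box a b) x *\<^sub>R e)) \<longlonglongrightarrow>
          abs_L2 (\<lambda>x. indicator ((\<Union>i. F i) \<inter> box a b) x *\<^sub>R e)"
        unfolding eq
      proof (rule L2_dominated_convergence(2) [OF _ _ integrable_indicator_box norm_indicator_box_le])
        show "(\<lambda>n. indicator ((\<Union>i<n. F i) \<inter> box a b) x *\<^sub>R e) \<longlonglongrightarrow> indicator ((\<Union>i. F i) \<inter> box a b) x *\<^sub>R e" for x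
          using LIMSEQ_indicator_UN [of "\<lambda>i. F i \<inter> box a b" x]
          by (intro tendsto_scaleR tendsto_const) (simp add: Int_UN_distrib2)
        note [measurable] = F
        show "(\<lambda>x. indicator ((\<Union>i<n. F i) \<inter> box a b) x *\<^sub>R e) \<in> borel_measurable borel" for n
          by measurable
        show "(\<lambda>x. indicator ((\<Union>i. F i) \<inter> box a b) x *\<^sub>R e) \<in> borel_measurable borel"
          by measurable
      qed
    qed
  qed
qed

text \<open>
  A function in \<open>L\<^sup>2\<close> is the limit of simple functions bounded by twice its norm. Cutting the \<open>i\<close>-th one off
  outside the cube of side \<open>2 i\<close> keeps this convergence and makes it a finite sum of terms covered by
  \<open>borel_in_closure\<close>.
\<close>

lemma closure_test_span: "closure test_span = (UNIV :: ('d::finite, 'n::finite) L2 set)"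
proof -
  have "abs_L2 f \<in> closure test_span" if f: "in_L2 f" for f :: "real^'d \<Rightarrow> complex^'n"
  proof -
    have f_meas: "f \<in> borel_measurable borel" by (rule in_L2_measurable [OF f])
    from borel_measurable_implies_sequence_metric [OF this, of 0]
    obtain s where s: "\<And>i. simple_function borel (s i)"
      "\<And>x. (\<lambda>i. s i x) \<longlonglongrightarrow> f x" "\<And>i x. norm (s i x) \<le> 2 * norm (f x)"
      by auto
    define Q :: "nat \<Rightarrow> (real^'d) set" where "Q i = box (\<chi> j. - real i) (\<chi> j. real i)" for i
    define g where "g i x = indicator (Q i) x *\<^sub>R s i x" for i x
    have s_meas: "s i \<in> borel_measurable borel" for i
      by (rule borel_measurable_simple_function [OF s(1)])
    have in_closure: "abs_L2 (g i) \<in> closure test_span" for i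
    proof -
      let ?A = "\<lambda>v. s i -` {v}"
      have fin: "finite (range (s i))"
        using simple_functionD(1) [OF s(1)] by simp
      have A: "?A v \<in> sets borel" for v
        using simple_functionD(2) [OF s(1), of i "{v}"] by simp
      have "(\<Sum>v\<in>range (s i). abs_L2 (\<lambda>x. indicator (?A v \<inter> Q i) x *\<^sub>R v)) \<in> closure test_span"
        unfolding Q_def by (intro closure_test_span_sum borel_in_closure A)
      also have "(\<Sum>v\<in>V. abs_L2 (\<lambda>x. indicator (?A v \<inter> Q i) x *\<^sub>R v))
          = abs_L2 (\<lambda>x. \<Sum>v\<in>V. indicator (?A v \<inter> Q i) x *\<^sub>R v) \<and>
            in_L2 (\<lambda>x. \<Sum>v\<in>V. indicator (?A v \<inter> Q i) x *\<^sub>R v)" if "finite V" for V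
        using that
      proof (induction V)
        case (insert v V)
        have v: "in_L2 (\<lambda>x. indicator (?A v \<inter> Q i) x *\<^sub>R v)"
          unfolding Q_def by (rule in_L2_indicator_box [OF A])
        note V = insert.IH [THEN conjunct1] insert.IH [THEN conjunct2]
        show ?case
          unfolding sum.insert [OF insert.hyps] V(1) abs_L2_add [OF v V(2)]
          using in_L2_add [OF v V(2)] by blast
      qed (simp add: zero_L2.abs_eq)
      note this [OF fin, THEN conjunct1]
      also have "(\<lambda>x. \<Sum>v\<in>range (s i). indicator (?A v \<inter> Q i) x *\<^sub>R v) = g i"
      proof
        fix x
        have "(\<Sum>v\<in>range (s i). indicator (?A v \<inter> Q i) x *\<^sub>R v)
            = (\<Sum>v\<in>range (s i). if v = s i x then g i x else 0)"
          by (rule sum.cong) (auto simp: g_def indicator_def)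
        also have "\<dots> = g i x" using fin by simp
        finally show "(\<Sum>v\<in>range (s i). indicator (?A v \<inter> Q i) x *\<^sub>R v) = g i x" .
      qed
      finally show ?thesis .
    qed
    have "(\<lambda>i. abs_L2 (g i)) \<longlonglongrightarrow> abs_L2 f"
    proof (rule L2_dominated_convergence(2) [where w = "\<lambda>x. 4 * (norm (f x))\<^sup>2"])
      show "g i \<in> borel_measurable borel" for i
        unfolding g_def [abs_def] Q_def using s_meas by measurable
      show "integrable lborel (\<lambda>x. 4 * (norm (f x))\<^sup>2)"
        using in_L2_integrable [OF f] by simp
      show "(norm (g i x))\<^sup>2 \<le> 4 * (norm (f x))\<^sup>2" for i x
        using power_mono [OF s(3) [of i x], of 2] by (auto simp: g_def indicator_def power_mult_distrib)
      show "(\<lambda>i. g i x) \<longlonglongrightarrow> f x" for x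
      proof (rule Lim_transform_eventually [OF s(2)])
        obtain N where N: "norm x < real N" using reals_Archimedean2 by blast
        show "\<forall>\<^sub>F i in sequentially. s i x = g i x"
          using eventually_ge_at_top [of N]
        proof eventually_elim
          case (elim i)
          have "\<bar>x $ j\<bar> < real i" for j
            using component_le_norm_cart [of x j] N elim by linarith
          hence "x \<in> Q i" by (auto simp: Q_def mem_box_cart abs_less_iff) (smt (verit))
          thus ?case by (simp add: g_def)
        qed
      qed
    qed (rule f_meas)
    with in_closure show ?thesis by (rule closure_test_span_limit)
  qed
  hence "u \<in> closure test_span" for u :: "('d, 'n) L2"
    by (rule L2_induct_rep)
  thus ?thesis by blast
qed

end

subsection \<open>Curves of test functions and difference quotients\<close>

lemma tensor_diff:
  assumes "in_L2 (\<lambda>x. \<phi> x *\<^sub>R e)" "in_L2 (\<lambda>x. \<psi> x *\<^sub>R e)"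
  shows "tensor \<phi> e - tensor \<psi> e = tensor (\<lambda>x. \<phi> x - \<psi> x) e"
  using assms by (simp add: tensor_def abs_L2_diff scaleR_diff_left)

lemma tensor_scaleR:
  assumes "in_L2 (\<lambda>x. \<phi> x *\<^sub>R e)"
  shows "r *\<^sub>R tensor \<phi> e = tensor (\<lambda>x. r * \<phi> x) e"
  using assms by (simp add: tensor_def abs_L2_scaleR)

lemma translate_tensor:
  assumes "in_L2 (\<lambda>x. \<phi> x *\<^sub>R e)"
  shows "translate y (tensor \<phi> e) = tensor (\<lambda>x. \<phi> (x + y)) e"
  using assms by (simp add: tensor_def abs_L2_translate)

lemma mat_app_tensor:
  assumes "in_L2 (\<lambda>x. \<phi> x *\<^sub>R e)"
  shows "mat_app M (tensor \<phi> e) = tensor \<phi> (complex_matrix M *v e)"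
  using assms
  by (simp add: tensor_def abs_L2_mat_app
      linear_cmul [OF bounded_linear.linear [OF matrix_vector_mul_bounded_linear]])

lemma uniformly_close_on_compact:
  fixes f :: "real \<Rightarrow> 'a::metric_space \<Rightarrow> real"
  assumes cont: "continuous_on UNIV (\<lambda>(t, x). f t x)" and K: "compact K" and "0 < \<epsilon>"
  obtains \<delta> where "0 < \<delta>" "\<delta> \<le> 1" "\<And>t x. \<bar>t - t0\<bar> < \<delta> \<Longrightarrow> x \<in> K \<Longrightarrow> \<bar>f t x - f t0 x\<bar> < \<epsilon>"
proof -
  have "compact ({t0 - 1..t0 + 1} \<times> K)"
    by (intro compact_Times K) simp
  from compact_uniformly_continuous [OF continuous_on_subset [OF cont] this]
  have "uniformly_continuous_on ({t0 - 1..t0 + 1} \<times> K) (\<lambda>(t, x). f t x)" by simp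
  then obtain \<delta> where \<delta>: "0 < \<delta>" and
    *: "\<And>p p'. p \<in> {t0 - 1..t0 + 1} \<times> K \<Longrightarrow> p' \<in> {t0 - 1..t0 + 1} \<times> K \<Longrightarrow> dist p' p < \<delta> \<Longrightarrow>
      dist (case p' of (t, x) \<Rightarrow> f t x) (case p of (t, x) \<Rightarrow> f t x) < \<epsilon>"
    using \<open>0 < \<epsilon>\<close> unfolding uniformly_continuous_on_def by metis
  show ?thesis
  proof (rule that [of "min \<delta> 1"])
    fix t x assume t: "\<bar>t - t0\<bar> < min \<delta> 1" and x: "x \<in> K"
    show "\<bar>f t x - f t0 x\<bar> < \<epsilon>"
      using * [of "(t0, x)" "(t, x)"] t x by (auto simp: dist_Pair_Pair dist_real_def abs_less_iff)
  qed (use \<delta> in auto)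
qed

context
  fixes \<phi> :: "real \<Rightarrow> real^'d::finite \<Rightarrow> real" and t0 :: real and K :: "(real^'d) set"
    and e :: "complex^'n::finite"
  assumes cont: "continuous_on UNIV (\<lambda>(t, x). \<phi> t x)" and K: "compact K"
    and supp: "\<And>t x. \<bar>t - t0\<bar> < 1 \<Longrightarrow> x \<notin> K \<Longrightarrow> \<phi> t x = 0"
begin

private lemma continuous_slice: "continuous_on S (\<phi> t)"
proof -
  have "continuous_on UNIV ((\<lambda>(t, x). \<phi> t x) \<circ> Pair t)"
    by (intro continuous_on_compose continuous_on_subset [OF cont] continuous_intros) auto
  thus ?thesis by (auto simp: o_def intro: continuous_on_subset)
qed

private lemma in_L2_slice: "\<bar>t - t0\<bar> < 1 \<Longrightarrow> in_L2 (\<lambda>x. \<phi> t x *\<^sub>R e)"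
  by (rule in_L2_tensor [OF continuous_slice K supp])

text \<open>
  By the mean value theorem the difference quotient in \<open>t\<close> is the value of \<open>\<phi>'\<close> at an intermediate time,
  so it converges uniformly on the common support \<open>K\<close>. Used both for test functions of space-time and for
  translates of a fixed test function.
\<close>

lemma tensor_curve_derivative:
  assumes deriv: "\<And>t x. ((\<lambda>s. \<phi> s x) has_real_derivative \<phi>' t x) (at t)"
    and cont': "continuous_on UNIV (\<lambda>(t, x). \<phi>' t x)"
  shows "((\<lambda>t. tensor (\<phi> t) e) has_vector_derivative tensor (\<phi>' t0) e) (at t0)"
  unfolding has_vector_derivative_iff_quotient
proof (rule LIM_I)
  fix r :: real assume r: "0 < r"
  have supp': "\<phi>' t0 x = 0" if "x \<notin> K" for x
  proof -
    have "((\<lambda>s. 0) has_real_derivative \<phi>' t0 x) (at t0)"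
      by (rule has_field_derivative_transform_within_open [OF deriv, of "ball t0 1"])
        (use supp that in \<open>auto simp: dist_real_def abs_minus_commute\<close>)
    thus ?thesis using DERIV_unique DERIV_const by blast
  qed
  have slice': "continuous_on UNIV (\<phi>' t0)"
  proof -
    have "continuous_on UNIV ((\<lambda>(t, x). \<phi>' t x) \<circ> Pair t0)"
      by (intro continuous_on_compose continuous_on_subset [OF cont'] continuous_intros) auto
    thus ?thesis by (simp add: o_def)
  qed
  have in_L2': "in_L2 (\<lambda>x. \<phi>' t0 x *\<^sub>R e)"
    by (rule in_L2_tensor [OF slice' K supp'])
  \<comment> \<open>The summand \<open>1\<close> allows division by \<open>C\<close> even for a null set \<open>K\<close>.\<close>
  define C where "C = sqrt (measure lborel K) * norm e + 1"
  have C: "0 < C" by (simp add: C_def add_nonneg_pos)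
  from uniformly_close_on_compact [OF cont' K, of "r / C" t0] r C
  obtain \<delta> where \<delta>: "0 < \<delta>" "\<delta> \<le> 1" "\<And>t x. \<bar>t - t0\<bar> < \<delta> \<Longrightarrow> x \<in> K \<Longrightarrow> \<bar>\<phi>' t x - \<phi>' t0 x\<bar> < r / C"
    by (metis divide_pos_pos)
  have "norm ((tensor (\<phi> t) e - tensor (\<phi> t0) e) /\<^sub>R (t - t0) - tensor (\<phi>' t0) e) < r"
    if t: "t \<noteq> t0" "norm (t - t0) < \<delta>" for t
  proof -
    define q where "q x = (\<phi> t x - \<phi> t0 x) / (t - t0)" for x
    have q: "\<bar>q x - \<phi>' t0 x\<bar> \<le> r / C" if x: "x \<in> K" for x
    proof -
      have "\<exists>\<xi>. \<bar>\<xi> - t0\<bar> < \<delta> \<and> q x = \<phi>' \<xi> x"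
      proof (cases "t0 < t")
        case True
        from MVT2 [OF this deriv] obtain \<xi> where "t0 < \<xi>" "\<xi> < t" "\<phi> t x - \<phi> t0 x = (t - t0) * \<phi>' \<xi> x"
          by blast
        thus ?thesis using t True by (intro exI [of _ \<xi>]) (auto simp: q_def)
      next
        case False
        with t have "t < t0" by simp
        from MVT2 [OF this deriv] obtain \<xi> where "t < \<xi>" "\<xi> < t0" "\<phi> t0 x - \<phi> t x = (t0 - t) * \<phi>' \<xi> x"
          by blast
        moreover from this(3) have "\<phi> t x - \<phi> t0 x = (t - t0) * \<phi>' \<xi> x" by (simp add: algebra_simps)
        ultimately show ?thesis using t by (intro exI [of _ \<xi>]) (auto simp: q_def)
      qed
      thus ?thesis using \<delta>(3) x by (auto intro: less_imp_le)
    qed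
    have qc: "continuous_on UNIV q"
      unfolding q_def by (intro continuous_intros continuous_slice) (use t in auto)
    have q0: "q x = 0" if "x \<notin> K" for x
      using supp [OF _ that] t \<delta> by (simp add: q_def)
    have "norm (tensor (\<lambda>x. q x - \<phi>' t0 x) e) \<le> r / C * sqrt (measure lborel K) * norm e"
    proof (rule tensor_bound)
      show "(\<lambda>x. q x - \<phi>' t0 x) \<in> borel_measurable borel"
        by (intro borel_measurable_continuous_onI continuous_on_diff qc slice')
    qed (use K q0 q supp' r C in auto)
    also have "\<dots> = r / C * (C - 1)" by (simp add: C_def)
    also have "\<dots> < r" using r C by (simp add: field_simps)
    also have "tensor (\<lambda>x. q x - \<phi>' t0 x) e = (tensor (\<phi> t) e - tensor (\<phi> t0) e) /\<^sub>R (t - t0) - tensor (\<phi>' t0) e"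
    proof -
      have 1: "in_L2 (\<lambda>x. \<phi> t x *\<^sub>R e)" "in_L2 (\<lambda>x. \<phi> t0 x *\<^sub>R e)"
        using t \<delta> by (auto intro!: in_L2_slice)
      have 2: "in_L2 (\<lambda>x. (\<phi> t x - \<phi> t0 x) *\<^sub>R e)"
        using in_L2_diff [OF 1] by (simp add: scaleR_diff_left)
      have 3: "in_L2 (\<lambda>x. q x *\<^sub>R e)"
        by (rule in_L2_tensor [OF qc K q0])
      have "tensor q e = (tensor (\<phi> t) e - tensor (\<phi> t0) e) /\<^sub>R (t - t0)"
        by (simp add: tensor_diff [OF 1] tensor_scaleR [OF 2] q_def [abs_def] divide_inverse mult.commute)
      thus ?thesis using tensor_diff [OF 3 in_L2'] by simp
    qed
    finally show ?thesis .
  qed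
  thus "\<exists>s>0. \<forall>x. x \<noteq> t0 \<and> norm (x - t0) < s \<longrightarrow>
      norm ((tensor (\<phi> x) e - tensor (\<phi> t0) e) /\<^sub>R (x - t0) - tensor (\<phi>' t0) e) < r"
    using \<delta>(1) by blast
qed

end

lemma smooth_compact_partial:
  assumes "smooth_compact \<psi>"
  shows "smooth_compact (\<lambda>x. frechet_derivative \<psi> (at x) v)"
  unfolding smooth_compact_def
proof (intro conjI allI)
  show "times_differentiable m (\<lambda>x. frechet_derivative \<psi> (at x) v)" for m
    using assms unfolding smooth_compact_def by (metis times_differentiable.simps(2))
  obtain K where K: "compact K" "\<And>x. x \<notin> K \<Longrightarrow> \<psi> x = 0"
    using assms unfolding smooth_compact_def by blast
  have "frechet_derivative \<psi> (at x) v = 0" if "x \<notin> K" for x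
  proof -
    have "((\<lambda>x. 0) has_derivative (\<lambda>_. 0)) (at x)" by simp
    hence "(\<psi> has_derivative (\<lambda>_. 0)) (at x)"
      by (rule has_derivative_transform_within_open [OF _ open_Compl [OF compact_imp_closed [OF K(1)]]])
        (use K that in auto)
    thus ?thesis using frechet_derivative_at by metis
  qed
  with K(1) show "\<exists>K. compact K \<and> (\<forall>x. x \<notin> K \<longrightarrow> frechet_derivative \<psi> (at x) v = 0)" by blast
qed

lemma smooth_compact_has_derivative:
  "smooth_compact \<psi> \<Longrightarrow> (\<psi> has_derivative frechet_derivative \<psi> (at x)) (at x)"
  unfolding smooth_compact_def
  using frechet_derivative_works times_differentiable.simps(2) by blast

lemma smooth_compact_translate:
  assumes "smooth_compact \<psi>" shows "smooth_compact (\<lambda>x. \<psi> (x + y))"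
  unfolding smooth_compact_def
proof (intro conjI allI)
  show "times_differentiable m (\<lambda>x. \<psi> (x + y))" for m
    using times_differentiable_compose_affine [OF bounded_linear_ident] assms
    unfolding smooth_compact_def by blast
  obtain K where K: "compact K" "\<And>x. x \<notin> K \<Longrightarrow> \<psi> x = 0"
    using assms unfolding smooth_compact_def by blast
  have "compact ((\<lambda>x. x - y) ` K)"
    by (intro compact_continuous_image K continuous_intros)
  moreover have "\<psi> (x + y) = 0" if "x \<notin> (\<lambda>x. x - y) ` K" for x
    using that by (intro K) (auto simp: image_iff)
  ultimately show "\<exists>K. compact K \<and> (\<forall>x. x \<notin> K \<longrightarrow> \<psi> (x + y) = 0)" by blast
qed

text \<open>
  The centred difference quotient is the average of the quotients with steps \<open>h\<close> and \<open>- h\<close> of the curve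
  of translates, whose derivative at \<open>0\<close> is the partial derivative.
\<close>

lemma diff_quot_tensor_tendsto:
  assumes \<psi>: "smooth_compact \<psi>"
  shows "(\<lambda>n. diff_quot j n (tensor \<psi> e)) \<longlonglongrightarrow> tensor (\<lambda>x. frechet_derivative \<psi> (at x) (axis j 1)) e"
proof -
  let ?\<psi>' = "\<lambda>x. frechet_derivative \<psi> (at x) (axis j 1)"
  define \<phi> where "\<phi> t x = \<psi> (x + t *\<^sub>R axis j 1)" for t x
  define u where "u t = tensor (\<phi> t) e" for t
  obtain K where K: "compact K" "\<And>x. x \<notin> K \<Longrightarrow> \<psi> x = 0"
    using \<psi> unfolding smooth_compact_def by blast
  obtain R where R: "\<And>x. x \<in> K \<Longrightarrow> norm x \<le> R"
    using compact_imp_bounded [OF K(1)] by (auto simp: bounded_iff)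
  have "(u has_vector_derivative tensor (\<lambda>x. ?\<psi>' (x + 0 *\<^sub>R axis j 1)) e) (at 0)"
    unfolding u_def
  proof (rule tensor_curve_derivative)
    have "continuous_on UNIV ((\<lambda>x. \<psi> x) \<circ> (\<lambda>(t, x). x + t *\<^sub>R axis j 1))"
      by (intro continuous_on_compose smooth_compact_continuous \<psi>)
        (auto simp: case_prod_unfold intro!: continuous_intros)
    thus "continuous_on UNIV (\<lambda>(t, x). \<phi> t x)" by (simp add: \<phi>_def o_def case_prod_unfold)
    have "continuous_on UNIV (?\<psi>' \<circ> (\<lambda>(t, x). x + t *\<^sub>R axis j 1))"
      by (intro continuous_on_compose smooth_compact_continuous smooth_compact_partial \<psi>)
        (auto simp: case_prod_unfold intro!: continuous_intros)
    thus "continuous_on UNIV (\<lambda>(t, x). ?\<psi>' (x + t *\<^sub>R axis j 1))" by (simp add: o_def case_prod_unfold)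
    \<comment> \<open>For \<open>\<bar>t\<bar> < 1\<close> the translates are supported in a ball that is larger by \<open>1\<close>.\<close>
    show "compact (cball (0::real^'a) (R + 1))" by simp
    show "\<phi> t x = 0" if "\<bar>t - 0\<bar> < 1" "x \<notin> cball 0 (R + 1)" for t x
    proof -
      have "norm x \<le> norm (x + t *\<^sub>R axis j 1) + norm (t *\<^sub>R (axis j 1 :: real^'a))"
        using norm_triangle_ineq4 [of "x + t *\<^sub>R axis j 1" "t *\<^sub>R axis j 1"] by simp
      hence "R < norm (x + t *\<^sub>R axis j 1)" using that by (simp add: norm_axis_1)
      hence "x + t *\<^sub>R axis j 1 \<notin> K" using R by force
      thus ?thesis unfolding \<phi>_def by (rule K(2))
    qed
    show "((\<lambda>s. \<phi> s x) has_real_derivative ?\<psi>' (x + t *\<^sub>R axis j 1)) (at t)" for t x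
    proof -
      have "((\<lambda>s. x + s *\<^sub>R axis j 1) has_derivative (\<lambda>h. h *\<^sub>R axis j 1)) (at t)"
        by (auto intro!: derivative_eq_intros)
      from has_derivative_compose [OF this smooth_compact_has_derivative [OF \<psi>]]
      show ?thesis
        using linear_cmul [OF has_derivative_linear [OF smooth_compact_has_derivative [OF \<psi>]]]
        by (simp add: \<phi>_def has_field_derivative_def mult_commute_abs)
    qed
  qed
  hence u: "((\<lambda>s. (u s - u 0) /\<^sub>R s) \<longlongrightarrow> tensor ?\<psi>' e) (at 0)"
    unfolding has_vector_derivative_iff_quotient by simp
  define h where "h n = inverse (real (Suc n))" for n
  have h: "h \<longlonglongrightarrow> 0" "h n \<noteq> 0" for n
    unfolding h_def by (rule LIMSEQ_inverse_real_of_nat) simp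
  have mh: "(\<lambda>n. - h n) \<longlonglongrightarrow> 0" using tendsto_minus [OF h(1)] by simp
  have "(\<lambda>n. (u (h n) - u 0) /\<^sub>R h n) \<longlonglongrightarrow> tensor ?\<psi>' e"
    using filterlim_compose [OF u, of h] h by (simp add: filterlim_at)
  moreover have "(\<lambda>n. (u (- h n) - u 0) /\<^sub>R (- h n)) \<longlonglongrightarrow> tensor ?\<psi>' e"
    using filterlim_compose [OF u, of "\<lambda>n. - h n"] mh h(2) by (simp add: filterlim_at)
  ultimately have "(\<lambda>n. (1 / 2) *\<^sub>R ((u (h n) - u 0) /\<^sub>R h n + (u (- h n) - u 0) /\<^sub>R (- h n)))
      \<longlonglongrightarrow> (1 / 2) *\<^sub>R (tensor ?\<psi>' e + tensor ?\<psi>' e)"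
    by (intro tendsto_intros)
  moreover have "(1 / 2) *\<^sub>R ((u (h n) - u 0) /\<^sub>R h n + (u (- h n) - u 0) /\<^sub>R (- h n)) = diff_quot j n (tensor \<psi> e)" for n
  proof -
    have u_eq: "u t = translate (t *\<^sub>R axis j 1) (tensor \<psi> e)" for t
      unfolding u_def \<phi>_def by (rule translate_tensor [OF in_L2_smooth_compact [OF \<psi>], symmetric])
    have ax: "axis j (1 / real (Suc n)) = h n *\<^sub>R (axis j 1 :: real^'a)"
      by (simp add: h_def vec_eq_iff axis_def inverse_eq_divide)
    show ?thesis
      unfolding diff_quot_def ax u_eq
      by (simp add: h_def algebra_simps del: of_nat_Suc flip: scaleR_add_left)
  qed
  moreover have "(1 / 2) *\<^sub>R (tensor ?\<psi>' e + tensor ?\<psi>' e) = tensor ?\<psi>' e"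
    by (simp flip: scaleR_2)
  ultimately show ?thesis by simp
qed

lemma subspace_test_span: "subspace test_span"
  unfolding test_span_def by (rule subspace_span)

lemma tensor_in_test_span: "smooth_compact \<psi> \<Longrightarrow> tensor \<psi> e \<in> test_span"
  unfolding test_span_def by (rule span_base) blast

lemma test_span_induct:
  assumes "F \<in> test_span" and "subspace S" and "\<And>\<psi> e. smooth_compact \<psi> \<Longrightarrow> tensor \<psi> e \<in> S"
  shows "F \<in> S"
  using assms span_minimal [of "{tensor \<psi> e | \<psi> e. smooth_compact \<psi>}" S]
  unfolding test_span_def by blast

lemma test_span_invariant:
  assumes T: "linear T" and tensor: "\<And>\<psi> e. smooth_compact \<psi> \<Longrightarrow> T (tensor \<psi> e) \<in> test_span"
    and F: "F \<in> test_span"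
  shows "T F \<in> test_span"
proof -
  have "F \<in> {F. T F \<in> test_span}"
    by (rule test_span_induct [OF F])
      (auto intro: tensor linear_subspace_vimage [OF T subspace_test_span, unfolded vimage_def])
  thus ?thesis by simp
qed

lemma mat_app_test_span: "F \<in> test_span \<Longrightarrow> mat_app M F \<in> test_span"
  by (rule test_span_invariant [OF bounded_linear.linear [OF bounded_linear_mat_app]])
    (auto simp: mat_app_tensor in_L2_smooth_compact tensor_in_test_span)

lemma translate_test_span: "F \<in> test_span \<Longrightarrow> translate y F \<in> test_span"
  by (rule test_span_invariant [OF bounded_linear.linear [OF bounded_linear_translate]])
    (auto simp: translate_tensor in_L2_smooth_compact intro!: tensor_in_test_span smooth_compact_translate)

lemma diff_quot_test_span: "F \<in> test_span \<Longrightarrow> diff_quot j n F \<in> test_span"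
  unfolding diff_quot_def
  by (intro subspace_scale subspace_diff subspace_test_span translate_test_span)

lemma convergent_diff_quot:
  assumes "F \<in> test_span" shows "convergent (\<lambda>n. diff_quot j n F)"
proof -
  note lin = bounded_linear.linear [OF bounded_linear_diff_quot]
  have "subspace {F. convergent (\<lambda>n. diff_quot j n F)}"
    by (rule subspaceI)
      (auto simp: linear_0 [OF lin] linear_add [OF lin] linear_cmul [OF lin]
        intro: convergent_const convergent_add bounded_linear.convergent [OF bounded_linear_scaleR_right])
  moreover have "tensor \<psi> e \<in> {F. convergent (\<lambda>n. diff_quot j n F)}" if "smooth_compact \<psi>" for \<psi> e
    using diff_quot_tensor_tendsto [OF that] by (auto intro: convergentI)
  ultimately have "F \<in> {F. convergent (\<lambda>n. diff_quot j n F)}"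
    by (rule test_span_induct [OF assms])
  thus ?thesis by simp
qed

section \<open>Distributional solutions and weak solutions\<close>

text \<open>
  \<open>N\<close> is the primitive of a bump function \<open>\<eta>\<close> supported in \<open>[0, \<epsilon>]\<close>. The difference of two shifted copies of \<open>N\<close>
  is a test function in time whose derivative approximates a difference of two point evaluations.
\<close>

lemma smooth_step_exists:
  fixes \<epsilon> :: real
  assumes "0 < \<epsilon>"
  obtains c :: real and N \<eta> :: "real \<Rightarrow> real" where "0 < c" "\<And>x. (N has_real_derivative \<eta> x) (at x)"
    "\<And>m. times_differentiable m N" "\<And>x. 0 \<le> \<eta> x" "continuous_on UNIV \<eta>"
    "\<And>x. x \<le> 0 \<Longrightarrow> \<eta> x = 0" "\<And>x. \<epsilon> \<le> x \<Longrightarrow> \<eta> x = 0"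
    "\<And>x. x \<le> 0 \<Longrightarrow> N x = 0" "\<And>x. \<epsilon> \<le> x \<Longrightarrow> N x = c"
proof -
  define \<eta> where "\<eta> x = flat 0 x * flat 0 (\<epsilon> - x)" for x
  have "times_differentiable m (\<lambda>x. flat 0 (- 1 * x + \<epsilon>))" for m
    by (rule times_differentiable_compose_affine [OF bounded_linear_mult_right times_differentiable_flat])
  hence smooth: "times_differentiable m \<eta>" for m
    unfolding \<eta>_def [abs_def] by (intro times_differentiable_mult times_differentiable_flat) simp
  have cont: "continuous_on S \<eta>" for S
    by (rule times_differentiable_continuous_on [OF smooth])
  have zero: "\<eta> x = 0" if "x \<le> 0 \<or> \<epsilon> \<le> x" for x
    using that by (auto simp: \<eta>_def flat_def)
  have nonneg: "0 \<le> \<eta> x" for x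
    by (simp add: \<eta>_def flat_0_bounds)
  define N where "N x = (LBINT y=ereal 0..ereal x. \<eta> y)" for x
  have N: "(N has_real_derivative \<eta> x) (at x)" for x
  proof -
    define L where "L = \<bar>x\<bar> + 1"
    have "(N has_vector_derivative \<eta> x) (at x within {- L..L})"
      unfolding N_def by (rule interval_integral_FTC2) (auto simp: L_def intro: cont)
    moreover have "at x within {- L..L} = at x"
      by (rule at_within_interior) (auto simp: L_def)
    ultimately show ?thesis
      by (simp only: has_real_derivative_iff_has_vector_derivative)
  qed
  have N0: "N 0 = 0" by (simp add: N_def)
  have low: "N x = 0" if "x \<le> 0" for x
  proof (cases "x = 0")
    case False
    with that have "x < 0" by simp
    from MVT2 [OF this N] obtain z where "z < 0" "N 0 - N x = (0 - x) * \<eta> z" by blast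
    thus ?thesis using zero [of z] N0 by simp
  qed (simp add: N0)
  define c where "c = N \<epsilon>"
  have high: "N x = c" if "\<epsilon> \<le> x" for x
  proof (cases "x = \<epsilon>")
    case False
    with that have "\<epsilon> < x" by simp
    from MVT2 [OF this N] obtain z where "\<epsilon> < z" "N x - N \<epsilon> = (x - \<epsilon>) * \<eta> z" by blast
    thus ?thesis using zero [of z] by (simp add: c_def)
  qed (simp add: c_def)
  have c: "0 < c"
  proof -
    from MVT2 [OF \<open>0 < \<epsilon>\<close> N] obtain z where "0 < z" "z < \<epsilon>" "N \<epsilon> - N 0 = (\<epsilon> - 0) * \<eta> z" by blast
    thus ?thesis using \<open>0 < \<epsilon>\<close> by (simp add: c_def N0 \<eta>_def flat_def)
  qed
  have "times_differentiable m N" for m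
  proof (cases m)
    case (Suc i)
    have "times_differentiable (Suc i) N"
    proof (rule times_differentiableI)
      show "(N has_derivative (\<lambda>v. \<eta> x * v)) (at x)" for x
        using N by (simp add: has_field_derivative_def)
      show "times_differentiable i (\<lambda>x. \<eta> x * v)" for v
        by (intro times_differentiable_mult smooth times_differentiable_const)
    qed
    thus ?thesis using Suc by simp
  qed simp
  from that [OF c N this nonneg cont _ _ low high] zero show ?thesis by simp
qed

text \<open>
  If \<open>R\<close> is a primitive of \<open>r\<close> and \<open>q = p - R\<close>, integration by parts turns the hypothesis into
  \<open>\<integral> \<theta>' q = 0\<close>. For \<open>\<theta>(x) = N(x - s) - N(x - t)\<close> it says that the averages of \<open>q\<close> just after \<open>s\<close> and just
  after \<open>t\<close> agree. As the window shrinks, \<open>q s = q t\<close>, so \<open>q\<close> is constant.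
\<close>

lemma du_Bois_Reymond:
  fixes p r :: "real \<Rightarrow> real"
  assumes p: "continuous_on {0..} p" and r: "continuous_on {0..} r"
    and test: "\<And>\<theta> \<theta>' a b. (\<And>m. times_differentiable m \<theta>) \<Longrightarrow> (\<And>x. (\<theta> has_real_derivative \<theta>' x) (at x)) \<Longrightarrow>
      continuous_on UNIV \<theta>' \<Longrightarrow>
      0 < a \<Longrightarrow> a < b \<Longrightarrow> (\<And>x. x \<notin> {a..b} \<Longrightarrow> \<theta> x = 0 \<and> \<theta>' x = 0) \<Longrightarrow>
      integral {0..b} (\<lambda>t. \<theta>' t * p t + \<theta> t * r t) = 0"
    and t: "0 \<le> t"
  shows "(p has_real_derivative r t) (at t within {0..})"
proof -
  define R where "R t = integral {0..t} r" for t
  have R: "(R has_real_derivative r t) (at t within {0..T})" if "0 \<le> t" "t \<le> T" for t T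
    unfolding R_def using that
    by (intro integral_has_real_derivative continuous_on_subset [OF r]) auto
  have R_at: "(R has_real_derivative r t) (at t within {0..})" if "0 \<le> t" for t
  proof -
    have "at t within {0..} = at t within {0..t + 1}"
      by (rule at_within_nhd [of _ "{..<t + 1}"]) auto
    thus ?thesis using R [of t "t + 1"] that by simp
  qed
  define q where "q t = p t - R t" for t
  have R_cont: "continuous_on {0..} R"
    using R_at by (auto simp: continuous_on_eq_continuous_within intro: DERIV_continuous)
  have q: "continuous_on {0..} q"
    unfolding q_def by (intro continuous_on_diff p R_cont)
  have const: "q s = q t" if st: "0 < s" "s < t" for s t
  proof -
    have "\<bar>q s - q t\<bar> \<le> 2 * \<delta>" if \<delta>: "0 < \<delta>" for \<delta>
    proof -
      have near: "\<exists>\<epsilon>>0. \<forall>\<sigma>\<in>{v..v + \<epsilon>}. \<bar>q \<sigma> - q v\<bar> \<le> \<delta>" if "0 < v" for v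
      proof -
        have "\<exists>d>0. \<forall>\<sigma>\<in>{0..}. dist \<sigma> v < d \<longrightarrow> dist (q \<sigma>) (q v) < \<delta>"
          using q \<delta> that unfolding continuous_on_iff by simp
        then obtain d where d: "0 < d" "\<forall>\<sigma>\<in>{0..}. dist \<sigma> v < d \<longrightarrow> dist (q \<sigma>) (q v) < \<delta>" by blast
        have "\<bar>q \<sigma> - q v\<bar> \<le> \<delta>" if "\<sigma> \<in> {v..v + d / 2}" for \<sigma>
          using d(2) [rule_format, of \<sigma>] that \<open>0 < v\<close> d(1) by (simp add: dist_real_def)
        thus ?thesis using d(1) by (intro exI [of _ "d / 2"]) simp
      qed
      obtain \<epsilon>1 where \<epsilon>1: "0 < \<epsilon>1" "\<forall>\<sigma>\<in>{s..s + \<epsilon>1}. \<bar>q \<sigma> - q s\<bar> \<le> \<delta>"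
        using near [OF st(1)] by blast
      obtain \<epsilon>2 where \<epsilon>2: "0 < \<epsilon>2" "\<forall>\<sigma>\<in>{t..t + \<epsilon>2}. \<bar>q \<sigma> - q t\<bar> \<le> \<delta>"
        using near [OF order.strict_trans [OF st]] by blast
      note \<epsilon>12 = \<epsilon>1 \<epsilon>2
      define \<epsilon> where "\<epsilon> = min \<epsilon>1 \<epsilon>2"
      have \<epsilon>: "0 < \<epsilon>" using \<epsilon>12 by (simp add: \<epsilon>_def)
      obtain c N \<eta> where N: "0 < c" "\<And>x. (N has_real_derivative \<eta> x) (at x)"
        "\<And>m. times_differentiable m N" "\<And>x. 0 \<le> \<eta> x" "continuous_on UNIV \<eta>"
        "\<And>x. x \<le> 0 \<Longrightarrow> \<eta> x = 0" "\<And>x. \<epsilon> \<le> x \<Longrightarrow> \<eta> x = 0"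
        "\<And>x. x \<le> 0 \<Longrightarrow> N x = 0" "\<And>x. \<epsilon> \<le> x \<Longrightarrow> N x = c"
        by (rule smooth_step_exists [OF \<epsilon>]) (rule that; assumption)
      define T where "T = t + \<epsilon>"
      have T: "0 \<le> T" "s < T" "t < T" using st \<epsilon> by (auto simp: T_def)
      have \<eta>_cont: "continuous_on S (\<lambda>\<sigma>. \<eta> (\<sigma> - v))" for S v
        by (rule continuous_on_compose2 [OF N(5)]) (auto intro!: continuous_intros)
      have N_shift: "((\<lambda>\<sigma>. N (\<sigma> - v)) has_real_derivative \<eta> (x - v)) (at x)" for v x
        using N(2) [of "x + - v", unfolded DERIV_shift] by simp
      have avg: "\<bar>integral {0..T} (\<lambda>\<sigma>. \<eta> (\<sigma> - v) * q \<sigma>) - c * q v\<bar> \<le> c * \<delta>"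
        if v: "0 < v" "v + \<epsilon> \<le> T" "\<And>\<sigma>. \<sigma> \<in> {v..v + \<epsilon>} \<Longrightarrow> \<bar>q \<sigma> - q v\<bar> \<le> \<delta>" for v
      proof -
        have "((\<lambda>\<sigma>. \<eta> (\<sigma> - v)) has_integral N (T - v) - N (0 - v)) {0..T}"
          using T N_shift
          by (intro fundamental_theorem_of_calculus)
            (auto simp: has_real_derivative_iff_has_vector_derivative [symmetric] intro: DERIV_subset)
        hence int: "((\<lambda>\<sigma>. \<eta> (\<sigma> - v)) has_integral c) {0..T}"
          using N(8) [of "- v"] N(9) [of "T - v"] v by simp
        have "(\<lambda>\<sigma>. \<eta> (\<sigma> - v) * q \<sigma>) integrable_on {0..T}"
          by (intro integrable_continuous_real continuous_on_mult \<eta>_cont continuous_on_subset [OF q]) auto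
        hence "((\<lambda>\<sigma>. \<eta> (\<sigma> - v) * q \<sigma>) has_integral integral {0..T} (\<lambda>\<sigma>. \<eta> (\<sigma> - v) * q \<sigma>)) {0..T}"
          by (rule integrable_integral)
        from has_integral_diff [OF this has_integral_mult_left [OF int, of "q v"]]
        have diff: "((\<lambda>\<sigma>. \<eta> (\<sigma> - v) * (q \<sigma> - q v)) has_integral
            integral {0..T} (\<lambda>\<sigma>. \<eta> (\<sigma> - v) * q \<sigma>) - c * q v) {0..T}"
          by (simp add: right_diff_distrib)
        have bound: "\<bar>\<eta> (\<sigma> - v) * (q \<sigma> - q v)\<bar> \<le> \<eta> (\<sigma> - v) * \<delta>" for \<sigma>
        proof (cases "\<sigma> \<in> {v..v + \<epsilon>}")
          case True
          thus ?thesis using v(3) [OF True] N(4) by (simp add: abs_mult mult_left_mono)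
        next
          case False
          hence "\<eta> (\<sigma> - v) = 0" using N(6) [of "\<sigma> - v"] N(7) [of "\<sigma> - v"] by auto
          thus ?thesis by simp
        qed
        have "\<eta> (\<sigma> - v) * (q \<sigma> - q v) \<le> \<eta> (\<sigma> - v) * \<delta>" for \<sigma>
          using bound [of \<sigma>] by linarith
        from has_integral_le [OF diff has_integral_mult_left [OF int, of \<delta>] this]
        have upper: "integral {0..T} (\<lambda>\<sigma>. \<eta> (\<sigma> - v) * q \<sigma>) - c * q v \<le> c * \<delta>" by simp
        have "- (\<eta> (\<sigma> - v) * (q \<sigma> - q v)) \<le> \<eta> (\<sigma> - v) * \<delta>" for \<sigma>
          using bound [of \<sigma>] by linarith
        from has_integral_le [OF has_integral_neg [OF diff] has_integral_mult_left [OF int, of \<delta>] this]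
        have "- (integral {0..T} (\<lambda>\<sigma>. \<eta> (\<sigma> - v) * q \<sigma>) - c * q v) \<le> c * \<delta>" by simp
        with upper show ?thesis by linarith
      qed
      define \<theta> where "\<theta> x = N (x - s) - N (x - t)" for x
      define \<theta>' where "\<theta>' x = \<eta> (x - s) - \<eta> (x - t)" for x
      have \<theta>_deriv: "(\<theta> has_real_derivative \<theta>' x) (at x)" for x
        unfolding \<theta>_def \<theta>'_def by (intro DERIV_diff N_shift)
      have \<theta>'_cont: "continuous_on S \<theta>'" for S
        unfolding \<theta>'_def by (intro continuous_on_diff \<eta>_cont)
      have \<theta>_supp: "\<theta> x = 0 \<and> \<theta>' x = 0" if "x \<notin> {s..T}" for x
      proof (cases "x < s")
        case True
        thus ?thesis using st N(6,8) [of "x - s"] N(6,8) [of "x - t"] by (simp add: \<theta>_def \<theta>'_def)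
      next
        case False
        with that have "T < x" by simp
        thus ?thesis using st N(7,9) [of "x - s"] N(7,9) [of "x - t"] by (simp add: \<theta>_def \<theta>'_def T_def)
      qed
      have \<theta>_smooth: "times_differentiable m \<theta>" for m
      proof -
        have shift: "times_differentiable m (\<lambda>x. N (x + - v))" for v
          by (rule times_differentiable_compose_affine [OF bounded_linear_ident N(3)])
        have "times_differentiable m (\<lambda>x. N (x + - s) + (- 1) * N (x + - t))"
          by (intro times_differentiable_add times_differentiable_mult times_differentiable_const shift)
        thus ?thesis by (simp add: \<theta>_def [abs_def])
      qed
      have zero: "integral {0..T} (\<lambda>\<sigma>. \<theta>' \<sigma> * p \<sigma> + \<theta> \<sigma> * r \<sigma>) = 0"
        by (rule test [OF \<theta>_smooth \<theta>_deriv \<theta>'_cont st(1) T(2) \<theta>_supp])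
      have \<theta>_cont: "continuous_on S \<theta>" for S
        using \<theta>_deriv by (auto intro!: continuous_at_imp_continuous_on DERIV_isCont)
      have "((\<lambda>\<sigma>. \<theta>' \<sigma> * p \<sigma> + \<theta> \<sigma> * r \<sigma>) has_integral 0) {0..T}"
      proof -
        have "(\<lambda>\<sigma>. \<theta>' \<sigma> * p \<sigma> + \<theta> \<sigma> * r \<sigma>) integrable_on {0..T}"
          by (intro integrable_continuous_real continuous_on_add continuous_on_mult \<theta>_cont \<theta>'_cont
              continuous_on_subset [OF p] continuous_on_subset [OF r]) auto
        thus ?thesis using zero by (metis integrable_integral)
      qed
      moreover have "((\<lambda>\<sigma>. \<theta>' \<sigma> * R \<sigma> + \<theta> \<sigma> * r \<sigma>) has_integral \<theta> T * R T - \<theta> 0 * R 0) {0..T}"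
      proof (rule fundamental_theorem_of_calculus [OF T(1)])
        fix x assume "x \<in> {0..T}"
        hence "(R has_real_derivative r x) (at x within {0..T})" by (intro R) auto
        from DERIV_mult [OF DERIV_subset [OF \<theta>_deriv subset_UNIV] this]
        show "((\<lambda>\<sigma>. \<theta> \<sigma> * R \<sigma>) has_vector_derivative \<theta>' x * R x + \<theta> x * r x) (at x within {0..T})"
          by (simp add: has_real_derivative_iff_has_vector_derivative mult.commute)
      qed
      moreover have "\<theta> T * R T - \<theta> 0 * R 0 = 0"
      proof -
        have "\<theta> T = 0" using N(9) [of "T - s"] N(9) [of "T - t"] st by (simp add: \<theta>_def T_def)
        moreover have "\<theta> 0 = 0" using \<theta>_supp [of 0] st by simp
        ultimately show ?thesis by simp
      qed
      ultimately have "((\<lambda>\<sigma>. (\<theta>' \<sigma> * p \<sigma> + \<theta> \<sigma> * r \<sigma>) - (\<theta>' \<sigma> * R \<sigma> + \<theta> \<sigma> * r \<sigma>)) has_integral 0 - 0) {0..T}"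
        by (metis has_integral_diff)
      hence *: "((\<lambda>\<sigma>. \<eta> (\<sigma> - s) * q \<sigma> - \<eta> (\<sigma> - t) * q \<sigma>) has_integral 0) {0..T}"
        by (simp add: q_def \<theta>'_def algebra_simps)
      have "(\<lambda>\<sigma>. \<eta> (\<sigma> - v) * q \<sigma>) integrable_on {0..T}" for v
        by (intro integrable_continuous_real continuous_on_mult \<eta>_cont continuous_on_subset [OF q]) auto
      from integral_unique [OF *] Henstock_Kurzweil_Integration.integral_diff [OF this [of s] this [of t]]
      have "integral {0..T} (\<lambda>\<sigma>. \<eta> (\<sigma> - s) * q \<sigma>) = integral {0..T} (\<lambda>\<sigma>. \<eta> (\<sigma> - t) * q \<sigma>)"
        by simp
      moreover have "\<bar>integral {0..T} (\<lambda>\<sigma>. \<eta> (\<sigma> - s) * q \<sigma>) - c * q s\<bar> \<le> c * \<delta>"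
        using st \<epsilon> \<epsilon>12 by (intro avg) (auto simp: T_def \<epsilon>_def)
      moreover have "\<bar>integral {0..T} (\<lambda>\<sigma>. \<eta> (\<sigma> - t) * q \<sigma>) - c * q t\<bar> \<le> c * \<delta>"
        using st \<epsilon> \<epsilon>12 by (intro avg) (auto simp: T_def \<epsilon>_def)
      ultimately have "\<bar>c * q s - c * q t\<bar> \<le> 2 * (c * \<delta>)" by linarith
      moreover have "\<bar>c * q s - c * q t\<bar> = c * \<bar>q s - q t\<bar>"
        using N(1) unfolding right_diff_distrib [symmetric] abs_mult by simp
      ultimately have "c * \<bar>q s - q t\<bar> \<le> c * (2 * \<delta>)" by linarith
      thus ?thesis using N(1) by simp
    qed
    from this [of "\<bar>q s - q t\<bar> / 4"] show ?thesis by (cases "q s = q t") auto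
  qed
  have const': "q s = q 1" if "s \<in> {0<..}" for s
  proof (cases s "1 :: real" rule: linorder_cases)
    case less
    thus ?thesis using const [of s 1] that by simp
  next
    case greater
    thus ?thesis using const [of 1 s] by simp
  qed simp
  have q_const: "q s = q 1" if "0 \<le> s" for s
  proof (rule continuous_constant_on_closure [OF _ const'])
    show "continuous_on (closure {0<..}) q" using q by simp
    show "s \<in> closure {0<..}" using that by simp
  qed
  have eq: "q 1 + R s = p s" if "0 \<le> s" for s
    using q_const [OF that] unfolding q_def by linarith
  have "((\<lambda>s. q 1 + R s) has_real_derivative r t) (at t within {0..})"
    using DERIV_add [OF DERIV_const R_at [OF t], of "q 1"] by simp
  thus ?thesis
    by (rule has_field_derivative_transform_within [OF _ zero_less_one]) (use t eq in auto)
qed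

section \<open>Symmetrizable systems\<close>

lemma complex_matrix_mul:
  "complex_matrix (M ** N) *v x = complex_matrix M *v (complex_matrix N *v x)"
  unfolding vec_eq_iff
proof
  fix i
  have "(complex_matrix (M ** N) *v x) $ i = (\<Sum>j\<in>UNIV. \<Sum>k\<in>UNIV. (M $ i $ k * N $ k $ j) *\<^sub>R (x $ j))"
    by (simp only: complex_matrix_mult_component) (simp add: matrix_matrix_mult_def scaleR_sum_left)
  also have "\<dots> = (\<Sum>k\<in>UNIV. \<Sum>j\<in>UNIV. (M $ i $ k * N $ k $ j) *\<^sub>R (x $ j))"
    by (rule sum.swap)
  also have "\<dots> = (complex_matrix M *v (complex_matrix N *v x)) $ i"
    by (simp add: complex_matrix_mult_component scaleR_sum_right)
  finally show "(complex_matrix (M ** N) *v x) $ i = (complex_matrix M *v (complex_matrix N *v x)) $ i" .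
qed

lemma complex_matrix_one: "complex_matrix (mat 1) *v (x :: complex^'n) = x"
proof -
  have "complex_matrix (mat 1 :: real^'n^'n) = mat 1"
    by (simp add: map_matrix_def mat_def vec_eq_iff)
  thus ?thesis by (simp only: matrix_vector_mul_lid)
qed

lemma mat_app_mat_app: "mat_app M (mat_app N f) = mat_app (M ** N) f"
  by transfer (simp add: complex_matrix_mul L2_eq_def in_L2_matrix)

lemma mat_app_one: "mat_app (mat 1) f = f"
  by transfer (simp add: complex_matrix_one L2_eq_def)

lemma integrable_scaleR_L2:
  fixes f :: "real^'d::finite \<Rightarrow> complex^'n::finite"
  assumes \<psi>: "smooth_compact \<psi>" and f: "in_L2 f"
  shows "integrable lborel (\<lambda>x. \<psi> x *\<^sub>R f x)"
proof (rule Bochner_Integration.integrable_bound)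
  define e :: "complex^'n" where "e = axis undefined 1"
  have "integrable lborel (\<lambda>x. (norm (\<psi> x *\<^sub>R e))\<^sup>2)"
    by (rule in_L2_integrable [OF in_L2_smooth_compact [OF \<psi>]])
  moreover have "norm e = 1" by (simp add: e_def norm_axis_1)
  ultimately have "integrable lborel (\<lambda>x. (\<psi> x)\<^sup>2)" by simp
  thus "integrable lborel (\<lambda>x. (\<psi> x)\<^sup>2 + (norm (f x))\<^sup>2)"
    by (intro Bochner_Integration.integrable_add in_L2_integrable f)
  have "norm (\<psi> x *\<^sub>R f x) \<le> (\<psi> x)\<^sup>2 + (norm (f x))\<^sup>2" for x
    using sum_squares_bound [of "\<bar>\<psi> x\<bar>" "norm (f x)"]
      mult_nonneg_nonneg [OF abs_ge_zero norm_ge_zero, of "\<psi> x" "f x"]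
    unfolding norm_scaleR power2_abs by linarith
  thus "AE x in lborel. norm (\<psi> x *\<^sub>R f x) \<le> norm ((\<psi> x)\<^sup>2 + (norm (f x))\<^sup>2)"
    by simp
  have [measurable]: "\<psi> \<in> borel_measurable borel" "f \<in> borel_measurable borel"
    by (auto intro: borel_measurable_continuous_onI smooth_compact_continuous \<psi> in_L2_measurable f)
  show "(\<lambda>x. \<psi> x *\<^sub>R f x) \<in> borel_measurable lborel" by measurable
qed

lemma inner_integral_scaleR_L2:
  assumes \<psi>: "smooth_compact \<psi>" and f: "in_L2 f"
  shows "inner (\<integral>x. \<psi> x *\<^sub>R f x \<partial>lborel) e = inner (abs_L2 f) (tensor \<psi> e)"
proof -
  have "inner (\<integral>x. \<psi> x *\<^sub>R f x \<partial>lborel) e = (\<integral>x. inner (\<psi> x *\<^sub>R f x) e \<partial>lborel)"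
    by (rule integral_inner_left [symmetric]) (rule integrable_scaleR_L2 [OF assms])
  thus ?thesis
    by (simp add: tensor_def inner_abs_L2 f in_L2_smooth_compact [OF \<psi>])
qed

lemma smooth_compact_slice:
  assumes \<phi>: "smooth_compact (\<phi> :: real \<times> (real^'d::finite) \<Rightarrow> real)"
  shows "smooth_compact (\<lambda>x. \<phi> (t, x))"
  unfolding smooth_compact_def
proof (intro conjI allI)
  have "bounded_linear (\<lambda>x::real^'d. (0::real, x))"
    by (intro bounded_linear_Pair bounded_linear_zero bounded_linear_ident)
  from times_differentiable_compose_affine [OF this, of _ \<phi> "(t, 0)"]
  show "times_differentiable m (\<lambda>x. \<phi> (t, x))" for m
    using \<phi> by (simp add: smooth_compact_def)
  obtain K where K: "compact K" "\<And>z. z \<notin> K \<Longrightarrow> \<phi> z = 0"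
    using \<phi> unfolding smooth_compact_def by auto
  have "compact (snd ` K)" by (intro compact_continuous_image K continuous_intros)
  moreover have "\<phi> (t, x) = 0" if "x \<notin> snd ` K" for x
    using that by (intro K) force
  ultimately show "\<exists>K. compact K \<and> (\<forall>x. x \<notin> K \<longrightarrow> \<phi> (t, x) = 0)" by blast
qed

lemma frechet_derivative_slice:
  assumes \<phi>: "smooth_compact (\<phi> :: real \<times> (real^'d::finite) \<Rightarrow> real)"
  shows "frechet_derivative (\<lambda>x. \<phi> (t, x)) (at x) v = frechet_derivative \<phi> (at (t, x)) (0, v)"
proof -
  have "((\<lambda>x. (t, x)) has_derivative (\<lambda>v. (0, v))) (at x)"
    by (auto intro!: derivative_eq_intros)
  from has_derivative_compose [OF this smooth_compact_has_derivative [OF \<phi>]]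
  show ?thesis using frechet_derivative_at by metis
qed

lemma dt_has_derivative:
  assumes \<phi>: "smooth_compact (\<phi> :: real \<times> (real^'d::finite) \<Rightarrow> real)"
  shows "((\<lambda>s. \<phi> (s, x)) has_real_derivative dt \<phi> (t, x)) (at t)"
proof -
  have "((\<lambda>s. (s, x)) has_derivative (\<lambda>h. h *\<^sub>R (1, 0))) (at t)"
    by (auto intro!: derivative_eq_intros)
  from has_derivative_compose [OF this smooth_compact_has_derivative [OF \<phi>]]
  have "((\<lambda>s. \<phi> (s, x)) has_derivative (\<lambda>h. frechet_derivative \<phi> (at (t, x)) (h *\<^sub>R (1, 0)))) (at t)" .
  moreover have "frechet_derivative \<phi> (at (t, x)) (h *\<^sub>R (1, 0)) = dt \<phi> (t, x) * h" for h
    unfolding dt_def linear_cmul [OF has_derivative_linear [OF smooth_compact_has_derivative [OF \<phi>]]]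
    by simp
  ultimately show ?thesis by (simp only: has_field_derivative_def)
qed

lemma test_function_smooth_compact: "test_function \<phi> \<Longrightarrow> smooth_compact \<phi>"
  unfolding test_function_def smooth_compact_def by auto

text \<open>
  \<open>Q\<^sup>T Q\<close> is a symmetrizer; \<open>Q'\<close> is the inverse of \<open>Q\<close>, given explicitly for the estimates.
\<close>

locale symmetrizable_system =
  fixes A :: "'d::finite \<Rightarrow> real^'n::finite^'n" and B Q Q' :: "real^'n^'n"
  assumes left_inverse: "Q' ** Q = mat 1"
    and symmetric: "transpose (transpose Q ** Q ** A j) = transpose Q ** Q ** A j"
begin

definition q :: real where
  "q = onorm (mat_app Q' :: ('d, 'n) L2 \<Rightarrow> ('d, 'n) L2) + 1"

sublocale evo: approximable_evolution
  "\<lambda>j. mat_app (A j) :: ('d, 'n) L2 \<Rightarrow> ('d, 'n) L2" "\<lambda>j. mat_app (transpose (A j))"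
  "mat_app B" "mat_app (transpose B)" "mat_app Q" diff_quot test_span q
proof (rule approximable_evolution.intro)
  fix j n i m and x y F :: "('d, 'n) L2"
  show "inner (mat_app Q (mat_app (A j) x)) (mat_app Q y) = inner (mat_app Q x) (mat_app Q (mat_app (A j) y))"
  proof -
    have "inner (mat_app Q (mat_app (A j) x)) (mat_app Q y) = inner (mat_app (transpose Q ** Q ** A j) x) y"
      by (simp only: inner_commute [of _ "mat_app Q y"] inner_mat_app [of Q y] mat_app_mat_app matrix_mul_assoc)
        (simp only: inner_commute)
    also have "\<dots> = inner x (mat_app (transpose Q ** Q ** A j) y)"
      by (simp only: inner_mat_app symmetric)
    also have "\<dots> = inner (mat_app Q x) (mat_app Q (mat_app (A j) y))"
      by (simp only: inner_mat_app [of Q x] mat_app_mat_app matrix_mul_assoc)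
    finally show ?thesis .
  qed
  show "0 < q"
    by (simp add: q_def onorm_pos_le [OF bounded_linear_mat_app] add_nonneg_pos)
  show "norm x \<le> q * norm (mat_app Q x)"
  proof -
    have "x = mat_app Q' (mat_app Q x)"
      by (simp add: mat_app_mat_app left_inverse mat_app_one)
    hence "norm x = norm (mat_app Q' (mat_app Q x))" by simp
    also have "\<dots> \<le> onorm (mat_app Q' :: ('d, 'n) L2 \<Rightarrow> _) * norm (mat_app Q x)"
      by (rule onorm [OF bounded_linear_mat_app])
    also have "\<dots> \<le> q * norm (mat_app Q x)"
      by (intro mult_right_mono) (auto simp: q_def)
    finally show ?thesis .
  qed
qed (rule bounded_linear_mat_app bounded_linear_diff_quot inner_mat_app diff_quot_skew diff_quot_diff_quot
    diff_quot_mat_app subspace_test_span closure_test_span mat_app_test_span diff_quot_test_span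
    convergent_diff_quot; assumption?)+

lemma adj_gen_tensor:
  assumes \<psi>: "smooth_compact \<psi>"
  shows "inner u (evo.adj_gen (tensor \<psi> e)) =
    (\<Sum>j\<in>UNIV. inner (mat_app (A j) u) (tensor (\<lambda>x. frechet_derivative \<psi> (at x) (axis j 1)) e))
    - inner (mat_app B u) (tensor \<psi> e)"
proof -
  have "evo.deriv_D j (tensor \<psi> e) = tensor (\<lambda>x. frechet_derivative \<psi> (at x) (axis j 1)) e" for j
    by (rule evo.deriv_D_eqI [OF diff_quot_tensor_tendsto [OF \<psi>]])
  thus ?thesis
    by (simp add: evo.adj_gen_def inner_diff_right inner_sum_right inner_mat_app)
qed

text \<open>
  The inner integral of the distributional formulation, for a single function \<open>f\<close> in place of the
  solution at time \<open>t\<close>.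
\<close>

definition tested :: "(real \<times> (real^'d) \<Rightarrow> real) \<Rightarrow> (real^'d \<Rightarrow> complex^'n) \<Rightarrow> real \<Rightarrow> complex^'n" where
  "tested \<phi> f t = (\<integral>x. - dt \<phi> (t, x) *\<^sub>R f x - (\<Sum>j\<in>UNIV. dx j \<phi> (t, x) *\<^sub>R (complex_matrix (A j) *v f x))
     + \<phi> (t, x) *\<^sub>R (complex_matrix B *v f x) \<partial>lborel)"

lemma inner_tested:
  assumes \<phi>: "smooth_compact \<phi>" and f: "in_L2 f"
  shows "inner (tested \<phi> f t) e =
    - (inner (abs_L2 f) (tensor (\<lambda>x. dt \<phi> (t, x)) e) + inner (abs_L2 f) (evo.adj_gen (tensor (\<lambda>x. \<phi> (t, x)) e)))"
proof -
  have dt: "smooth_compact (\<lambda>x. dt \<phi> (t, x))"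
    unfolding dt_def by (rule smooth_compact_slice [OF smooth_compact_partial [OF \<phi>]])
  have dx: "smooth_compact (\<lambda>x. dx j \<phi> (t, x))" for j
    unfolding dx_def by (rule smooth_compact_slice [OF smooth_compact_partial [OF \<phi>]])
  have sl: "smooth_compact (\<lambda>x. \<phi> (t, x))" by (rule smooth_compact_slice [OF \<phi>])
  note int = integrable_scaleR_L2 [OF dt f] integrable_scaleR_L2 [OF dx in_L2_matrix [OF f]]
    integrable_scaleR_L2 [OF sl in_L2_matrix [OF f]]
  have "tested \<phi> f t = - (\<integral>x. dt \<phi> (t, x) *\<^sub>R f x \<partial>lborel)
      - (\<Sum>j\<in>UNIV. \<integral>x. dx j \<phi> (t, x) *\<^sub>R (complex_matrix (A j) *v f x) \<partial>lborel)
      + (\<integral>x. \<phi> (t, x) *\<^sub>R (complex_matrix B *v f x) \<partial>lborel)"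
    unfolding tested_def scaleR_minus_left
    by (rule has_bochner_integral_integral_eq)
      (intro has_bochner_integral_add has_bochner_integral_diff has_bochner_integral_minus
        has_bochner_integral_sum has_bochner_integral_integrable int)
  hence "inner (tested \<phi> f t) e = - inner (abs_L2 f) (tensor (\<lambda>x. dt \<phi> (t, x)) e)
      - (\<Sum>j\<in>UNIV. inner (mat_app (A j) (abs_L2 f)) (tensor (\<lambda>x. dx j \<phi> (t, x)) e))
      + inner (mat_app B (abs_L2 f)) (tensor (\<lambda>x. \<phi> (t, x)) e)"
    by (simp add: inner_add_left inner_diff_left inner_sum_left abs_L2_mat_app f
        inner_integral_scaleR_L2 [OF dt f] inner_integral_scaleR_L2 [OF dx in_L2_matrix [OF f]]
        inner_integral_scaleR_L2 [OF sl in_L2_matrix [OF f]])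
  thus ?thesis
    by (simp add: adj_gen_tensor [OF sl] frechet_derivative_slice [OF \<phi>] dx_def)
qed

lemma continuous_in_L2_curve:
  assumes "continuous_in_L2 U" shows "continuous_on {0..} (\<lambda>t. abs_L2 (U t))"
  unfolding continuous_on_def
proof
  fix t :: real assume t: "t \<in> {0..}"
  have "\<forall>\<^sub>F s in at t within {0..}. L2_norm (\<lambda>x. U s x - U t x) = norm (abs_L2 (U s) - abs_L2 (U t))"
    unfolding eventually_at_filter using assms t
    by (intro always_eventually) (auto simp: continuous_in_L2_def abs_L2_diff norm_abs_L2 in_L2_diff)
  moreover have "((\<lambda>s. L2_norm (\<lambda>x. U s x - U t x)) \<longlongrightarrow> 0) (at t within {0..})"
    using assms t by (auto simp: continuous_in_L2_def)
  ultimately have "((\<lambda>s. norm (abs_L2 (U s) - abs_L2 (U t))) \<longlongrightarrow> 0) (at t within {0..})"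
    by (rule Lim_transform_eventually [rotated])
  thus "((\<lambda>t. abs_L2 (U t)) \<longlongrightarrow> abs_L2 (U t)) (at t within {0..})"
    by (simp add: tendsto_norm_zero_iff Lim_null [symmetric])
qed

text \<open>
  By the product rule, the component along \<open>e\<close> of the tested equation is minus the time derivative of
  \<open>\<langle>U(t), \<phi>(t, \<cdot>) \<otimes> e\<rangle>\<close>, which vanishes for \<open>t = 0\<close> and for large \<open>t\<close>.
\<close>

lemma weak_solution_distributional:
  assumes weak: "evo.weak_solution (\<lambda>t. abs_L2 (U t))" and U: "\<And>t. 0 \<le> t \<Longrightarrow> in_L2 (U t)"
  shows "distributional_solution A B U"
  unfolding distributional_solution_def
proof (intro allI impI)
  fix \<phi> :: "real \<times> (real^'d) \<Rightarrow> real" assume test: "test_function \<phi>"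
  note \<phi> = test_function_smooth_compact [OF test]
  obtain K where K: "compact K" "K \<subseteq> {0<..} \<times> UNIV" "\<And>z. z \<notin> K \<Longrightarrow> \<phi> z = 0"
    using test unfolding test_function_def by auto
  have d0: "frechet_derivative \<phi> (at z) v = 0" if "z \<notin> K" for z v
  proof -
    have "((\<lambda>x. 0) has_derivative (\<lambda>_. 0)) (at z)" by simp
    hence "(\<phi> has_derivative (\<lambda>_. 0)) (at z)"
      by (rule has_derivative_transform_within_open [OF _ open_Compl [OF compact_imp_closed [OF K(1)]]])
        (use K that in auto)
    thus ?thesis using frechet_derivative_at by metis
  qed
  have "bounded (fst ` K)"
    by (intro compact_imp_bounded compact_continuous_image K continuous_intros)
  then obtain T' where T': "\<forall>t\<in>fst ` K. \<bar>t\<bar> \<le> T'" by (auto simp: bounded_iff)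
  define T where "T = \<bar>T'\<bar> + 1"
  have outK: "(t, x) \<notin> K" if "t \<le> 0 \<or> T \<le> t" for t x
    using that T' K(2) by (force simp: T_def)
  have zero: "tested \<phi> (U t) t = 0" if "t \<le> 0 \<or> T \<le> t" for t
    unfolding tested_def using outK [OF that] by (simp add: K(3) d0 dt_def dx_def)
  define J where "J t = indicator {0..T} t *\<^sub>R tested \<phi> (U t) t" for t
  have J: "(LBINT t:{0<..}. tested \<phi> (U t) t) = (\<integral>t. J t \<partial>lborel)"
    unfolding set_lebesgue_integral_def J_def
  proof (rule Bochner_Integration.integral_cong [OF refl])
    fix t
    show "indicator {0<..} t *\<^sub>R tested \<phi> (U t) t = indicator {0..T} t *\<^sub>R tested \<phi> (U t) t"
      using zero [of t] by (cases "0 < t \<and> t < T") auto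
  qed
  have "(\<integral>t. J t \<partial>lborel) = 0"
  \<comment> \<open>If \<open>J\<close> is not integrable, its Bochner integral is \<open>0\<close> by convention.\<close>
  proof (cases "integrable lborel J")
    case True
    have "inner (\<integral>t. J t \<partial>lborel) e = 0" for e
    proof -
      let ?f = "\<lambda>t. inner (tested \<phi> (U t) t) e"
      have set_int: "set_integrable lborel {0..T} ?f"
        using integrable_inner_left [of e, OF True] by (simp add: set_integrable_def J_def)
      define P where "P t = inner (abs_L2 (U t)) (tensor (\<lambda>x. \<phi> (t, x)) e)" for t
      have "((\<lambda>t. - P t) has_real_derivative ?f t) (at t within {0..T})" if t: "t \<in> {0..T}" for t
      proof -
        have "((\<lambda>t. tensor (\<lambda>x. \<phi> (t, x)) e) has_vector_derivative tensor (\<lambda>x. dt \<phi> (t, x)) e) (at t)"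
        proof (rule tensor_curve_derivative)
          show "continuous_on UNIV (\<lambda>(t, x). \<phi> (t, x))"
            using smooth_compact_continuous [OF \<phi>] by (simp add: case_prod_unfold)
          show "continuous_on UNIV (\<lambda>(t, x). dt \<phi> (t, x))"
            using smooth_compact_continuous [OF smooth_compact_partial [OF \<phi>]]
            by (simp add: case_prod_unfold dt_def)
          show "compact (snd ` K)" by (intro compact_continuous_image K continuous_intros)
          show "\<phi> (s, x) = 0" if "x \<notin> snd ` K" for s x
            using that by (intro K) force
          show "((\<lambda>s. \<phi> (s, x)) has_real_derivative dt \<phi> (s, x)) (at s)" for s x
            by (rule dt_has_derivative [OF \<phi>])
        qed
        hence Phi: "((\<lambda>t. tensor (\<lambda>x. \<phi> (t, x)) e) has_derivative
            (\<lambda>h. h *\<^sub>R tensor (\<lambda>x. dt \<phi> (t, x)) e)) (at t within {0..})"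
          by (auto simp: has_vector_derivative_def intro: has_derivative_at_withinI)
        have "(P has_real_derivative inner (abs_L2 (U t)) (evo.adj_gen (tensor (\<lambda>x. \<phi> (t, x)) e))
            + inner (abs_L2 (U t)) (tensor (\<lambda>x. dt \<phi> (t, x)) e)) (at t within {0..})"
          unfolding P_def
        proof (rule evo.weak_product_rule [OF _ _ _ Phi])
          show "continuous_on {0..} (\<lambda>t. abs_L2 (U t))" "0 \<le> t"
            using weak t by (auto simp: evo.weak_solution_def)
          show "((\<lambda>s. inner (abs_L2 (U s)) (tensor (\<lambda>x. \<phi> (t, x)) e)) has_real_derivative
              inner (abs_L2 (U t)) (evo.adj_gen (tensor (\<lambda>x. \<phi> (t, x)) e))) (at t within {0..})"
            using weak t tensor_in_test_span [OF smooth_compact_slice [OF \<phi>]]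
            by (auto simp: evo.weak_solution_def)
        qed
        from DERIV_minus [OF this]
        have "((\<lambda>t. - P t) has_real_derivative ?f t) (at t within {0..})"
          using t by (simp add: inner_tested [OF \<phi> U] add.commute)
        thus ?thesis by (rule DERIV_subset) auto
      qed
      hence "(?f has_integral - P T - (- P 0)) {0..T}"
        by (intro fundamental_theorem_of_calculus)
          (auto simp: T_def has_real_derivative_iff_has_vector_derivative [symmetric])
      moreover have "P T = 0" "P 0 = 0"
      proof -
        have "tensor (\<lambda>x::real^'d. 0) e = 0" by (simp add: tensor_def zero_L2.abs_eq)
        thus "P T = 0" "P 0 = 0" unfolding P_def using outK by (simp_all add: K(3))
      qed
      ultimately have "integral {0..T} ?f = 0" by (simp add: integral_unique)
      hence "(LBINT t:{0..T}. ?f t) = 0" using set_borel_integral_eq_integral(2) [OF set_int] by simp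
      moreover have "inner (\<integral>t. J t \<partial>lborel) e = (\<integral>t. inner (J t) e \<partial>lborel)"
        by (rule integral_inner_left [symmetric]) (rule True)
      moreover have "(\<integral>t. inner (J t) e \<partial>lborel) = (LBINT t:{0..T}. ?f t)"
        by (simp add: set_lebesgue_integral_def J_def)
      ultimately show ?thesis by simp
    qed
    from this [of "\<integral>t. J t \<partial>lborel"] show ?thesis by simp
  qed (rule not_integrable_integral_eq)
  with J show "(LBINT t:{0<..}. \<integral>x. - dt \<phi> (t, x) *\<^sub>R U t x
      - (\<Sum>j\<in>UNIV. dx j \<phi> (t, x) *\<^sub>R (complex_matrix (A j) *v U t x))
      + \<phi> (t, x) *\<^sub>R (complex_matrix B *v U t x) \<partial>lborel) = 0"
    by (simp only: tested_def)
qed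

text \<open>
  Test functions of the form \<open>\<theta>(t) \<psi>(x)\<close> reduce the distributional equation to the situation of
  \<open>du_Bois_Reymond\<close> with \<open>p(t) = \<langle>U(t), \<psi> \<otimes> e\<rangle>\<close>.
\<close>

lemma distributional_weak_solution:
  assumes dist: "distributional_solution A B U" and cont: "continuous_in_L2 U"
  shows "evo.weak_solution (\<lambda>t. abs_L2 (U t))"
proof (rule evo.weak_solution_spanI [OF continuous_in_L2_curve [OF cont] test_span_def])
  have U: "in_L2 (U t)" if "0 \<le> t" for t
    using cont that by (simp add: continuous_in_L2_def)
  have U_cont: "continuous_on {0..} (\<lambda>t. abs_L2 (U t))"
    by (rule continuous_in_L2_curve [OF cont])
  fix F :: "('d, 'n) L2" and t :: real assume "F \<in> {tensor \<psi> e | \<psi> e. smooth_compact \<psi>}" and t: "0 \<le> t"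
  then obtain \<psi> e where F: "F = tensor \<psi> e" and \<psi>: "smooth_compact \<psi>" by blast
  obtain K where K: "compact K" "\<And>x. x \<notin> K \<Longrightarrow> \<psi> x = 0"
    using \<psi> unfolding smooth_compact_def by auto
  show "((\<lambda>s. inner (abs_L2 (U s)) F) has_real_derivative inner (abs_L2 (U t)) (evo.adj_gen F)) (at t within {0..})"
  proof (rule du_Bois_Reymond [OF _ _ _ t])
    show "continuous_on {0..} (\<lambda>s. inner (abs_L2 (U s)) F)"
      "continuous_on {0..} (\<lambda>s. inner (abs_L2 (U s)) (evo.adj_gen F))"
      by (intro continuous_on_inner U_cont continuous_on_const)+
    fix \<theta> \<theta>' :: "real \<Rightarrow> real" and a b :: real
    assume \<theta>: "\<And>m. times_differentiable m \<theta>" "\<And>x. (\<theta> has_real_derivative \<theta>' x) (at x)"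
      "continuous_on UNIV \<theta>'" and ab: "0 < a" "a < b" and supp: "\<And>x. x \<notin> {a..b} \<Longrightarrow> \<theta> x = 0 \<and> \<theta>' x = 0"
    define \<phi> where "\<phi> z = \<theta> (fst z) * \<psi> (snd z)" for z :: "real \<times> (real^'d)"
    have test: "test_function \<phi>"
      unfolding test_function_def
    proof (intro conjI allI exI)
      show "times_differentiable m \<phi>" for m
      proof -
        have "times_differentiable m (\<lambda>z::real \<times> (real^'d). \<theta> (fst z + 0))"
          by (rule times_differentiable_compose_affine [OF bounded_linear_fst \<theta>(1)])
        moreover have "times_differentiable m (\<lambda>z::real \<times> (real^'d). \<psi> (snd z + 0))"
          using \<psi> unfolding smooth_compact_def
          by (intro times_differentiable_compose_affine [OF bounded_linear_snd]) blast
        ultimately show ?thesis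
          unfolding \<phi>_def [abs_def] by (intro times_differentiable_mult) simp_all
      qed
      show "compact ({a..b} \<times> K)" by (intro compact_Times K) simp
      show "{a..b} \<times> K \<subseteq> {0<..} \<times> UNIV" using ab by auto
      show "z \<notin> {a..b} \<times> K \<longrightarrow> \<phi> z = 0" for z
        using supp [of "fst z"] K(2) [of "snd z"] by (cases z) (auto simp: \<phi>_def)
    qed
    note \<phi> = test_function_smooth_compact [OF test]
    have dt: "dt \<phi> (s, x) = \<theta>' s * \<psi> x" for s x
    proof -
      have "((\<lambda>s. \<phi> (s, x)) has_real_derivative \<theta>' s * \<psi> x) (at s)"
        unfolding \<phi>_def by (auto intro!: derivative_eq_intros \<theta>(2))
      thus ?thesis using dt_has_derivative [OF \<phi>] DERIV_unique by blast
    qed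
    have in_L2: "in_L2 (\<lambda>x. \<psi> x *\<^sub>R e')" for e' :: "complex^'n"
      by (rule in_L2_smooth_compact [OF \<psi>])
    have tested: "inner (tested \<phi> (U s) s) e' =
        - (\<theta>' s * inner (abs_L2 (U s)) (tensor \<psi> e') + \<theta> s * inner (abs_L2 (U s)) (evo.adj_gen (tensor \<psi> e')))"
      if "0 \<le> s" for s e'
      using evo.adj_gen_scaleR [OF tensor_in_test_span [OF \<psi>], of "\<theta> s" e']
      by (simp add: inner_tested [OF \<phi> U [OF that]] dt tensor_scaleR [OF in_L2, symmetric])
        (simp add: \<phi>_def tensor_scaleR [OF in_L2, symmetric])
    have zero: "tested \<phi> (U s) s = 0" if s: "s \<notin> {a..b}" for s
    proof -
      have "dx j \<phi> (s, x) = 0" for j x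
      proof -
        have "(\<lambda>x. \<phi> (s, x)) = (\<lambda>x. 0)" using supp [OF s] by (simp add: \<phi>_def)
        moreover have "frechet_derivative (\<lambda>x::real^'d. 0::real) (at x) v = 0" for x v
          by (simp add: frechet_derivative_const)
        ultimately show ?thesis
          using frechet_derivative_slice [OF \<phi>, of s x "axis j 1"] by (simp add: dx_def)
      qed
      thus ?thesis unfolding tested_def using supp [OF s] by (simp add: dt) (simp add: \<phi>_def supp [OF s])
    qed
    define J where "J s = indicator {0..b} s *\<^sub>R tested \<phi> (U s) s" for s
    have J: "(\<lambda>s. indicator {0<..} s *\<^sub>R tested \<phi> (U s) s) = J"
    proof
      fix s
      show "indicator {0<..} s *\<^sub>R tested \<phi> (U s) s = J s"
        using zero [of s] ab by (cases "s \<in> {a..b}") (auto simp: J_def indicator_def)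
    qed
    have "(LBINT s:{0<..}. tested \<phi> (U s) s) = 0"
      using dist test unfolding distributional_solution_def tested_def by blast
    hence J0: "(\<integral>s. J s \<partial>lborel) = 0"
      by (simp only: set_lebesgue_integral_def J)
    have comp_cont: "continuous_on {0..b} (\<lambda>s. inner (tested \<phi> (U s) s) e')" for e'
    proof -
      have "continuous_on {0..b} \<theta>"
        using \<theta>(2) by (auto intro!: continuous_at_imp_continuous_on DERIV_isCont)
      hence "continuous_on {0..b} (\<lambda>s. - (\<theta>' s * inner (abs_L2 (U s)) (tensor \<psi> e')
          + \<theta> s * inner (abs_L2 (U s)) (evo.adj_gen (tensor \<psi> e'))))"
        by (intro continuous_on_minus continuous_on_add continuous_on_mult continuous_on_inner
            continuous_on_const continuous_on_subset [OF \<theta>(3)] continuous_on_subset [OF U_cont]) auto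
      thus ?thesis by (rule continuous_on_eq) (simp add: tested)
    qed
    have comp_int: "integrable lborel (\<lambda>s. inner (J s) e')" for e'
      using borel_integrable_atLeastAtMost' [OF comp_cont [of e']]
      by (simp add: set_integrable_def J_def)
    have J_int: "integrable lborel J"
    proof -
      have "integrable lborel (\<lambda>s. \<Sum>e'\<in>Basis. inner (J s) e' *\<^sub>R e')"
        by (intro Bochner_Integration.integrable_sum integrable_scaleR_left comp_int)
      thus ?thesis by (simp add: euclidean_representation)
    qed
    have "(LBINT s:{0..b}. inner (tested \<phi> (U s) s) e) = (\<integral>s. inner (J s) e \<partial>lborel)"
      by (simp add: set_lebesgue_integral_def J_def)
    also have "\<dots> = inner (\<integral>s. J s \<partial>lborel) e"
      by (rule integral_inner_left) (rule J_int)
    finally have "(LBINT s:{0..b}. inner (tested \<phi> (U s) s) e) = 0" by (simp add: J0)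
    hence "integral {0..b} (\<lambda>s. inner (tested \<phi> (U s) s) e) = 0"
      using set_borel_integral_eq_integral(2) [OF borel_integrable_atLeastAtMost' [OF comp_cont [of e]]] by simp
    moreover have "integral {0..b} (\<lambda>s. inner (tested \<phi> (U s) s) e) =
        integral {0..b} (\<lambda>s. - (\<theta>' s * inner (abs_L2 (U s)) F + \<theta> s * inner (abs_L2 (U s)) (evo.adj_gen F)))"
      by (rule integral_cong) (simp add: tested F)
    ultimately show "integral {0..b} (\<lambda>s. \<theta>' s * inner (abs_L2 (U s)) F
        + \<theta> s * inner (abs_L2 (U s)) (evo.adj_gen F)) = 0"
      unfolding Henstock_Kurzweil_Integration.integral_neg by linarith
  qed
qed

theorem strongly_well_posed: "strongly_well_posed A B"
  unfolding strongly_well_posed_def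
proof (rule exI [of _ evo.M], intro conjI exI [of _ "evo.\<alpha>"] allI impI)
  show "0 < evo.M" by (rule evo.M_pos)
  fix U\<^sub>0 :: "real^'d \<Rightarrow> complex^'n" assume U0: "in_L2 U\<^sub>0"
  obtain u where u: "evo.weak_solution u" "u 0 = abs_L2 U\<^sub>0"
    "\<And>t. 0 \<le> t \<Longrightarrow> norm (u t) \<le> evo.M * exp (evo.\<alpha> * t) * norm (abs_L2 U\<^sub>0)"
    using evo.ex_weak_solution [of "abs_L2 U\<^sub>0"] by blast
  define U where "U t = rep_L2 (u t)" for t
  have U: "in_L2 (U t)" and abs_U: "abs_L2 (U t) = u t" for t
    by (simp_all add: U_def in_L2_rep)
  have norm_U: "L2_norm (U t) = norm (u t)" for t
    using norm_abs_L2 [OF U, of t] by (simp add: abs_U)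
  have "continuous_in_L2 U"
    unfolding continuous_in_L2_def
  proof (intro conjI allI impI U)
    fix t :: real assume "0 \<le> t"
    hence "(u \<longlongrightarrow> u t) (at t within {0..})"
      using u(1) by (auto simp: evo.weak_solution_def continuous_on_def)
    hence "((\<lambda>s. norm (u s - u t)) \<longlongrightarrow> 0) (at t within {0..})"
      by (simp add: tendsto_norm_zero_iff Lim_null [symmetric])
    moreover have "norm (u s - u t) = L2_norm (\<lambda>x. U s x - U t x)" for s
      using norm_abs_L2 [OF in_L2_diff [OF U U], of s t] by (simp add: abs_U abs_L2_diff [OF U U, symmetric])
    ultimately show "((\<lambda>s. L2_norm (\<lambda>x. U s x - U t x)) \<longlongrightarrow> 0) (at t within {0..})"
      by simp
  qed
  moreover have "distributional_solution A B U"
    by (rule weak_solution_distributional) (simp_all add: U abs_U u(1))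
  moreover have "AE x in lborel. U 0 x = U\<^sub>0 x"
    unfolding U_def u(2) by (rule rep_abs_L2 [OF U0])
  ultimately have sol: "solves_cauchy_problem A B U\<^sub>0 U"
    by (simp add: solves_cauchy_problem_def)
  have uniq: "AE x in lborel. V t x = U t x" if V: "solves_cauchy_problem A B U\<^sub>0 V" and t: "0 \<le> t" for V t
  proof -
    have cont: "continuous_in_L2 V" and V0: "AE x in lborel. V 0 x = U\<^sub>0 x"
      and dist: "distributional_solution A B V"
      using V by (auto simp: solves_cauchy_problem_def)
    have V_L2: "in_L2 (V t)" if "0 \<le> t" for t
      using cont that by (simp add: continuous_in_L2_def)
    have "abs_L2 (V 0) = u 0"
      using V0 by (simp add: u(2) abs_L2_eq_iff V_L2 U0)
    from evo.weak_solution_unique [OF distributional_weak_solution [OF dist cont] u(1) this t]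
    have "abs_L2 (V t) = abs_L2 (U t)" by (simp add: abs_U)
    thus ?thesis by (simp add: abs_L2_eq_iff V_L2 t U)
  qed
  have bound: "L2_norm (U t) \<le> evo.M * exp (evo.\<alpha> * t) * L2_norm U\<^sub>0" if "0 \<le> t" for t
    using u(3) [OF that] by (simp add: norm_U norm_abs_L2 U0)
  show "\<exists>U. solves_cauchy_problem A B U\<^sub>0 U \<and>
      (\<forall>V. solves_cauchy_problem A B U\<^sub>0 V \<longrightarrow> (\<forall>t\<ge>0. AE x in lborel. V t x = U t x)) \<and>
      (\<forall>t\<ge>0. L2_norm (U t) \<le> evo.M * exp (evo.\<alpha> * t) * L2_norm U\<^sub>0)"
    using sol uniq bound by blast
qed

end

section \<open>Hyperbolicity\<close>

lemma matrix_power_mult_vector: "matrix_power M m *v x = (((*v) M) ^^ m) x"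
  by (induction m) (simp_all add: matrix_vector_mul_assoc [symmetric])

lemma scaleR_mult_vector: "(r *\<^sub>R M) *v x = r *\<^sub>R (M *v x)" for M :: "complex^'n^'m"
  by (simp add: vec_eq_iff matrix_vector_mult_def scaleR_sum_right)

text \<open>
  The columns of the partial sums converge by \<open>op_exp_sums\<close>, hence so do the matrices.
\<close>

lemma matrix_exp_mult_vector: "matrix_exp M *v x = op_exp ((*v) M) 1 x"
proof -
  note bl = matrix_vector_mul_bounded_linear [of M]
  define E where "E = (\<chi> i j. op_exp ((*v) M) 1 (axis j 1) $ i)"
  have "(\<lambda>N. \<Sum>m<N. (1 / fact m) *\<^sub>R matrix_power M m) \<longlonglongrightarrow> E"
  proof (intro vec_tendstoI)
    fix i j
    have "(\<lambda>m. ((1 ^ m / fact m) *\<^sub>R ((((*v) M) ^^ m) (axis j 1))) $ i) sums (op_exp ((*v) M) 1 (axis j 1) $ i)"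
      by (rule bounded_linear.sums [OF bounded_linear_vec_nth op_exp_sums [OF bl]])
    moreover have "((((*v) M) ^^ m) (axis j 1)) $ i = matrix_power M m $ i $ j" for m
      unfolding matrix_power_mult_vector [symmetric]
      by (simp add: matrix_vector_mult_def axis_def if_distrib cong: if_cong)
    ultimately show "(\<lambda>N. (\<Sum>m<N. (1 / fact m) *\<^sub>R matrix_power M m) $ i $ j) \<longlonglongrightarrow> E $ i $ j"
      by (simp add: sums_def E_def)
  qed
  hence "(\<lambda>m. (1 / fact m) *\<^sub>R matrix_power M m) sums E"
    by (simp add: sums_def)
  hence sums: "(\<lambda>m. (1 / fact m) *\<^sub>R matrix_power M m) sums matrix_exp M"
    unfolding matrix_exp_def by (simp add: sums_unique [symmetric])
  have "bounded_linear (\<lambda>M. M *v x)"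
    by (intro linear_conv_bounded_linear [THEN iffD1] linearI)
      (simp_all add: matrix_vector_mult_add_rdistrib scaleR_mult_vector)
  from bounded_linear.sums [OF this sums]
  have "(\<lambda>m. ((1 / fact m) *\<^sub>R matrix_power M m) *v x) sums (matrix_exp M *v x)" .
  moreover have "(\<lambda>m. ((1 / fact m) *\<^sub>R matrix_power M m) *v x) = (\<lambda>m. (1 ^ m / fact m) *\<^sub>R (((*v) M) ^^ m) x)"
    by (simp add: matrix_power_mult_vector scaleR_mult_vector)
  ultimately show ?thesis
    using op_exp_sums [OF bl, of 1 x] by (simp add: sums_unique2)
qed

lemma inner_imaginary: "inner (\<i> *s x) y = - inner x (\<i> *s y)"
  for x y :: "complex^'n"
  by (simp add: inner_vec_def inner_complex_def sum_negf [symmetric] algebra_simps)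

lemma complex_matrix_imaginary: "complex_matrix M *v (\<i> *s x) = \<i> *s (complex_matrix M *v x)"
  by (simp add: vector_scalar_commute)

lemma transpose_component: "transpose T $ i $ k = T $ k $ i"
  by (simp add: transpose_def)

context symmetrizable_system
begin

text \<open>
  The condition on the symmetrizer is linear in \<open>A j\<close>.
\<close>

lemma symmetric_symbol: "transpose (transpose Q ** Q ** symbol A \<xi>) = transpose Q ** Q ** symbol A \<xi>"
proof -
  have *: "(transpose Q ** Q ** symbol A \<xi>) $ i $ k = (\<Sum>j\<in>UNIV. \<xi> $ j * (transpose Q ** Q ** A j) $ i $ k)" for i k
  proof -
    have "(transpose Q ** Q ** symbol A \<xi>) $ i $ k
        = (\<Sum>l\<in>UNIV. \<Sum>j\<in>UNIV. \<xi> $ j * ((transpose Q ** Q) $ i $ l * A j $ l $ k))"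
      unfolding matrix_matrix_mult_def [of "transpose Q ** Q"]
      by (simp add: symbol_def sum_distrib_left mult_ac)
    also have "\<dots> = (\<Sum>j\<in>UNIV. \<Sum>l\<in>UNIV. \<xi> $ j * ((transpose Q ** Q) $ i $ l * A j $ l $ k))"
      by (rule sum.swap)
    also have "\<dots> = (\<Sum>j\<in>UNIV. \<xi> $ j * (transpose Q ** Q ** A j) $ i $ k)"
      unfolding matrix_matrix_mult_def [of "transpose Q ** Q"]
      by (simp add: sum_distrib_left)
    finally show ?thesis .
  qed
  have "(transpose Q ** Q ** A j) $ k $ i = (transpose Q ** Q ** A j) $ i $ k" for j i k
    using arg_cong [OF symmetric [of j], of "\<lambda>T. T $ i $ k"] by (simp only: transpose_component)
  thus ?thesis unfolding vec_eq_iff by (simp only: transpose_component * simp_thms)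
qed

text \<open>
  With \<open>T = Q\<^sup>T Q A(\<xi>)\<close> real and symmetric, \<open>\<langle>i T x, x\<rangle>\<close> equals its own negative for the real inner
  product, so the energy \<open>\<bar>Q x\<bar>\<close> does not grow along \<open>x' = - i A(\<xi>) x\<close>. The resulting bound does not
  depend on \<open>\<xi>\<close>.
\<close>

theorem hyperbolic: "hyperbolic A"
  unfolding hyperbolic_def
proof (rule bdd_aboveI2)
  fix \<xi> :: "real^'d"
  let ?S = "symbol A \<xi>"
  let ?M = "map_matrix (\<lambda>x. - \<i> * complex_of_real x) ?S"
  let ?Q = "(*v) (complex_matrix Q)" and ?Q' = "(*v) (complex_matrix Q')"
  let ?P = "transpose Q ** Q"
  note bl = matrix_vector_mul_bounded_linear
  have M: "?M *v x = - (\<i> *s (complex_matrix ?S *v x))" for x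
    by (simp add: vec_eq_iff matrix_vector_mult_def map_matrix_def sum_negf sum_distrib_left mult.assoc)
  have cons: "inner (?Q (?M *v x)) (?Q x) \<le> 0 * (norm (?Q x))\<^sup>2" for x
  proof -
    let ?T = "complex_matrix (?P ** ?S)"
    have "inner (\<i> *s (?T *v x)) x = - inner (?T *v x) (\<i> *s x)"
      by (rule inner_imaginary)
    also have "\<dots> = - inner x (\<i> *s (?T *v x))"
      by (simp only: inner_complex_matrix symmetric_symbol complex_matrix_imaginary)
    finally have "inner (\<i> *s (?T *v x)) x = 0"
      by (simp add: inner_commute)
    moreover have "inner (?Q (\<i> *s (complex_matrix ?S *v x))) (?Q x) = inner (\<i> *s (?T *v x)) x"
      by (simp only: inner_commute [of _ "?Q x"] inner_complex_matrix [of Q x] complex_matrix_imaginary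
          complex_matrix_mul [symmetric] matrix_mul_assoc)
        (simp only: inner_commute)
    ultimately have "inner (?Q (\<i> *s (complex_matrix ?S *v x))) (?Q x) = 0" by simp
    thus ?thesis
      unfolding M by (simp add: linear_neg [OF bounded_linear.linear [OF bl]])
  qed
  show "onorm ((*v) (matrix_exp ?M)) \<le> onorm ?Q' * onorm ?Q"
  proof (rule onorm_bound)
    show "0 \<le> onorm ?Q' * onorm ?Q" by (intro mult_nonneg_nonneg onorm_pos_le bl)
    fix x
    have "norm (?Q (op_exp ((*v) ?M) 1 x)) \<le> exp (0 * 1) * norm (?Q x)"
      by (rule op_exp_energy_estimate [OF bl bl cons]) simp
    hence Q: "norm (?Q (matrix_exp ?M *v x)) \<le> norm (?Q x)"
      by (simp add: matrix_exp_mult_vector)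
    have "matrix_exp ?M *v x = ?Q' (?Q (matrix_exp ?M *v x))"
      by (simp only: complex_matrix_mul [symmetric] left_inverse complex_matrix_one)
    hence "norm (matrix_exp ?M *v x) = norm (?Q' (?Q (matrix_exp ?M *v x)))" by simp
    also have "\<dots> \<le> onorm ?Q' * norm (?Q (matrix_exp ?M *v x))" by (rule onorm [OF bl])
    also have "\<dots> \<le> onorm ?Q' * (onorm ?Q * norm x)"
      by (intro mult_left_mono order_trans [OF Q onorm [OF bl]] onorm_pos_le bl)
    finally show "norm (matrix_exp ?M *v x) \<le> onorm ?Q' * onorm ?Q * norm x"
      by (simp add: mult.assoc)
  qed
qed

end


section \<open>The symmetrizer of the system\<close>

lemma block_parts_eq: "block (u_part U) (v_part U) (w_part U) = U"
proof -
  have "block (u_part U) (v_part U) (w_part U) $ r = U $ r" for r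
    by (cases r rule: sum.exhaust [case_product sum.exhaust])
      (auto simp: block_def u_part_def v_part_def w_part_def split: sum.splits)
  thus ?thesis by (simp add: vec_eq_iff)
qed

lemma sum_UNIV_Plus:
  "(\<Sum>r\<in>UNIV. f r) = (\<Sum>x\<in>UNIV. f (Inl x)) + (\<Sum>y\<in>UNIV. f (Inr y))"
  for f :: "'a::finite + 'b::finite \<Rightarrow> 'c::comm_monoid_add"
  by (subst UNIV_Plus_UNIV [symmetric], subst sum.Plus) simp_all

lemma inner_block:
  "inner (block u v w) (block u' v' w') = u * u' + inner v v' + (\<Sum>l\<in>UNIV. inner (w l) (w' l))"
proof -
  have "(\<Sum>(l, i)\<in>UNIV. w l $ i * w' l $ i) = (\<Sum>l\<in>UNIV. \<Sum>i\<in>UNIV. w l $ i * w' l $ i)"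
    by (simp add: sum.cartesian_product)
  thus ?thesis
    by (simp add: inner_vec_def sum_UNIV_Plus block_def case_prod_unfold UNIV_unit)
qed

text \<open>
  Instances with \<open>s = c\<close> and \<open>r l = a l / c\<^sup>2\<close> give the change of variables; its inverse is of the same form.
\<close>

definition Q_map :: "real \<Rightarrow> ('k \<Rightarrow> real) \<Rightarrow>
    real^('d::finite, 'k::finite) block_index \<Rightarrow> real^('d, 'k) block_index" where
  "Q_map s r U = block (s * u_part U) (v_part U) (\<lambda>l. w_part U l + r l *\<^sub>R v_part U)"

lemma linear_Q_map: "linear (Q_map s r)"
  by (rule linearI)
    (simp_all add: Q_map_def block_add block_scaleR algebra_simps)

lemma Q_map_matrix: "matrix (Q_map s r) *v U = Q_map s r U"
  by (simp add: matrix_works linear_Q_map)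

lemma A_matrix_mult: "A_matrix c a j *v U = A_map c a (axis j 1) U"
  by (simp add: A_matrix_def matrix_works linear_A_map)

lemma Q_map_inverse: "s \<noteq> 0 \<Longrightarrow> Q_map (1 / s) (\<lambda>l. - r l) (Q_map s r U) = U"
  using block_parts_eq [of U] by (simp add: Q_map_def)

text \<open>
  After the change of variables the last blocks of \<open>A(\<xi>) x\<close> are \<open>- a\<^sub>l u \<xi> + (a\<^sub>l / c\<^sup>2) c\<^sup>2 u \<xi> = 0\<close>. What remains is
  \<open>c\<^sup>2 (u' (\<xi> \<cdot> v) + u (\<xi> \<cdot> v'))\<close>, symmetric in the two arguments.
\<close>

lemma Q_map_A_map:
  assumes "c \<noteq> 0"
  shows "inner (Q_map c (\<lambda>l. a l / c\<^sup>2) (A_map c a \<xi> x)) (Q_map c (\<lambda>l. a l / c\<^sup>2) y) =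
    inner (Q_map c (\<lambda>l. a l / c\<^sup>2) x) (Q_map c (\<lambda>l. a l / c\<^sup>2) (A_map c a \<xi> y))"
  using assms
  by (simp add: Q_map_def A_map_def inner_block inner_commute [of \<xi>] algebra_simps power2_eq_square
      flip: scaleR_add_left)

lemma symmetric_matrixI:
  fixes T :: "real^'n^'n"
  assumes "\<And>x y. inner (T *v x) y = inner x (T *v y)"
  shows "transpose T = T"
proof -
  have "inner (transpose T *v y) x = inner (T *v y) x" for x y
    using assms [of x y] by (metis dot_lmul_matrix inner_commute vector_transpose_matrix transpose_transpose)
  hence "transpose T *v y = T *v y" for y
    by (metis vector_eq_rdot)
  thus ?thesis by (simp add: matrix_eq)
qed

lemma symmetrizable_system:
  fixes a :: "'k::finite \<Rightarrow> real" and B :: "real^('d::finite, 'k) block_index^('d, 'k) block_index"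
  assumes c: "c \<noteq> 0"
  shows "symmetrizable_system (A_matrix c a) (matrix (Q_map c (\<lambda>l. a l / c\<^sup>2)))
    (matrix (Q_map (1 / c) (\<lambda>l. - (a l / c\<^sup>2))) :: real^('d, 'k) block_index^('d, 'k) block_index)"
proof
  let ?Q = "matrix (Q_map c (\<lambda>l. a l / c\<^sup>2)) :: real^('d, 'k) block_index^('d, 'k) block_index"
  let ?Q' = "matrix (Q_map (1 / c) (\<lambda>l. - (a l / c\<^sup>2))) :: real^('d, 'k) block_index^('d, 'k) block_index"
  have "(?Q' ** ?Q) *v U = mat 1 *v U" for U
    unfolding matrix_vector_mul_assoc [symmetric] Q_map_matrix Q_map_inverse [OF c]
    by simp
  thus "?Q' ** ?Q = mat 1" unfolding matrix_eq by blast
  fix j :: 'd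
  show "transpose (transpose ?Q ** ?Q ** A_matrix c a j) = transpose ?Q ** ?Q ** A_matrix c a j"
  proof (rule symmetric_matrixI)
    fix x y :: "real^('d, 'k) block_index"
    have tr: "inner (transpose ?Q *v z) y = inner z (?Q *v y)" for z y
      by (metis dot_lmul_matrix vector_transpose_matrix transpose_transpose)
    have "inner ((transpose ?Q ** ?Q ** A_matrix c a j) *v x) y =
        inner (?Q *v (A_matrix c a j *v x)) (?Q *v y)"
      by (simp only: matrix_vector_mul_assoc [symmetric] tr)
    also have "\<dots> = inner (?Q *v x) (?Q *v (A_matrix c a j *v y))"
      by (simp only: Q_map_matrix A_matrix_mult Q_map_A_map [OF c])
    also have "\<dots> = inner x ((transpose ?Q ** ?Q ** A_matrix c a j) *v y)"
      by (simp only: matrix_vector_mul_assoc [symmetric] inner_commute [of x] tr)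
        (simp only: inner_commute)
    finally show "inner ((transpose ?Q ** ?Q ** A_matrix c a j) *v x) y =
        inner x ((transpose ?Q ** ?Q ** A_matrix c a j) *v y)" .
  qed
qed

theorem theorem3p1:
  fixes c :: real
    and a b :: "'k::finite \<Rightarrow> real"
  assumes "c\<^sup>2 > 0"
    and "\<And>l. b l > 0"
    and "inj b"
    and "\<And>l. a l \<noteq> 0"
  shows "hyperbolic (A_matrix c a :: 'd::finite \<Rightarrow> real^('d, 'k) block_index^('d, 'k) block_index) \<and>
         strongly_well_posed
           (A_matrix c a :: 'd \<Rightarrow> real^('d, 'k) block_index^('d, 'k) block_index) (B_matrix b)"
proof -
  have "c \<noteq> 0" using assms(1) by auto
  from symmetrizable_system.hyperbolic [OF symmetrizable_system [OF this]]
    symmetrizable_system.strongly_well_posed [OF symmetrizable_system [OF this]]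
  show ?thesis by blast
qed

end
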